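(* Let $W$ be the affine Weyl group of type $\tilde B_2$ and let $u<w$ in $W$ with $a(u)\in\{1,2\}$ and $a(w)=4$. Then $\mu(u,w)=1$ if $l(w)-l(u)=1$, and $\mu(u,w)=0$ otherwise.
   Context: $W$ is the Coxeter group with simple reflections $r,s,t$ and relations $r^2=s^2=t^2=e$, $rt=tr$, $(rs)^4=(st)^4=e$; $l$ is the length and $<$ the Bruhat order. $a$ is Lusztig's $a$-function on $W$; its values on $W$ are $0$ (only at $e$), $1$, $2$, $4$. The elements with $a=1$ are the non-identity elements with a unique reduced expression; those with $a=2$ are $\{u\,rt(srt)^m\,v\mid u\in\{e,s,ts,rs\},\ v\in\{e,s,st,sr\},\ m\in\mathbb{N}\}$. $P_{u,w}$ are the Kazhdan–Lusztig polynomials and, for $u\le w$, $\mu(u,w)$ is the coefficient of $q^{\frac12(l(w)-l(u)-1)}$ in $P_{u,w}$ (zero if the exponent is not an integer). *)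

theory Defs
  imports
    "HOL-Library.Poly_Mapping"
    "HOL-Library.Extended_Nat"
    "HOL-Computational_Algebra.Polynomial"
begin

section \<open>The Coxeter group\<close>

datatype gen = Gr | Gs | Gt

text \<open>The presentation is taken in monoids, as a congruence on words; the generators are
  involutions, so this presents the same object as the group presentation.\<close>

inductive cox_eq :: "gen list \<Rightarrow> gen list \<Rightarrow> bool" where
  refl: "cox_eq u u"
| sym: "cox_eq u v \<Longrightarrow> cox_eq v u"
| trans: "cox_eq u v \<Longrightarrow> cox_eq v w \<Longrightarrow> cox_eq u w"
| context_closed: "cox_eq u v \<Longrightarrow> cox_eq (a @ u @ b) (a @ v @ b)"
| square: "cox_eq [g, g] []"
| rt: "cox_eq [Gr, Gt] [Gt, Gr]"
| rs: "cox_eq (concat (replicate 4 [Gr, Gs])) []"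
| st: "cox_eq (concat (replicate 4 [Gs, Gt])) []"

lemma equivp_cox_eq: "equivp cox_eq"
  by (intro equivpI reflpI sympI transpI) (blast intro: cox_eq.intros)+

quotient_type W = "gen list" / cox_eq morphisms rep_W of_word
  by (rule equivp_cox_eq)

lemma cox_eq_append: "cox_eq u u' \<Longrightarrow> cox_eq v v' \<Longrightarrow> cox_eq (u @ v) (u' @ v')"
  using cox_eq.context_closed[of u u' "[]" v] cox_eq.context_closed[of v v' u' "[]"]
  by (auto intro: cox_eq.trans)

instantiation W :: monoid_mult
begin

lift_definition one_W :: W is "[]" .

lift_definition times_W :: "W \<Rightarrow> W \<Rightarrow> W" is "(@)"
  by (rule cox_eq_append)

instance
  by standard (transfer, simp add: cox_eq.refl)+

end

lemma cox_eq_rev: "cox_eq u v \<Longrightarrow> cox_eq (rev u) (rev v)"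
proof (induction rule: cox_eq.induct)
  case rs
  have "cox_eq ([Gs] @ concat (replicate 4 [Gr, Gs]) @ [Gs]) ([Gs] @ [] @ [Gs])"
    by (intro cox_eq.context_closed cox_eq.rs)
  moreover have "cox_eq (concat (replicate 4 [Gs, Gr]) @ [Gs, Gs] @ [])
      (concat (replicate 4 [Gs, Gr]) @ [] @ [])"
    by (intro cox_eq.context_closed cox_eq.square)
  ultimately show ?case
    using cox_eq.square[of Gs]
    by (simp add: numeral_eq_Suc) (blast intro: cox_eq.sym cox_eq.trans)
next
  case st
  have "cox_eq ([Gt] @ concat (replicate 4 [Gs, Gt]) @ [Gt]) ([Gt] @ [] @ [Gt])"
    by (intro cox_eq.context_closed cox_eq.st)
  moreover have "cox_eq (concat (replicate 4 [Gt, Gs]) @ [Gt, Gt] @ [])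
      (concat (replicate 4 [Gt, Gs]) @ [] @ [])"
    by (intro cox_eq.context_closed cox_eq.square)
  ultimately show ?case
    using cox_eq.square[of Gt]
    by (simp add: numeral_eq_Suc) (blast intro: cox_eq.sym cox_eq.trans)
next
  case (context_closed u v a b)
  then show ?case
    using cox_eq.context_closed[of "rev u" "rev v" "rev b" "rev a"] by simp
qed (auto intro: cox_eq.intros)

instantiation W :: inverse
begin

lift_definition inverse_W :: "W \<Rightarrow> W" is rev
  by (rule cox_eq_rev)

definition divide_W :: "W \<Rightarrow> W \<Rightarrow> W" where
  "divide_W x y = x * inverse y"

instance ..

end

lemma W_left_inverse: "inverse x * x = (1 :: W)"
proof (transfer)
  fix u :: "gen list"
  show "cox_eq (rev u @ u) []"
  proof (induction u)
    case (Cons g u)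
    have "cox_eq (rev u @ [g, g] @ u) (rev u @ [] @ u)"
      by (intro cox_eq.context_closed cox_eq.square)
    then show ?case
      using Cons by (auto intro: cox_eq.trans)
  qed (simp add: cox_eq.refl)
qed

definition of_gen :: "gen \<Rightarrow> W" where
  "of_gen g = of_word [g]"

definition len :: "W \<Rightarrow> nat" where
  "len w = (LEAST n. \<exists>ws. length ws = n \<and> of_word ws = w)"

definition reduced_word :: "W \<Rightarrow> gen list" where
  "reduced_word w = (SOME ws. of_word ws = w \<and> length ws = len w)"

definition reflections :: "W set" where
  "reflections = {x * of_gen g * inverse x | x g. True}"

text \<open>The Bruhat order.\<close>

definition bruhat_step :: "W \<Rightarrow> W \<Rightarrow> bool" where
  "bruhat_step x y \<longleftrightarrow> (\<exists>\<tau>\<in>reflections. y = x * \<tau>) \<and> len x < len y"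

lemma bruhat_steps_len: "bruhat_step\<^sup>*\<^sup>* x y \<Longrightarrow> x = y \<or> len x < len y"
  by (induction rule: rtranclp_induct) (auto simp: bruhat_step_def)

instantiation W :: order
begin

definition less_eq_W :: "W \<Rightarrow> W \<Rightarrow> bool" where
  "x \<le> y \<longleftrightarrow> bruhat_step\<^sup>*\<^sup>* x y"

definition less_W :: "W \<Rightarrow> W \<Rightarrow> bool" where
  "x < y \<longleftrightarrow> x \<le> y \<and> x \<noteq> (y :: W)"

instance
proof
  fix x y z :: W
  show "x \<le> y \<Longrightarrow> y \<le> x \<Longrightarrow> x = y"
    unfolding less_eq_W_def by (fastforce dest: bruhat_steps_len)
  show "x < y \<longleftrightarrow> x \<le> y \<and> \<not> y \<le> x"
    unfolding less_W_def less_eq_W_def by (fastforce dest: bruhat_steps_len)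
  show "x \<le> x" by (simp add: less_eq_W_def)
  show "x \<le> y \<Longrightarrow> y \<le> z \<Longrightarrow> x \<le> z" by (simp add: less_eq_W_def)
qed

end

section \<open>The Hecke algebra\<close>

text \<open>The ground ring is the ring of Laurent polynomials in $v = q^{1/2}$ with integer
  coefficients, represented by finitely supported functions of the exponent of $v$, with the
  convolution product. The Hecke algebra is the free module with basis $T_w$
  ($w \in W$), so its elements are finitely supported functions on the group.\<close>

type_synonym laurent = "int \<Rightarrow>\<^sub>0 int"
type_synonym hecke = "W \<Rightarrow>\<^sub>0 laurent"

definition vpow :: "int \<Rightarrow> laurent" where
  "vpow k = Poly_Mapping.single k 1"

abbreviation q :: laurent where
  "q \<equiv> vpow 2"

definition laurent_bar :: "laurent \<Rightarrow> laurent" where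
  "laurent_bar p = Poly_Mapping.map_key uminus p"

definition hscale :: "laurent \<Rightarrow> hecke \<Rightarrow> hecke" where
  "hscale a h = Poly_Mapping.map ((*) a) h"

definition T :: "W \<Rightarrow> hecke" where
  "T w = Poly_Mapping.single w 1"

text \<open>The linear map that sends $T_w$ to $f(w)$.\<close>

definition lin_ext :: "(W \<Rightarrow> hecke) \<Rightarrow> hecke \<Rightarrow> hecke" where
  "lin_ext f h = (\<Sum>w\<in>Poly_Mapping.keys h. hscale (Poly_Mapping.lookup h w) (f w))"

text \<open>The product $T_g T_w$; the second case is the quadratic relation
  $(T_g - q)(T_g + 1) = 0$.\<close>

definition gen_mult_T :: "gen \<Rightarrow> W \<Rightarrow> hecke" where
  "gen_mult_T g w =
     (if len w < len (of_gen g * w) then T (of_gen g * w)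
      else hscale (q - 1) (T w) + hscale q (T (of_gen g * w)))"

definition T_mult :: "W \<Rightarrow> hecke \<Rightarrow> hecke" where
  "T_mult w k = foldr (\<lambda>g. lin_ext (gen_mult_T g)) (reduced_word w) k"

definition hmult :: "hecke \<Rightarrow> hecke \<Rightarrow> hecke" where
  "hmult h k = lin_ext (\<lambda>w. T_mult w k) h"

definition hinverse :: "hecke \<Rightarrow> hecke" where
  "hinverse h = (THE k. hmult h k = T 1 \<and> hmult k h = T 1)"

text \<open>The bar involution: $v \mapsto v^{-1}$ and $T_w \mapsto T_{w^{-1}}^{-1}$.\<close>

definition hbar :: "hecke \<Rightarrow> hecke" where
  "hbar h = (\<Sum>w\<in>Poly_Mapping.keys h.
     hscale (laurent_bar (Poly_Mapping.lookup h w)) (hinverse (T (inverse w))))"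

section \<open>Kazhdan--Lusztig polynomials\<close>

definition at_q :: "int poly \<Rightarrow> laurent" where
  "at_q p = poly (map_poly of_int p) q"

text \<open>$v^{-l(w)} \sum_{y \le w} p_y(q) T_y$\<close>

definition kl_combination :: "W \<Rightarrow> (W \<Rightarrow> int poly) \<Rightarrow> hecke" where
  "kl_combination w p = hscale (vpow (- int (len w))) (\<Sum>y\<in>{..w}. hscale (at_q (p y)) (T y))"

text \<open>\<open>KL_poly w y\<close> is the polynomial $P_{y,w}$. The degree condition is
  $\deg P_{y,w} \le \frac12 (l(w) - l(y) - 1)$.\<close>

definition KL_poly :: "W \<Rightarrow> W \<Rightarrow> int poly" where
  "KL_poly w = (THE p.
     (\<forall>y. \<not> y \<le> w \<longrightarrow> p y = 0) \<and>
     p w = 1 \<and>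
     (\<forall>y<w. 2 * Polynomial.degree (p y) + len y + 1 \<le> len w) \<and>
     hbar (kl_combination w p) = kl_combination w p)"

text \<open>The Kazhdan--Lusztig basis element $q^{-l(w)/2} \sum_{y \le w} P_{y,w} T_y$.\<close>

definition KL_basis :: "W \<Rightarrow> hecke" where
  "KL_basis w = kl_combination w (KL_poly w)"

text \<open>Meant for $u \le w$. If the difference of the lengths is even, the exponent
  $\frac12 (l(w) - l(u) - 1)$ is not an integer.\<close>

definition mu :: "W \<Rightarrow> W \<Rightarrow> int" where
  "mu u w = (if odd (len w - len u)
     then Polynomial.coeff (KL_poly w u) ((len w - len u - 1) div 2) else 0)"

section \<open>Lusztig's a-function\<close>

text \<open>The coefficients $h_{x,y,z}$ with $C_x C_y = \sum_z h_{x,y,z} C_z$, where $C$ is the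
  Kazhdan--Lusztig basis above. The basis with signs gives the same constants up to sign,
  so the same a-function.\<close>

definition struct_consts :: "W \<Rightarrow> W \<Rightarrow> (W \<Rightarrow>\<^sub>0 laurent)" where
  "struct_consts x y = (THE c. hmult (KL_basis x) (KL_basis y) = lin_ext KL_basis c)"

definition h_const :: "W \<Rightarrow> W \<Rightarrow> W \<Rightarrow> laurent" where
  "h_const x y z = Poly_Mapping.lookup (struct_consts x y) z"

text \<open>$a(z)$ is the least natural number $n$ such that $v^{-n} h_{x,y,z}$ is a polynomial
  in $v^{-1}$ for all $x$, $y$, and $\infty$ if there is none.\<close>

definition a_fun :: "W \<Rightarrow> enat" where
  "a_fun z = Inf {enat n | n. \<forall>x y. \<forall>k\<in>Poly_Mapping.keys (h_const x y z). k \<le> int n}"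

end

theory Submission
  imports Defs
begin

text \<open>
  Call an element fully commutative if no reduced expression of it contains \<open>rsrs\<close> or \<open>stst\<close>, and
  write $\tilde T_w = v^{-l(w)} T_w$.

  An element is fully commutative iff its $a$-value is not 4. Indeed the coefficients
  $f_{x,y,z}$ of $\tilde T_x \tilde T_y$ have degree at most 4, because they count folded galleries
  in the plane, and every fold reduces the number of directions of reflecting lines that separate
  the gallery's direction from its position. So $h_{x,y,z}$ and $f_{x,y,z}$ have the same coefficient
  of $v^4$, which is 1 for suitable \<open>x\<close> and \<open>y\<close> if \<open>z\<close> is not fully commutative. If \<open>z\<close> is fully
  commutative, the alcove of $z^{-1}$ lies in a common strip with the fundamental alcove, hence at
  most 3 folds occur for $f_{z,y,x} = f_{x,y^{-1},z}$.

  For the values of $\mu$, let \<open>w\<close> be not fully commutative. Then $w = x w_J y$ (reduced) with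
  $l(x) \le 3$. Modulo the span $I$ of the $C_z$ with \<open>z\<close> not fully commutative,
  $\tilde T_w \equiv - \sum_{z < w_J} v^{l(z) - 4} \tilde T_x \tilde T_{zy}$. Since
  $-\mu(u,w)$ is the coefficient of $v^{-1} C_u$ in $\tilde T_w$, an explicit expansion of these few
  products shows that a fully commutative \<open>u\<close> with $\mu(u,w) \ne 0$ is $x z y$ with $l(z) = 3$. It also
  shows that the left descents of such \<open>u\<close> are left descents of \<open>w\<close>, which makes $I$ a left ideal and
  keeps the induction on $l(w)$ going.
\<close>

section \<open>The group and its length function\<close>

text \<open>No Kazhdan-Lusztig polynomial is ever computed. The base change between
  \<open>Tn\<close> and \<open>KL_basis\<close> is the identity modulo v^-1, so \<open>mu\<close> is
  read off from its inverse to first order, and bounds on degrees pass from one basis to the other.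
  The difficulty is circular: multiplying a congruence modulo I by a generator needs I to be stable,
  which is the statement about descents itself. Hence I enters as \<open>not_fc_span n\<close>, with
  a bound on lengths, so that stability is used for shorter elements only. Three letters are enough
  because a longer left factor of w_J always exposes another braid further left. Lengths are
  compared through the action on the plane: a descent is a linear inequality between coordinates, so
  expansions become case distinctions. The number 4 is both the length of w_J and the number of
  directions of reflecting lines. In the upper bound for the a-function the obstacle is the strip 0
  < x - y < 2: the fundamental alcove spans the other three strips but only half of this one, so
  some of its alcoves need a segment between vertices instead of one ending at an interior
  point.\<close>

lemma of_word_Nil [simp]: "of_word [] = 1"
  by (simp add: one_W_def)

lemma of_word_append: "of_word (u @ v) = of_word u * of_word v"
  by transfer (rule cox_eq.refl)

lemma of_word_Cons: "of_word (g # u) = of_gen g * of_word u"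
  using of_word_append[of "[g]" u] by (simp add: of_gen_def)

lemma of_word_surj: obtains u where "of_word u = w"
  by transfer (use cox_eq.refl in auto)

lemma W_inverse_inverse [simp]: "inverse (inverse w) = (w :: W)"
  by transfer (simp add: cox_eq.refl)

lemma W_right_inverse: "w * inverse w = (1 :: W)"
  using W_left_inverse[of "inverse w"] by simp

lemma W_inv_cancel [simp]: "inverse x * (x * y) = y" "x * (inverse x * y) = (y :: W)"
  by (simp_all add: mult.assoc[symmetric] W_left_inverse W_right_inverse)

lemma W_left_cancel [simp]: "x * y = x * z \<longleftrightarrow> y = (z :: W)"
  by (metis W_inv_cancel(1))

lemma W_right_cancel [simp]: "y * x = z * x \<longleftrightarrow> y = (z :: W)"
  by (metis W_right_inverse mult.assoc mult.right_neutral)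

lemma W_inverse_mult: "inverse (x * y) = inverse y * inverse (x :: W)"
  by transfer (simp add: cox_eq.refl)

lemma W_inverse_unique: "x * y = 1 \<Longrightarrow> inverse x = (y :: W)"
  by (metis W_inv_cancel(1) mult.right_neutral)

lemma W_inverse_one [simp]: "inverse 1 = (1 :: W)"
  by (rule W_inverse_unique) simp

lemma gen_sq [simp]: "of_gen g * of_gen g = 1"
  unfolding of_gen_def by transfer (use cox_eq.square in simp)

lemma gen_sq_left [simp]: "of_gen g * (of_gen g * w) = w"
  by (simp add: mult.assoc[symmetric])

lemma inverse_of_gen [simp]: "inverse (of_gen g) = of_gen g"
  by (rule W_inverse_unique) simp

lemma gen_eq_iff: "of_gen g * x = y \<longleftrightarrow> x = of_gen g * y"
  by (metis gen_sq_left)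

lemma gen_eq_iff_right: "x * of_gen g = y \<longleftrightarrow> x = y * of_gen g"
  by (metis gen_sq mult.assoc mult.right_neutral)

lemma gen_comm: "of_gen Gr * of_gen Gt = of_gen Gt * of_gen Gr"
  unfolding of_gen_def by transfer (use cox_eq.rt in simp)

lemma gen_braid_aux:
  assumes "g = Gr \<or> g = Gt"
  shows "of_gen g * of_gen Gs * (of_gen g * of_gen Gs) * (of_gen g * of_gen Gs * (of_gen g * of_gen Gs)) = 1"
proof -
  have "of_word (concat (replicate 4 [Gr, Gs])) = 1"
    by transfer (use cox_eq.rs in simp)
  moreover have "of_word (concat (replicate 4 [Gs, Gt])) = 1"
    by transfer (use cox_eq.st in simp)
  ultimately have "of_gen Gr * of_gen Gs * (of_gen Gr * of_gen Gs) * (of_gen Gr * of_gen Gs * (of_gen Gr * of_gen Gs)) = 1"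
    and st: "of_gen Gs * of_gen Gt * (of_gen Gs * of_gen Gt) * (of_gen Gs * of_gen Gt * (of_gen Gs * of_gen Gt)) = 1"
    by (simp_all add: numeral_eq_Suc of_word_Cons mult.assoc)
  moreover have "of_gen Gt * of_gen Gs * (of_gen Gt * of_gen Gs) * (of_gen Gt * of_gen Gs * (of_gen Gt * of_gen Gs)) = 1"
    using arg_cong[OF st, of inverse] by (simp add: W_inverse_mult mult.assoc)
  ultimately show ?thesis using assms by auto
qed

lemma gen_braid:
  assumes "g = Gr \<or> g = Gt"
  shows "of_gen Gs * (of_gen g * (of_gen Gs * of_gen g)) = of_gen g * (of_gen Gs * (of_gen g * of_gen Gs))"
  using W_inverse_unique[OF gen_braid_aux[OF assms]] by (simp add: W_inverse_mult mult.assoc)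

lemma cox_eq_length: "cox_eq u v \<Longrightarrow> even (length u) = even (length v)"
  by (induction rule: cox_eq.induct) (auto simp: length_concat sum_list_replicate)

lemma len_le: "len (of_word ws) \<le> length ws"
  unfolding len_def by (rule Least_le) blast

lemma reduced_word_exists: "\<exists>ws. of_word ws = w \<and> length ws = len w"
proof -
  have "\<exists>n ws. length ws = n \<and> of_word ws = w" by (metis of_word_surj)
  from LeastI_ex[OF this] show ?thesis unfolding len_def by blast
qed

lemma reduced_word: "of_word (reduced_word w) = w" "length (reduced_word w) = len w"
  using someI_ex[OF reduced_word_exists[of w]] by (auto simp: reduced_word_def)

lemma len_even_word: "even (len (of_word ws)) = even (length ws)"
proof -
  have "cox_eq (reduced_word (of_word ws)) ws"
    using reduced_word(1)[of "of_word ws"] by (simp add: W.abs_eq_iff)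
  then show ?thesis using cox_eq_length reduced_word(2) by metis
qed

lemma len_mult_le: "len (x * y) \<le> len x + len y"
  by (metis len_le length_append of_word_append reduced_word)

lemma even_len_mult: "even (len (x * y)) \<longleftrightarrow> even (len x) = even (len y)"
  by (metis even_add len_even_word length_append of_word_append reduced_word(1))

lemma len_1 [simp]: "len 1 = 0"
  using len_le[of "[]"] by simp

lemma len_0_iff [simp]: "len w = 0 \<longleftrightarrow> w = 1"
  by (metis len_1 length_0_conv of_word_Nil reduced_word)

lemma len_of_gen [simp]: "len (of_gen g) = 1"
proof -
  have "len (of_gen g) \<le> 1" "odd (len (of_gen g))"
    using len_le[of "[g]"] len_even_word[of "[g]"] by (simp_all add: of_gen_def)
  then show ?thesis by (cases "len (of_gen g) = 0") (auto simp: le_Suc_eq)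
qed

lemma of_gen_neq_1 [simp]: "of_gen g \<noteq> 1"
  using len_of_gen[of g] by (metis len_1 zero_neq_one)

lemma len_inverse [simp]: "len (inverse w) = len w"
proof -
  have *: "len (inverse w) \<le> len w" for w
  proof -
    have "inverse (of_word (reduced_word w)) = of_word (rev (reduced_word w))"
      by (simp add: inverse_W.abs_eq)
    then show ?thesis using len_le[of "rev (reduced_word w)"] by (simp add: reduced_word)
  qed
  from *[of w] *[of "inverse w"] show ?thesis by simp
qed

abbreviation dsc :: "gen \<Rightarrow> W \<Rightarrow> bool" where
  "dsc g w \<equiv> len (of_gen g * w) < len w"

abbreviation rdsc :: "W \<Rightarrow> gen \<Rightarrow> bool" where
  "rdsc w g \<equiv> len (w * of_gen g) < len w"

lemma len_gen_cases: "len (of_gen g * w) = len w + 1 \<or> len w = len (of_gen g * w) + 1"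
proof -
  have "len (of_gen g * w) \<le> len w + 1" "len w \<le> len (of_gen g * w) + 1"
    using len_mult_le[of "of_gen g" w] len_mult_le[of "of_gen g" "of_gen g * w"] by simp_all
  moreover have "even (len (of_gen g * w)) \<noteq> even (len w)" by (simp add: even_len_mult)
  ultimately show ?thesis by presburger
qed

lemma len_asc: "\<not> dsc g w \<Longrightarrow> len (of_gen g * w) = Suc (len w)"
  and len_dsc: "dsc g w \<Longrightarrow> len w = Suc (len (of_gen g * w))"
  using len_gen_cases[of g w] by auto

lemma not_dsc_iff: "\<not> dsc g w \<longleftrightarrow> len w < len (of_gen g * w)"
  using len_gen_cases[of g w] by auto

lemma dsc_gen_mult [simp]: "dsc g (of_gen g * w) \<longleftrightarrow> \<not> dsc g w"
  using len_gen_cases[of g w] by auto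

lemma rdsc_iff: "rdsc w g \<longleftrightarrow> dsc g (inverse w)"
  by (metis W_inverse_mult inverse_of_gen len_inverse)

lemma dsc_iff: "dsc g w \<longleftrightarrow> rdsc (inverse w) g"
  using rdsc_iff[of "inverse w" g] by simp

lemma len_rgen_cases: "len (w * of_gen g) = len w + 1 \<or> len w = len (w * of_gen g) + 1"
  using len_gen_cases[of g "inverse w"] by (metis W_inverse_mult inverse_of_gen len_inverse)

lemma len_rasc: "\<not> rdsc w g \<Longrightarrow> len (w * of_gen g) = Suc (len w)"
  and len_rdsc: "rdsc w g \<Longrightarrow> len w = Suc (len (w * of_gen g))"
  using len_rgen_cases[of w g] by auto

lemma rdsc_gen_mult [simp]: "rdsc (w * of_gen g) g \<longleftrightarrow> \<not> rdsc w g"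
  using len_rgen_cases[of w g] by (auto simp: mult.assoc)

lemma exists_dsc: assumes "w \<noteq> 1" obtains g where "dsc g w"
proof -
  obtain g ws where gws: "reduced_word w = g # ws"
    using assms reduced_word(2)[of w] len_0_iff[of w] by (cases "reduced_word w") auto
  then have "of_gen g * w = of_word ws"
    using reduced_word(1)[of w] by (auto simp: of_word_Cons gen_eq_iff)
  then have "len (of_gen g * w) \<le> length ws" by (simp add: len_le)
  also have "\<dots> < len w" using reduced_word(2)[of w] gws by simp
  finally show thesis using that by blast
qed

lemma exists_rdsc: assumes "w \<noteq> 1" obtains g where "rdsc w g"
proof -
  have "inverse w \<noteq> 1" using assms by (metis W_inverse_inverse W_inverse_one)
  then show thesis using exists_dsc[of "inverse w"] that by (auto simp: rdsc_iff)
qed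

lemma W_left_induct [case_names one gen]:
  assumes "P 1" "\<And>g w. \<not> dsc g w \<Longrightarrow> P w \<Longrightarrow> P (of_gen g * w)"
  shows "P w"
proof (induction "len w" arbitrary: w)
  case 0 then show ?case using assms(1) by (metis len_0_iff)
next
  case (Suc n)
  then have "w \<noteq> 1" by auto
  then obtain g where g: "dsc g w" by (rule exists_dsc)
  then have "P (of_gen g * w)" using Suc len_dsc by (metis nat.inject)
  then show ?case using assms(2)[of g "of_gen g * w"] g by simp
qed

lemma W_right_induct [case_names one gen]:
  assumes "P 1" "\<And>g w. \<not> rdsc w g \<Longrightarrow> P w \<Longrightarrow> P (w * of_gen g)"
  shows "P w"
proof -
  have "P (inverse v)" for v
  proof (induction v rule: W_left_induct)
    case one show ?case using assms(1) by simp
  next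
    case (gen g v)
    then show ?case using assms(2)[of "inverse v" g] dsc_iff[of g v] by (simp add: W_inverse_mult)
  qed
  from this[of "inverse w"] show ?thesis by simp
qed

lemma finite_len: "finite {w. len w \<le> n}"
proof -
  have "finite (UNIV :: gen set)"
  proof -
    have "(UNIV :: gen set) = {Gr, Gs, Gt}" by (auto intro: gen.exhaust)
    then show ?thesis by (metis finite.emptyI finite_insert)
  qed
  then have "finite (of_word ` {ws. set ws \<subseteq> UNIV \<and> length ws \<le> n})"
    by (intro finite_imageI finite_lists_length_le)
  moreover have "{w. len w \<le> n} \<subseteq> of_word ` {ws. set ws \<subseteq> UNIV \<and> length ws \<le> n}"
  proof
    fix w assume "w \<in> {w. len w \<le> n}"
    then show "w \<in> of_word ` {ws. set ws \<subseteq> UNIV \<and> length ws \<le> n}"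
      using reduced_word[of w] by (intro image_eqI[of _ _ "reduced_word w"]) auto
  qed
  ultimately show ?thesis by (rule finite_subset[rotated])
qed

section \<open>Reflections and the Bruhat order\<close>

text \<open>The parity of the number of times that the reflection \<open>\<tau>\<close> occurs among
  $g_1 \cdots g_i \cdots g_1$ ($i \<le> n$) for the word $g_1 \cdots g_n$.\<close>

fun inv_par :: "gen list \<Rightarrow> W \<Rightarrow> bool" where
  "inv_par [] \<tau> \<longleftrightarrow> False"
| "inv_par (g # ws) \<tau> \<longleftrightarrow> (\<tau> = of_gen g) \<noteq> inv_par ws (of_gen g * \<tau> * of_gen g)"

lemma inv_par_append:
  "inv_par (u @ v) \<tau> \<longleftrightarrow> inv_par u \<tau> \<noteq> inv_par v (inverse (of_word u) * \<tau> * of_word u)"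
  by (induction u arbitrary: \<tau>) (auto simp: of_word_Cons W_inverse_mult mult.assoc)

lemma inv_par_conj:
  assumes "\<And>g. g \<in> set ws \<Longrightarrow> of_gen g * c = c * of_gen g"
  shows "inv_par ws (inverse c * \<tau> * c) \<longleftrightarrow> inv_par ws \<tau>"
  using assms
proof (induction ws arbitrary: \<tau>)
  case (Cons g ws)
  have gc: "of_gen g * c = c * of_gen g" using Cons.prems by simp
  then have gc': "of_gen g * inverse c = inverse c * of_gen g"
    by (metis W_inverse_mult inverse_of_gen)
  have "inverse c * \<tau> * c = of_gen g \<longleftrightarrow> \<tau> = of_gen g"
    by (metis W_inv_cancel(1) W_left_cancel W_right_cancel gc mult.assoc)
  moreover have "of_gen g * (inverse c * \<tau> * c) * of_gen g = inverse c * (of_gen g * \<tau> * of_gen g) * c"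
    by (metis gc gc' mult.assoc)
  ultimately show ?case using Cons by simp
qed simp

text \<open>The four-letter word represents the central longest element of a dihedral group of order
  8, so by \<open>inv_par_conj\<close> both halves of the relator have the same parity and
  cancel.\<close>

lemma inv_par_dihedral:
  assumes "g = Gr \<or> g = Gt"
  shows "\<not> inv_par ([g, Gs, g, Gs] @ [g, Gs, g, Gs]) \<tau>" "\<not> inv_par ([Gs, g, Gs, g] @ [Gs, g, Gs, g]) \<tau>"
proof -
  let ?c = "of_gen g * (of_gen Gs * (of_gen g * of_gen Gs))"
  have eq: "of_word [g, Gs, g, Gs] = ?c" "of_word [Gs, g, Gs, g] = ?c"
    using gen_braid[OF assms] by (simp_all add: of_word_Cons)
  have 1: "of_gen g * ?c = ?c * of_gen g"
    by (subst gen_braid[OF assms, symmetric]) (simp add: mult.assoc gen_braid[OF assms])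
  have 2: "of_gen Gs * ?c = ?c * of_gen Gs"
    by (subst gen_braid[OF assms, symmetric]) (simp add: mult.assoc)
  have 3: "of_gen h * ?c = ?c * of_gen h" if "h \<in> {g, Gs}" for h
    using 1 2 that by auto
  show "\<not> inv_par ([g, Gs, g, Gs] @ [g, Gs, g, Gs]) \<tau>"
    unfolding inv_par_append eq by (subst inv_par_conj) (use 3 in auto)
  show "\<not> inv_par ([Gs, g, Gs, g] @ [Gs, g, Gs, g]) \<tau>"
    unfolding inv_par_append eq by (subst inv_par_conj) (use 3 in auto)
qed

lemma gen_conj_iff: "of_gen g * \<tau> * of_gen g = of_gen g \<longleftrightarrow> \<tau> = of_gen g"
  by (metis gen_sq gen_sq_left mult.assoc mult.left_neutral mult.right_neutral)

text \<open>Each defining relation preserves the parity, and contexts are harmless because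
  equivalent words conjugate \<open>\<tau>\<close> in the same way. So the parity is a function on
  the group, which gives the exchange property.\<close>

lemma inv_par_cong: "cox_eq u v \<Longrightarrow> inv_par u \<tau> = inv_par v \<tau>"
proof (induction arbitrary: \<tau> rule: cox_eq.induct)
  case (context_closed u v a b)
  then have "of_word u = of_word v" by (simp add: W.abs_eq_iff)
  with context_closed show ?case by (simp add: inv_par_append of_word_append)
next
  case (square g)
  show ?case by (auto simp: gen_conj_iff)
next
  case rt
  have "of_gen Gr * \<tau> * of_gen Gr = of_gen Gt \<longleftrightarrow> \<tau> = of_gen Gt"
    and "of_gen Gt * \<tau> * of_gen Gt = of_gen Gr \<longleftrightarrow> \<tau> = of_gen Gr"
    by (metis gen_comm gen_sq gen_sq_left mult.assoc mult.right_neutral)+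
  then show ?case by auto
next
  case rs
  have "concat (replicate 4 [Gr, Gs]) = [Gr, Gs, Gr, Gs] @ [Gr, Gs, Gr, Gs]" by (simp add: numeral_eq_Suc)
  then show ?case using inv_par_dihedral(1)[of Gr \<tau>] by (simp only: inv_par.simps(1)) simp
next
  case st
  have "concat (replicate 4 [Gs, Gt]) = [Gs, Gt, Gs, Gt] @ [Gs, Gt, Gs, Gt]" by (simp add: numeral_eq_Suc)
  then show ?case using inv_par_dihedral(2)[of Gt \<tau>] by (simp only: inv_par.simps(1)) simp
qed auto

lift_definition is_inv :: "W \<Rightarrow> W \<Rightarrow> bool" is "\<lambda>u \<tau>. inv_par u \<tau>"
  by (rule ext) (rule inv_par_cong)

lemma is_inv_of_word: "is_inv (of_word u) \<tau> = inv_par u \<tau>"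
  by (simp add: is_inv.abs_eq)

lemma is_inv_mult: "is_inv (x * y) \<tau> \<longleftrightarrow> is_inv x \<tau> \<noteq> is_inv y (inverse x * \<tau> * x)"
  by (metis inv_par_append is_inv_of_word of_word_append of_word_surj)

lemma is_inv_1 [simp]: "\<not> is_inv 1 \<tau>"
  using is_inv_of_word[of "[]"] by simp

lemma is_inv_gen: "is_inv (of_gen g) \<tau> \<longleftrightarrow> \<tau> = of_gen g"
  using is_inv_of_word[of "[g]"] by (simp add: of_gen_def)

text \<open>The contributions of \<open>x\<close> and \<open>inverse x\<close> cancel because their
  product is 1; the generator in the middle leaves an odd count.\<close>

lemma is_inv_self:
  assumes "\<tau> \<in> reflections"
  shows "is_inv \<tau> \<tau>"
proof -
  obtain x g where \<tau>: "\<tau> = x * of_gen g * inverse x" using assms by (auto simp: reflections_def)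
  have 0: "\<not> is_inv (x * inverse x) \<tau>" by (simp add: W_right_inverse)
  have "is_inv \<tau> \<tau> \<longleftrightarrow> is_inv x \<tau> \<noteq> is_inv (of_gen g * inverse x) (inverse x * \<tau> * x)"
    by (subst (1) \<tau>) (simp add: is_inv_mult mult.assoc)
  also have "inverse x * \<tau> * x = of_gen g" by (simp add: \<tau> mult.assoc W_left_inverse)
  finally show ?thesis
    using 0 by (simp add: is_inv_mult is_inv_gen \<tau> mult.assoc W_left_inverse)
qed

lemma inv_par_deletion: "inv_par ws \<tau> \<Longrightarrow> \<exists>vs. length vs < length ws \<and> \<tau> * of_word ws = of_word vs"
proof (induction ws arbitrary: \<tau>)
  case (Cons g ws)
  show ?case
  proof (cases "\<tau> = of_gen g")
    case True then show ?thesis by (intro exI[of _ ws]) (simp add: of_word_Cons)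
  next
    case False
    then obtain vs where "length vs < length ws" "of_gen g * \<tau> * of_gen g * of_word ws = of_word vs"
      using Cons by auto
    then show ?thesis
      by (intro exI[of _ "g # vs"]) (simp add: of_word_Cons mult.assoc flip: gen_eq_iff)
  qed
qed simp

lemma reflection_sq: "\<tau> \<in> reflections \<Longrightarrow> \<tau> * \<tau> = 1"
  by (auto simp: reflections_def mult.assoc W_right_inverse)

lemma reflection_conj: "\<tau> \<in> reflections \<Longrightarrow> x * \<tau> * inverse x \<in> reflections"
  unfolding reflections_def by (clarsimp, metis W_inverse_mult mult.assoc)

lemma gen_reflection: "of_gen g \<in> reflections"
  unfolding reflections_def by (clarsimp, metis W_inverse_one mult.left_neutral mult.right_neutral)

text \<open>Deleting a letter gives one direction. For the other, \<open>is_inv_self\<close> shows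
  that multiplication by \<open>\<tau>\<close> flips the parity, so the same argument applies to
  \<open>\<tau> * w\<close>.\<close>

lemma strong_exchange:
  assumes "\<tau> \<in> reflections"
  shows "len (\<tau> * w) < len w \<longleftrightarrow> is_inv w \<tau>"
proof -
  have *: "len (\<tau> * w) < len w" if "is_inv w \<tau>" for w
  proof -
    have "inv_par (reduced_word w) \<tau>" using that by (metis is_inv_of_word reduced_word(1))
    then show ?thesis using inv_par_deletion[of "reduced_word w"] by (metis len_le le_less_trans reduced_word)
  qed
  have "is_inv (\<tau> * w) \<tau>" if "\<not> is_inv w \<tau>"
  proof -
    have "inverse \<tau> * \<tau> * \<tau> = \<tau>" by (simp add: W_left_inverse)
    then show ?thesis using that is_inv_self[OF assms] by (simp add: is_inv_mult)
  qed
  then have "len w < len (\<tau> * w)" if "\<not> is_inv w \<tau>"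
    using *[of "\<tau> * w"] that by (simp add: mult.assoc[symmetric] reflection_sq[OF assms])
  with * show ?thesis by (metis less_asym)
qed

lemma bruhat_step_iff: "bruhat_step x y \<longleftrightarrow> (\<exists>\<tau>\<in>reflections. y = \<tau> * x) \<and> len x < len y"
proof -
  have "(\<exists>\<tau>\<in>reflections. y = x * \<tau>) \<longleftrightarrow> (\<exists>\<tau>\<in>reflections. y = \<tau> * x)"
  proof (safe, goal_cases)
    case (1 \<tau>)
    then show ?case using reflection_conj[of \<tau> x] by (auto intro!: bexI[of _ "x * \<tau> * inverse x"] simp: mult.assoc W_left_inverse)
  next
    case (2 \<tau>)
    then show ?case using reflection_conj[of \<tau> "inverse x"] by (auto intro!: bexI[of _ "inverse x * \<tau> * x"] simp: mult.assoc)
  qed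
  then show ?thesis by (simp add: bruhat_step_def)
qed

lemma bruhat_step_le: "bruhat_step x y \<Longrightarrow> x \<le> y"
  by (simp add: less_eq_W_def)

lemma less_len: "x < y \<Longrightarrow> len x < len (y :: W)"
  using bruhat_steps_len[of x y] by (auto simp: less_W_def less_eq_W_def)

lemma le_len: "x \<le> y \<Longrightarrow> len x \<le> len (y :: W)"
  by (metis le_less less_W_def less_len)

lemma less_gen: "\<not> dsc g w \<Longrightarrow> w < of_gen g * w"
proof -
  assume g: "\<not> dsc g w"
  then have "bruhat_step w (of_gen g * w)"
    unfolding bruhat_step_iff using gen_reflection[of g] len_asc[OF g] by auto
  moreover have "w \<noteq> of_gen g * w" using len_asc[OF g] by (metis n_not_Suc_n)
  ultimately show ?thesis unfolding less_W_def using bruhat_step_le by blast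
qed

lemma gen_less: "dsc g w \<Longrightarrow> of_gen g * w < w"
  using less_gen[of g "of_gen g * w"] by simp

text \<open>Conjugation by \<open>of_gen g\<close> matches the inversions of \<open>y\<close> and
  \<open>of_gen g * y\<close> except for \<open>of_gen g\<close> itself. So a step can be reversed
  only if its reflection is \<open>of_gen g\<close>.\<close>

lemma bruhat_step_gen:
  assumes "bruhat_step x y"
  shows "bruhat_step (of_gen g * x) (of_gen g * y) \<or> of_gen g * x = y"
proof -
  obtain \<tau> where \<tau>: "\<tau> \<in> reflections" "y = \<tau> * x" "len x < len y"
    using assms by (auto simp: bruhat_step_iff)
  let ?\<tau> = "of_gen g * \<tau> * of_gen g"
  have refl: "?\<tau> \<in> reflections" using reflection_conj[OF \<tau>(1), of "of_gen g"] by simp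
  have gy: "of_gen g * y = ?\<tau> * (of_gen g * x)" and gx: "?\<tau> * (of_gen g * y) = of_gen g * x"
    using reflection_sq[OF \<tau>(1)] by (simp_all add: \<tau> mult.assoc) (simp add: mult.assoc[symmetric])
  show ?thesis
  proof (cases "len (of_gen g * x) < len (of_gen g * y)")
    case True
    then show ?thesis using refl gy by (auto simp: bruhat_step_iff)
  next
    case False
    have "is_inv y \<tau>"
      using strong_exchange[OF \<tau>(1), of y] \<tau> reflection_sq[OF \<tau>(1)] by (simp add: mult.assoc[symmetric])
    moreover have "\<not> is_inv (of_gen g * y) ?\<tau>"
      using False strong_exchange[OF refl, of "of_gen g * y"] gx by simp
    moreover have "of_gen g * ?\<tau> * of_gen g = \<tau>" by (simp add: mult.assoc)
    ultimately have "?\<tau> = of_gen g"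
      unfolding is_inv_mult by (simp add: is_inv_gen)
    then show ?thesis using \<tau>(2) by (simp add: gen_conj_iff)
  qed
qed

lemma le_gen_cases: "y \<le> w \<Longrightarrow> of_gen g * y \<le> w \<or> of_gen g * y \<le> of_gen g * w"
  unfolding less_eq_W_def
proof (induction rule: converse_rtranclp_induct)
  case (step y z)
  then show ?case using bruhat_step_gen[OF step(1), of g] by (metis converse_rtranclp_into_rtranclp)
qed simp

lemma le_gen_cases': "y \<le> w \<Longrightarrow> y \<le> of_gen g * w \<or> of_gen g * y \<le> of_gen g * w"
  unfolding less_eq_W_def
proof (induction rule: rtranclp_induct)
  case (step w z)
  have "bruhat_step\<^sup>*\<^sup>* y z" using step by simp
  then show ?case using step bruhat_step_gen[OF step(2), of g]
    by (metis gen_sq_left rtranclp.rtrancl_into_rtrancl)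
qed simp

lemma gen_mult_le: "y \<le> w \<Longrightarrow> \<not> dsc g w \<Longrightarrow> of_gen g * y \<le> of_gen g * w"
  using le_gen_cases[of y w g] less_gen[of g w] by auto

lemma lifting: "u \<le> of_gen g * w \<Longrightarrow> dsc g u \<Longrightarrow> of_gen g * u \<le> w"
  using le_gen_cases'[of u "of_gen g * w" g] gen_less[of g u] by auto

lemma lifting': "u \<le> of_gen g * w \<Longrightarrow> \<not> dsc g u \<Longrightarrow> u \<le> w"
  using le_gen_cases'[of u "of_gen g * w" g] less_gen[of g u] by auto

lemma dsc_is_inv: "dsc g w \<longleftrightarrow> is_inv w (of_gen g)"
  by (rule strong_exchange[OF gen_reflection])

text \<open>\<open>w\<close> and \<open>w * of_gen h\<close> differ in the single inversion w h
  w^-1, so a left descent changes only if this reflection is \<open>of_gen g\<close>.\<close>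

lemma dsc_rmult: "dsc g (w * of_gen h) \<longleftrightarrow> dsc g w \<noteq> (of_gen g * w = w * of_gen h)"
proof -
  have "inverse w * of_gen g * w = of_gen h \<longleftrightarrow> of_gen g * w = w * of_gen h"
    by (metis W_inv_cancel mult.assoc)
  then show ?thesis by (simp add: dsc_is_inv is_inv_mult is_inv_gen)
qed

lemma rdsc_lmult: "rdsc (of_gen g * w) h \<longleftrightarrow> rdsc w h \<noteq> (of_gen g * w = w * of_gen h)"
proof -
  have "of_gen h * inverse w = inverse w * of_gen g \<longleftrightarrow> of_gen g * w = w * of_gen h"
    by (metis W_inverse_inverse W_inverse_mult inverse_of_gen)
  then show ?thesis using dsc_rmult[of h "inverse w" g] by (simp add: rdsc_iff W_inverse_mult)
qed

section \<open>The action on the plane\<close>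

text \<open>The reflecting lines are those where x, y, (x+y)/2 or (x-y)/2 is an integer. The
  fundamental alcove is the triangle 0 < y < x < 1; its special vertices are (0,0), fixed by
  \<open>Gr\<close> and \<open>Gs\<close>, and (1,1), fixed by \<open>Gs\<close> and
  \<open>Gt\<close>.\<close>

fun refl_pt :: "gen \<Rightarrow> real \<times> real \<Rightarrow> real \<times> real" where
  "refl_pt Gr (x, y) = (x, - y)"
| "refl_pt Gs (x, y) = (y, x)"
| "refl_pt Gt (x, y) = (2 - x, y)"

text \<open>The fundamental alcove is the set where all \<open>wall g\<close> are positive.\<close>

fun wall :: "gen \<Rightarrow> real \<times> real \<Rightarrow> real" where
  "wall Gr (x, y) = y"
| "wall Gs (x, y) = x - y"
| "wall Gt (x, y) = 1 - x"

lemma refl_pt_sq [simp]: "refl_pt g (refl_pt g P) = P"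
  by (cases g; cases P) auto

lemma wall_refl_pt [simp]: "wall g (refl_pt g P) = - wall g P"
  by (cases g; cases P) auto

lemma foldr_refl_cong: "cox_eq u v \<Longrightarrow> foldr refl_pt u P = foldr refl_pt v P"
proof (induction arbitrary: P rule: cox_eq.induct)
  case rt then show ?case by (cases P) auto
next
  case rs then show ?case by (cases P) (auto simp: numeral_eq_Suc)
next
  case st then show ?case by (cases P) (auto simp: numeral_eq_Suc)
qed auto

lift_definition act :: "W \<Rightarrow> real \<times> real \<Rightarrow> real \<times> real" is "foldr refl_pt"
  by (rule ext) (rule foldr_refl_cong)

lemma act_1 [simp]: "act 1 P = P"
  by transfer simp

lemma act_mult: "act (x * y) P = act x (act y P)"
  by transfer simp

lemma act_gen [simp]: "act (of_gen g) P = refl_pt g P"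
  unfolding of_gen_def by transfer simp

text \<open>The words h, hg, hgh are the nontrivial elements of a dihedral group of order 8 without
  left descent \<open>g\<close>; they turn \<open>wall g\<close> into combinations of
  \<open>wall g\<close> and \<open>wall h\<close> with nonnegative integer coefficients, not both
  zero. The slack \<open>e\<close> covers the closed alcove (e = 0) and its interior (e > 0) at
  once.\<close>

lemma wall_dihedral:
  assumes "g \<noteq> h" "{g, h} \<noteq> {Gr, Gt}" "0 \<le> e" "e \<le> wall g P" "e \<le> wall h P"
  shows "e \<le> wall g (refl_pt h P)" "e \<le> wall g (refl_pt h (refl_pt g P))"
    "e \<le> wall g (refl_pt h (refl_pt g (refl_pt h P)))"
  using assms by (cases P; cases g; cases h; auto)+

lemma gen_braid':
  assumes "g \<noteq> h" "{g, h} \<noteq> {Gr, Gt}"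
  shows "of_gen g * (of_gen h * (of_gen g * (of_gen h * w))) = of_gen h * (of_gen g * (of_gen h * (of_gen g * w)))"
proof -
  have "of_gen g * (of_gen h * (of_gen g * of_gen h)) = of_gen h * (of_gen g * (of_gen h * of_gen g))"
    using assms by (cases g; cases h) (auto simp: gen_braid)
  from arg_cong[OF this, of "\<lambda>x. x * w"] show ?thesis by (simp add: mult.assoc)
qed

lemma gen_comm': "of_gen Gr * (of_gen Gt * w) = of_gen Gt * (of_gen Gr * w)"
  by (metis gen_comm mult.assoc)

text \<open>Peel off the part of \<open>w\<close> in a rank two parabolic subgroup containing \<open>g\<close>.\<close>

lemma wall_act:
  assumes "\<And>h. e \<le> wall h P" "0 \<le> e" "\<not> dsc g w"
  shows "e \<le> wall g (act w P)"
  using assms(3)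
proof (induction "len w" arbitrary: w g rule: less_induct)
  case less
  show ?case
  proof (cases "w = 1")
    case True then show ?thesis using assms(1) by simp
  next
    case False
    then obtain h where h: "dsc h w" by (rule exists_dsc)
    with less.prems have gh: "g \<noteq> h" by auto
    define w1 where "w1 = of_gen h * w"
    have w1: "w = of_gen h * w1" "\<not> dsc h w1" "len w = Suc (len w1)"
      using h len_dsc[OF h] by (auto simp: w1_def)
    have step: "e \<le> wall k (act v P)" if "len v < len w" "\<not> dsc k v" for v k
      using less.hyps that by blast
    show ?thesis
    proof (cases "{g, h} = {Gr, Gt}")
      case True
      have "\<not> dsc g w1"
      proof
        assume "dsc g w1"
        have "of_gen g * w = of_gen h * (of_gen g * w1)"
          using True gh by (auto simp: w1 doubleton_eq_iff gen_comm')
        then have "len (of_gen g * w) \<le> Suc (len (of_gen g * w1))"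
          using len_gen_cases[of h "of_gen g * w1"] by auto
        with \<open>dsc g w1\<close> w1(3) less.prems show False by simp
      qed
      then have "e \<le> wall g (act w1 P)" using step w1 by simp
      moreover have "wall g (refl_pt h Q) = wall g Q" for Q
        using True by (cases Q) (auto simp: doubleton_eq_iff)
      ultimately show ?thesis by (simp add: w1 act_mult)
    next
      case False
      note wd = wall_dihedral[OF gh False \<open>0 \<le> e\<close>]
      show ?thesis
      proof (cases "dsc g w1")
        case False
        then have "e \<le> wall g (act w1 P)" "e \<le> wall h (act w1 P)" using step w1 by auto
        then show ?thesis using wd(1) by (simp add: w1 act_mult)
      next
        case True
        define w2 where "w2 = of_gen g * w1"
        have w2: "w1 = of_gen g * w2" "\<not> dsc g w2" "len w1 = Suc (len w2)"
          using True len_dsc[OF True] by (auto simp: w2_def)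
        show ?thesis
        proof (cases "dsc h w2")
          case False
          then have "e \<le> wall g (act w2 P)" "e \<le> wall h (act w2 P)" using step w1 w2 by auto
          then show ?thesis using wd(2) by (simp add: w1 w2 act_mult)
        next
          case True
          define w3 where "w3 = of_gen h * w2"
          have w3: "w2 = of_gen h * w3" "\<not> dsc h w3" "len w2 = Suc (len w3)"
            using True len_dsc[OF True] by (auto simp: w3_def)
          have "\<not> dsc g w3"
          proof
            assume *: "dsc g w3"
            have "of_gen g * w = of_gen h * (of_gen g * (of_gen h * (of_gen g * w3)))"
              using gen_braid'[OF gh \<open>{g, h} \<noteq> {Gr, Gt}\<close>] by (simp add: w1 w2 w3)
            then have "len (of_gen g * w) \<le> Suc (Suc (Suc (len (of_gen g * w3))))"
              using len_gen_cases[of h "of_gen g * (of_gen h * (of_gen g * w3))"]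
                len_gen_cases[of g "of_gen h * (of_gen g * w3)"] len_gen_cases[of h "of_gen g * w3"] by auto
            with * w1(3) w2(3) w3(3) less.prems show False by simp
          qed
          then have "e \<le> wall g (act w3 P)" "e \<le> wall h (act w3 P)" using step w1 w2 w3 by auto
          then show ?thesis using wd(3) by (simp add: w1 w2 w3 act_mult)
        qed
      qed
    qed
  qed
qed

text \<open>The bound \<open>wall_act\<close> is applied to \<open>w\<close> and to
  \<open>of_gen g * w\<close>: exactly one of them lacks the descent, and \<open>refl_pt g\<close>
  changes the sign of the wall.\<close>

lemma wall_act_dsc:
  assumes "\<And>h. 0 < wall h P"
  shows "dsc g w \<longleftrightarrow> wall g (act w P) < 0"
proof -
  define e where "e = min (wall Gr P) (min (wall Gs P) (wall Gt P))"
  have "e \<le> wall h P" for h by (cases h) (auto simp: e_def)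
  moreover have "0 < e" using assms by (simp add: e_def)
  ultimately have *: "0 < wall g (act w P)" if "\<not> dsc g w" for w
    using wall_act[of e P g w] that by force
  from *[of w] *[of "of_gen g * w"] show ?thesis
    by (cases "dsc g w") (auto simp: act_mult simp del: not_less)
qed

text \<open>This point is fixed by the symmetry (x,y) -> (1-y,1-x) of the fundamental alcove, which
  exchanges \<open>Gr\<close> and \<open>Gt\<close>.\<close>

definition base_pt :: "real \<times> real" where
  "base_pt = (3/4, 1/4)"

lemma wall_base_pt: "0 < wall g base_pt"
  by (cases g) (auto simp: base_pt_def)

lemmas dsc_base = wall_act_dsc[of base_pt, OF wall_base_pt]

lemma wall_base_neq_0: "wall g (act w base_pt) \<noteq> 0"
  using dsc_base[of g w] dsc_base[of g "of_gen g * w"] len_gen_cases[of g w] by (auto simp: act_mult)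

section \<open>Laurent polynomials\<close>

abbreviation "lookup \<equiv> Poly_Mapping.lookup"
abbreviation "keys \<equiv> Poly_Mapping.keys"

abbreviation xi :: laurent where
  "xi \<equiv> vpow 1 - vpow (- 1)"

lemma vpow_add: "vpow a * vpow b = vpow (a + b)"
  by (simp add: vpow_def mult_single)

lemma vpow_0 [simp]: "vpow 0 = 1"
  by (simp add: vpow_def)

lemma vpow_cancel [simp]: "vpow a * (vpow (- a) * p) = p" "vpow (- a) * (vpow a * p) = p"
  by (simp_all add: mult.assoc[symmetric] vpow_add)

lemma lookup_vpow: "lookup (vpow k) j = (if j = k then 1 else 0)"
  by (simp add: vpow_def lookup_single when_def)

lemma laurent_single: "p = (\<Sum>k\<in>keys p. Poly_Mapping.single k (lookup p k))" for p :: laurent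
  by (rule poly_mapping_eqI) (simp add: lookup_sum lookup_single when_def in_keys_iff)

lemma lookup_vpow_mult [simp]: "lookup (vpow k * p) j = lookup p (j - k)"
proof -
  have eq: "k + i = j \<longleftrightarrow> i = j - k" for i by auto
  have "vpow k * p = (\<Sum>i\<in>keys p. Poly_Mapping.single (k + i) (lookup p i))"
    using arg_cong[OF laurent_single[of p], of "\<lambda>p. vpow k * p"]
    by (simp only: sum_distrib_left vpow_def mult_single mult_1)
  then have "lookup (vpow k * p) j = (\<Sum>i\<in>keys p. if i = j - k then lookup p i else 0)"
    by (simp add: lookup_sum lookup_single when_def eq)
  then show ?thesis by (simp add: in_keys_iff)
qed

lemma vpow_cancel' [simp]: "vpow a * (p * vpow (- a)) = p"
  by (simp add: mult.commute[of p])

lemma lookup_vpow_mult' [simp]: "lookup (p * vpow k) j = lookup p (j - k)"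
  by (simp add: mult.commute[of p])

lemma lookup_of_int_mult [simp]: "lookup (of_int c * p) j = c * lookup p (j :: int)"
proof -
  have "of_int c * p = Poly_Mapping.map ((*) c) p"
    by (simp add: mult_map_scale_conv_mult flip: single_of_int)
  then show ?thesis by (simp add: map.rep_eq when_def)
qed

lemma lookup_of_int_eq: "lookup (of_int c :: laurent) j = (if j = 0 then c else 0)"
  by (simp add: lookup_of_int when_def)

lemma lookup_xi_mult: "lookup (xi * p) j = lookup p (j - 1) - lookup p (j + 1)"
  by (simp add: left_diff_distrib lookup_minus)

lemma laurent_expand: "p = (\<Sum>k\<in>keys p. of_int (lookup p k) * vpow k)" for p :: laurent
proof -
  have "of_int c * vpow k = Poly_Mapping.single k c" for c k
    by (simp add: vpow_def mult_single flip: single_of_int)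
  then show ?thesis using laurent_single[of p] by simp
qed

lemma lookup_bar [simp]: "lookup (laurent_bar p) k = lookup p (- k)"
  by (simp add: laurent_bar_def map_key.rep_eq)

lemma bar_add: "laurent_bar (p + r) = laurent_bar p + laurent_bar r"
  by (rule poly_mapping_eqI) (simp add: lookup_add)

lemma bar_0 [simp]: "laurent_bar 0 = 0"
  by (rule poly_mapping_eqI) simp

lemma bar_sum: "laurent_bar (sum f A) = (\<Sum>x\<in>A. laurent_bar (f x))"
  by (induction A rule: infinite_finite_induct) (auto simp: bar_add)

lemma bar_mult: "laurent_bar (p * r) = laurent_bar p * laurent_bar r"
proof -
  have 1: "laurent_bar (of_int c * vpow k) = of_int c * vpow (- k)" for c k
    by (rule poly_mapping_eqI) (auto simp: lookup_of_int_eq)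
  have *: "laurent_bar (of_int c * vpow k * r) = laurent_bar (of_int c * vpow k) * laurent_bar r" for c k
    unfolding 1 by (rule poly_mapping_eqI) (simp add: mult.assoc)
  have "laurent_bar (p * r) = (\<Sum>k\<in>keys p. laurent_bar (of_int (lookup p k) * vpow k * r))"
    using arg_cong[OF laurent_expand[of p], of "\<lambda>p. laurent_bar (p * r)"]
    by (simp only: sum_distrib_right bar_sum)
  also have "\<dots> = (\<Sum>k\<in>keys p. laurent_bar (of_int (lookup p k) * vpow k)) * laurent_bar r"
    by (simp only: * sum_distrib_right)
  also have "(\<Sum>k\<in>keys p. laurent_bar (of_int (lookup p k) * vpow k)) = laurent_bar p"
    using arg_cong[OF laurent_expand[of p], of laurent_bar] by (simp only: bar_sum)
  finally show ?thesis .
qed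

lemma bar_vpow [simp]: "laurent_bar (vpow k) = vpow (- k)"
  by (rule poly_mapping_eqI) (auto simp: lookup_vpow)

lemma bar_of_int [simp]: "laurent_bar (of_int c) = of_int c"
  by (rule poly_mapping_eqI) (auto simp: lookup_of_int when_def)

lemma bar_1 [simp]: "laurent_bar 1 = 1"
  using bar_of_int[of 1] by simp

section \<open>The Hecke algebra\<close>

lemma lookup_hscale [simp]: "lookup (hscale a h) w = a * lookup h w"
  by (simp add: hscale_def map.rep_eq when_def)

lemma hscale_laws [simp]:
  "hscale 1 h = h" "hscale 0 h = 0" "hscale a 0 = 0" "hscale a (hscale b h) = hscale (a * b) h"
  by (auto intro!: poly_mapping_eqI simp: mult.assoc)

lemma hscale_distribs:
  "hscale a (h + k) = hscale a h + hscale a k" "hscale (a + b) h = hscale a h + hscale b h"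
  "hscale a (h - k) = hscale a h - hscale a k" "hscale (a - b) h = hscale a h - hscale b h"
  "hscale a (- h) = - hscale a h" "hscale (- a) h = - hscale a h"
  by (auto intro!: poly_mapping_eqI simp: lookup_add lookup_minus algebra_simps)

lemma hscale_sum: "hscale a (sum f A) = (\<Sum>x\<in>A. hscale a (f x))"
  by (induction A rule: infinite_finite_induct) (auto simp: hscale_distribs)

lemma lookup_T: "lookup (T w) u = (if u = w then 1 else 0)"
  by (simp add: T_def lookup_single when_def)

definition hlin :: "(hecke \<Rightarrow> hecke) \<Rightarrow> bool" where
  "hlin F \<longleftrightarrow> (\<forall>h k. F (h + k) = F h + F k) \<and> (\<forall>a h. F (hscale a h) = hscale a (F h))"

lemma hlinI: "(\<And>h k. F (h + k) = F h + F k) \<Longrightarrow> (\<And>a h. F (hscale a h) = hscale a (F h)) \<Longrightarrow> hlin F"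
  by (simp add: hlin_def)

lemma hlin_add: "hlin F \<Longrightarrow> F (h + k) = F h + F k"
  and hlin_scale: "hlin F \<Longrightarrow> F (hscale a h) = hscale a (F h)"
  by (simp_all add: hlin_def)

lemma hlin_0: "hlin F \<Longrightarrow> F 0 = 0"
  using hlin_scale[of F 0 0] by simp

lemma hlin_minus: "hlin F \<Longrightarrow> F (- h) = - F h"
  using hlin_scale[of F "- 1" h] by (simp add: hscale_distribs)

lemma hlin_diff: "hlin F \<Longrightarrow> F (h - k) = F h - F k"
  using hlin_add[of F h "- k"] by (simp add: hlin_minus)

lemma hlin_sum: "hlin F \<Longrightarrow> F (sum f A) = (\<Sum>x\<in>A. F (f x))"
  by (induction A rule: infinite_finite_induct) (auto simp: hlin_0 hlin_add)

lemma hlin_comp: "hlin F \<Longrightarrow> hlin G \<Longrightarrow> hlin (\<lambda>h. F (G h))"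
  by (simp add: hlin_def)

lemma hlin_diff_fun: "hlin F \<Longrightarrow> hlin G \<Longrightarrow> hlin (\<lambda>h. F h - G h)"
  by (simp add: hlin_def hscale_distribs)

lemma hlin_id: "hlin (\<lambda>h. h)"
  by (simp add: hlin_def)

text \<open>In this normalisation the quadratic relation reads T^2 = 1 + \<open>xi\<close> T, and
  the bar involution just negates \<open>xi\<close>.\<close>

definition Tn :: "W \<Rightarrow> hecke" where
  "Tn w = hscale (vpow (- int (len w))) (T w)"

text \<open>The coefficient with respect to the basis $v^{-l(w)} T_w$.\<close>

definition tc :: "hecke \<Rightarrow> W \<Rightarrow> laurent" where
  "tc h w = vpow (int (len w)) * lookup h w"

lemma tc_0_iff: "tc h w = 0 \<longleftrightarrow> w \<notin> keys h"
proof
  assume "tc h w = 0"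
  then have "vpow (- int (len w)) * tc h w = 0" by simp
  then show "w \<notin> keys h" by (simp add: tc_def in_keys_iff)
qed (simp add: tc_def in_keys_iff)

lemma tc_eqI: assumes "\<And>w. tc h w = tc k w" shows "h = k"
proof (rule poly_mapping_eqI)
  fix w
  have "vpow (- int (len w)) * tc h w = vpow (- int (len w)) * tc k w" by (simp add: assms)
  then show "lookup h w = lookup k w" by (simp add: tc_def)
qed

lemma tc_linear [simp]:
  "tc 0 w = 0" "tc (h + k) w = tc h w + tc k w" "tc (h - k) w = tc h w - tc k w"
  "tc (- h) w = - tc h w" "tc (hscale a h) w = a * tc h w"
  by (simp_all add: tc_def lookup_add lookup_minus algebra_simps)

lemma tc_sum: "tc (sum f A) w = (\<Sum>x\<in>A. tc (f x) w)"
  by (induction A rule: infinite_finite_induct) auto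

lemma tc_Tn: "tc (Tn w) u = (if u = w then 1 else 0)"
  by (simp add: tc_def Tn_def lookup_T vpow_add)

lemma T_eq_Tn: "T w = hscale (vpow (int (len w))) (Tn w)"
  by (simp add: Tn_def vpow_add)

lemma Tn_1: "Tn 1 = T 1"
  by (simp add: Tn_def)

lemma Tn_expand: "finite A \<Longrightarrow> keys h \<subseteq> A \<Longrightarrow> h = (\<Sum>w\<in>A. hscale (tc h w) (Tn w))"
  by (rule tc_eqI) (auto simp: tc_sum tc_Tn if_distrib tc_0_iff cong: if_cong)

lemma hlin_ext:
  assumes "hlin F" "hlin G" "\<And>w. F (Tn w) = G (Tn w)"
  shows "F h = G h"
proof -
  have h: "h = (\<Sum>w\<in>keys h. hscale (tc h w) (Tn w))" by (rule Tn_expand) auto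
  have "F h = (\<Sum>w\<in>keys h. hscale (tc h w) (G (Tn w)))"
    using arg_cong[OF h, of F] by (simp only: hlin_sum[OF assms(1)] hlin_scale[OF assms(1)] assms(3))
  also have "\<dots> = G h"
    using arg_cong[OF h, of G] by (simp only: hlin_sum[OF assms(2)] hlin_scale[OF assms(2)])
  finally show ?thesis .
qed

lemma lin_ext_superset:
  "finite A \<Longrightarrow> keys h \<subseteq> A \<Longrightarrow> lin_ext f h = (\<Sum>w\<in>A. hscale (lookup h w) (f w))"
  unfolding lin_ext_def by (rule sum.mono_neutral_left) (auto simp: in_keys_iff)

lemma hlin_lin_ext: "hlin (lin_ext f)"
proof (rule hlinI)
  fix h k :: hecke and a
  have "keys (h + k) \<subseteq> keys h \<union> keys k" by (rule keys_add)
  then show "lin_ext f (h + k) = lin_ext f h + lin_ext f k"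
    by (simp add: lin_ext_superset[of "keys h \<union> keys k"] lookup_add hscale_distribs sum.distrib)
  have "keys (hscale a h) \<subseteq> keys h" by (auto simp: in_keys_iff)
  then show "lin_ext f (hscale a h) = hscale a (lin_ext f h)"
    by (simp add: lin_ext_superset[of "keys h"] hscale_sum)
qed

lemma lin_ext_T [simp]: "lin_ext f (T w) = f w"
  using lin_ext_superset[of "{w}" "T w" f] by (simp add: T_def)

text \<open>This will turn out to be left multiplication by \<open>Tn (of_gen g)\<close>. It is
  treated as an operator because \<open>hmult\<close> rests on chosen reduced words and is not yet
  known to be associative.\<close>

definition Lt :: "gen \<Rightarrow> hecke \<Rightarrow> hecke" where
  "Lt g h = hscale (vpow (- 1)) (lin_ext (gen_mult_T g) h)"

lemma hlin_hscale: "hlin (hscale a)"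
  by (rule hlinI) (auto simp: hscale_distribs mult.commute)

lemma hlin_Lt: "hlin (Lt g)"
  unfolding Lt_def by (rule hlin_comp[OF hlin_hscale hlin_lin_ext])

lemma Lt_Tn: "Lt g (Tn w) = Tn (of_gen g * w) + (if dsc g w then hscale xi (Tn w) else 0)"
proof (cases "dsc g w")
  case False
  then have "int (len (of_gen g * w)) = int (len w) + 1" using len_asc[OF False] by simp
  then show ?thesis using False
    by (simp add: Tn_def Lt_def hlin_scale[OF hlin_lin_ext] gen_mult_T_def not_dsc_iff vpow_add minus_diff_commute)
next
  case True
  then have len: "int (len (of_gen g * w)) = int (len w) - 1" using len_dsc[OF True] by simp
  show ?thesis using True
    by (simp add: Tn_def Lt_def hlin_scale[OF hlin_lin_ext] gen_mult_T_def vpow_add len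
        hscale_distribs left_diff_distrib right_diff_distrib minus_diff_commute)
qed

lemma gen_neq [simp]: "of_gen g * u \<noteq> u" "u * of_gen g \<noteq> u"
  by (metis of_gen_neq_1 W_right_cancel mult.left_neutral)
     (metis of_gen_neq_1 W_left_cancel mult.right_neutral)

lemmas gen_neq' [simp] = gen_neq[symmetric]

lemma tc_Lt: "tc (Lt g h) u = tc h (of_gen g * u) + (if dsc g u then xi * tc h u else 0)"
proof -
  let ?A = "keys h \<union> {u, of_gen g * u}"
  have h: "h = (\<Sum>w\<in>?A. hscale (tc h w) (Tn w))" by (rule Tn_expand) auto
  have "tc (Lt g h) u = tc (Lt g (\<Sum>w\<in>?A. hscale (tc h w) (Tn w))) u"
    by (rule arg_cong[OF h, of "\<lambda>h. tc (Lt g h) u"])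
  also have "\<dots> = (\<Sum>w\<in>?A. tc h w * tc (Lt g (Tn w)) u)"
    by (simp add: hlin_sum[OF hlin_Lt] hlin_scale[OF hlin_Lt] tc_sum)
  also have "\<dots> = (\<Sum>w\<in>{u, of_gen g * u}. tc h w * tc (Lt g (Tn w)) u)"
    by (rule sum.mono_neutral_right) (auto simp: Lt_Tn tc_Tn)
  also have "\<dots> = tc h (of_gen g * u) + (if dsc g u then xi * tc h u else 0)"
    by (cases "dsc g u") (simp_all add: Lt_Tn tc_Tn gen_eq_iff)
  finally show ?thesis .
qed

definition flip :: "hecke \<Rightarrow> hecke" where
  "flip h = Poly_Mapping.map_key inverse h"

lemma inj_W_inverse: "inj (inverse :: W \<Rightarrow> W)"
  by (metis W_inverse_inverse injI)

lemma tc_flip [simp]: "tc (flip h) w = tc h (inverse w)"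
  by (simp add: tc_def flip_def map_key.rep_eq inj_W_inverse)

lemma hlin_flip: "hlin flip"
  by (rule hlinI) (auto intro!: tc_eqI)

definition Rt :: "gen \<Rightarrow> hecke \<Rightarrow> hecke" where
  "Rt g h = flip (Lt g (flip h))"

lemma hlin_Rt: "hlin (Rt g)"
  unfolding Rt_def by (intro hlin_comp[OF hlin_flip] hlin_comp[OF hlin_Lt] hlin_flip)

lemma tc_Rt: "tc (Rt g h) u = tc h (u * of_gen g) + (if rdsc u g then xi * tc h u else 0)"
  by (simp add: Rt_def tc_Lt W_inverse_mult rdsc_iff)

lemma Rt_Tn: "Rt g (Tn w) = Tn (w * of_gen g) + (if rdsc w g then hscale xi (Tn w) else 0)"
  by (rule tc_eqI) (auto simp: tc_Rt tc_Tn gen_eq_iff_right)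

text \<open>This commutation is the source of associativity and of independence from the chosen
  reduced words. The delicate case is g u = u h, where both multiplications move between the same
  two elements.\<close>

lemma Lt_Rt: "Lt g (Rt h a) = Rt h (Lt g a)"
proof (rule tc_eqI)
  fix u
  show "tc (Lt g (Rt h a)) u = tc (Rt h (Lt g a)) u"
  proof (cases "of_gen g * u = u * of_gen h")
    case True
    then have "rdsc u h \<longleftrightarrow> dsc g u" by simp
    moreover have "rdsc (of_gen g * u) h \<longleftrightarrow> \<not> rdsc u h" "dsc g (u * of_gen h) \<longleftrightarrow> \<not> dsc g u"
      using True rdsc_lmult dsc_rmult by blast+
    moreover have "of_gen g * (u * of_gen h) = u" using True by (metis gen_sq_left)
    ultimately show ?thesis using True
      by (auto simp: tc_Lt tc_Rt mult.assoc)
  next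
    case False
    then have "rdsc (of_gen g * u) h \<longleftrightarrow> rdsc u h" "dsc g (u * of_gen h) \<longleftrightarrow> dsc g u"
      using rdsc_lmult dsc_rmult by blast+
    then show ?thesis
      by (auto simp: tc_Lt tc_Rt mult.assoc algebra_simps)
  qed
qed

lemma Lt_Lt: "Lt g (Lt g h) = h + hscale xi (Lt g h)"
  by (rule tc_eqI) (auto simp: tc_Lt not_dsc_iff algebra_simps)

lemma foldr_Lt_Rt: "foldr Lt ws (Rt g h) = Rt g (foldr Lt ws h)"
  by (induction ws) (auto simp: Lt_Rt)

lemma foldr_Lt_fold_Rt: "foldr Lt ws (fold Rt vs h) = fold Rt vs (foldr Lt ws h)"
  by (induction vs arbitrary: h) (auto simp: foldr_Lt_Rt)

lemma hlin_foldr: "hlin (foldr Lt ws)"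
proof (induction ws)
  case (Cons g ws)
  then show ?case using hlin_comp[OF hlin_Lt[of g], of "foldr Lt ws"] by (simp add: comp_def)
qed (simp add: hlin_id[unfolded id_def] hlin_def)

lemma foldr_Lt_Tn: "length ws = len (of_word ws) \<Longrightarrow> foldr Lt ws (Tn 1) = Tn (of_word ws)"
proof (induction ws)
  case (Cons g ws)
  have le: "len (of_word ws) \<le> length ws" by (rule len_le)
  have le2: "len (of_gen g * of_word ws) \<le> Suc (len (of_word ws))"
    using len_gen_cases[of g "of_word ws"] by auto
  have eq: "length ws = len (of_word ws)" and "\<not> dsc g (of_word ws)"
    using Cons.prems le le2 by (auto simp: of_word_Cons)
  then show ?case using Cons.IH by (simp add: of_word_Cons Lt_Tn)
qed simp

lemma fold_Rt_Tn: "length ws = len (of_word ws) \<Longrightarrow> fold Rt ws (Tn 1) = Tn (of_word ws)"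
proof (induction ws rule: rev_induct)
  case (snoc g ws)
  have le: "len (of_word ws) \<le> length ws" by (rule len_le)
  have w: "of_word (ws @ [g]) = of_word ws * of_gen g" by (simp add: of_word_append of_gen_def)
  have le2: "len (of_word ws * of_gen g) \<le> Suc (len (of_word ws))"
    using len_rgen_cases[of "of_word ws" g] by auto
  have eq: "length ws = len (of_word ws)" and "\<not> rdsc (of_word ws) g"
    using snoc.prems le le2 by (auto simp: w)
  then show ?case using snoc.IH by (simp add: w Rt_Tn)
qed simp

lemma lin_ext_gen_mult: "lin_ext (gen_mult_T g) h = hscale (vpow 1) (Lt g h)"
  by (simp add: Lt_def vpow_add)

lemma T_mult_eq: "T_mult w k = hscale (vpow (int (len w))) (foldr Lt (reduced_word w) k)"
proof -
  have "foldr (\<lambda>g. lin_ext (gen_mult_T g)) ws k = hscale (vpow (int (length ws))) (foldr Lt ws k)" for ws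
    by (induction ws) (simp_all add: lin_ext_gen_mult hlin_scale[OF hlin_Lt] vpow_add)
  then show ?thesis by (simp add: T_mult_def reduced_word)
qed

lemma hlin_hmult_left: "hlin (\<lambda>h. hmult h k)"
  unfolding hmult_def by (rule hlin_lin_ext)

lemma hmult_Tn: "hmult (Tn w) k = foldr Lt (reduced_word w) k"
  by (simp add: hmult_def Tn_def hlin_scale[OF hlin_lin_ext] T_mult_eq vpow_add)

lemma hlin_hmult_right: "hlin (hmult a)"
proof (rule hlinI)
  fix h k c
  show "hmult a (h + k) = hmult a h + hmult a k"
    by (rule hlin_ext[of "\<lambda>a. hmult a (h + k)" "\<lambda>a. hmult a h + hmult a k"])
       (auto simp: hlin_def hlin_hmult_left[unfolded hlin_def] hscale_distribs hmult_Tn hlin_add[OF hlin_foldr])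
  show "hmult a (hscale c h) = hscale c (hmult a h)"
    by (rule hlin_ext[of "\<lambda>a. hmult a (hscale c h)" "\<lambda>a. hscale c (hmult a h)"])
       (auto simp: hlin_def hlin_hmult_left[unfolded hlin_def] hscale_distribs hmult_Tn hlin_scale[OF hlin_foldr] mult.commute)
qed

lemma hmult_Rt: "hmult a (Rt g b) = Rt g (hmult a b)"
  by (rule hlin_ext[OF hlin_hmult_left hlin_comp[OF hlin_Rt hlin_hmult_left]])
     (simp add: hmult_Tn foldr_Lt_Rt)

lemma hmult_1_left [simp]: "hmult (Tn 1) k = k"
proof -
  have "reduced_word 1 = []" using reduced_word(2)[of 1] by simp
  then show ?thesis by (simp add: hmult_Tn)
qed

lemma hmult_1_right [simp]: "hmult h (Tn 1) = h"
  by (rule hlin_ext[OF hlin_hmult_left hlin_id]) (simp add: hmult_Tn foldr_Lt_Tn reduced_word)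

lemma hmult_fold_Rt: "hmult a (fold Rt ws b) = fold Rt ws (hmult a b)"
  by (induction ws arbitrary: b) (auto simp: hmult_Rt)

lemma hmult_Tn_right: "hmult h (Tn w) = fold Rt (reduced_word w) h"
  using hmult_fold_Rt[of h "reduced_word w" "Tn 1"] by (simp add: fold_Rt_Tn reduced_word)

text \<open>By linearity \<open>c\<close> may be taken to be some \<open>Tn w\<close>. Right
  multiplication by it is a composite of operators \<open>Rt\<close>, which commute with
  \<open>hmult a\<close>.\<close>

lemma hmult_assoc: "hmult (hmult a b) c = hmult a (hmult b c)"
  by (rule hlin_ext[OF hlin_hmult_right hlin_comp[OF hlin_hmult_right hlin_hmult_right]])
     (simp add: hmult_Tn_right hmult_fold_Rt)

lemma hmult_gen_right: "hmult h (Tn (of_gen g)) = Rt g h"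
  using hmult_Rt[of h g "Tn 1"] rdsc_iff[of 1 g] by (simp add: Rt_Tn)

lemma hmult_gen_left: "hmult (Tn (of_gen g)) k = Lt g k"
  by (rule hlin_ext[OF hlin_hmult_right hlin_Lt])
     (simp add: hmult_Tn_right foldr_Lt_fold_Rt[of "[g]", simplified, symmetric] fold_Rt_Tn reduced_word
       Lt_Tn[of g 1, simplified, symmetric])

lemma hmult_gen_Tn: "\<not> rdsc x g \<Longrightarrow> hmult (Tn (x * of_gen g)) k = hmult (Tn x) (Lt g k)"
  using hmult_assoc[of "Tn x" "Tn (of_gen g)" k] by (simp add: hmult_gen_right hmult_gen_left Rt_Tn)

lemma Lt_hmult: "Lt g (hmult a b) = hmult (Lt g a) b"
  using hmult_assoc[of "Tn (of_gen g)" a b] by (simp add: hmult_gen_left)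

section \<open>The bar involution\<close>

definition Lti :: "gen \<Rightarrow> hecke \<Rightarrow> hecke" where
  "Lti g h = Lt g h - hscale xi h"

lemma Lt_Lti [simp]: "Lt g (Lti g h) = h" "Lti g (Lt g h) = h"
  by (simp_all add: Lti_def hlin_diff[OF hlin_Lt] hlin_scale[OF hlin_Lt] Lt_Lt)

lemma hinverse_eqI:
  assumes "hmult h k = T 1" "hmult k h = T 1"
  shows "hinverse h = k"
  unfolding hinverse_def
proof (rule the_equality)
  fix k' assume "hmult h k' = T 1 \<and> hmult k' h = T 1"
  then show "k' = k"
    using hmult_assoc[of k h k'] assms by (metis Tn_1 hmult_1_left hmult_1_right)
qed (use assms in blast)

lemma hlin_Lti: "hlin (Lti g)"
  unfolding Lti_def by (rule hlin_diff_fun[OF hlin_Lt hlin_hscale])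

text \<open>The future image of \<open>Tn w\<close> under \<open>hbar\<close>, see
  \<open>hbar_Tn\<close>.\<close>

definition bn :: "W \<Rightarrow> hecke" where
  "bn w = hscale (vpow (int (len w))) (hinverse (T (inverse w)))"

lemma bn_eqI:
  assumes "hmult (Tn (inverse w)) k = Tn 1" "hmult k (Tn (inverse w)) = Tn 1"
  shows "bn w = k"
proof -
  have "hinverse (T (inverse w)) = hscale (vpow (- int (len w))) k"
    by (rule hinverse_eqI)
       (use assms in \<open>simp_all add: T_eq_Tn[of "inverse w"] hlin_scale[OF hlin_hmult_left]
          hlin_scale[OF hlin_hmult_right] vpow_add Tn_1\<close>)
  then show ?thesis by (simp add: bn_def vpow_add)
qed

text \<open>Since \<open>hinverse\<close> is a definite description, the recursion needs inverses on
  both sides; these are carried along in an induction on the length.\<close>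

lemma bn_gen: "\<not> dsc g w \<Longrightarrow> bn (of_gen g * w) = Lti g (bn w)"
proof -
  have step: "hmult (Tn (inverse (of_gen h * v))) (Lti h k) = Tn 1"
    "hmult (Lti h k) (Tn (inverse (of_gen h * v))) = Tn 1"
    if "hmult (Tn (inverse v)) k = Tn 1" "hmult k (Tn (inverse v)) = Tn 1" "\<not> dsc h v" for h v k
  proof -
    have r: "\<not> rdsc (inverse v) h" using that(3) dsc_iff[of h v] by simp
    show "hmult (Tn (inverse (of_gen h * v))) (Lti h k) = Tn 1"
      using that r by (simp add: W_inverse_mult hmult_gen_Tn)
    have "hmult (Lti h k) (Tn (inverse (of_gen h * v))) = Rt h (hmult (Lti h k) (Tn (inverse v)))"
      using r by (simp add: W_inverse_mult hmult_Rt[symmetric] Rt_Tn)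
    also have "hmult (Lti h k) (Tn (inverse v)) = Lti h (Tn 1)"
      using that(2) by (simp add: Lti_def hlin_diff[OF hlin_hmult_left] hlin_scale[OF hlin_hmult_left] flip: Lt_hmult)
    also have "Rt h (Lti h (Tn 1)) = Lti h (Rt h (Tn 1))"
      by (simp add: Lti_def hlin_diff[OF hlin_Rt] hlin_scale[OF hlin_Rt] Lt_Rt)
    also have "Rt h (Tn 1) = Lt h (Tn 1)" by (simp add: Rt_Tn Lt_Tn)
    finally show "hmult (Lti h k) (Tn (inverse (of_gen h * v))) = Tn 1" by simp
  qed
  have inv: "hmult (Tn (inverse w)) (bn w) = Tn 1 \<and> hmult (bn w) (Tn (inverse w)) = Tn 1" for w
  proof (induction w rule: W_left_induct)
    case one
    have "bn 1 = Tn 1" by (rule bn_eqI) simp_all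
    then show ?case by simp
  next
    case (gen h v)
    then have "bn (of_gen h * v) = Lti h (bn v)" using step by (intro bn_eqI) auto
    then show ?case using step gen by auto
  qed
  show "\<not> dsc g w \<Longrightarrow> bn (of_gen g * w) = Lti g (bn w)" using step inv by (intro bn_eqI) auto
qed

lemma bn_1 [simp]: "bn 1 = Tn 1"
  by (rule bn_eqI) simp_all

lemma hbar_superset:
  assumes "finite A" "keys h \<subseteq> A"
  shows "hbar h = (\<Sum>w\<in>A. hscale (laurent_bar (tc h w)) (bn w))"
proof -
  have "hscale (laurent_bar (tc h w)) (bn w) = hscale (laurent_bar (lookup h w)) (hinverse (T (inverse w)))" for w
    by (simp add: tc_def bn_def bar_mult mult.commute mult.assoc vpow_add)
  then have "hbar h = (\<Sum>w\<in>keys h. hscale (laurent_bar (tc h w)) (bn w))" by (simp add: hbar_def)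
  also have "\<dots> = (\<Sum>w\<in>A. hscale (laurent_bar (tc h w)) (bn w))"
    by (rule sum.mono_neutral_left) (use assms in \<open>auto simp: tc_0_iff[THEN iffD2]\<close>)
  finally show ?thesis .
qed

lemma hbar_add: "hbar (h + k) = hbar h + hbar k"
proof -
  have "keys (h + k) \<subseteq> keys h \<union> keys k" by (rule keys_add)
  then show ?thesis
    by (simp add: hbar_superset[of "keys h \<union> keys k"] bar_add hscale_distribs sum.distrib)
qed

lemma hbar_scale: "hbar (hscale a h) = hscale (laurent_bar a) (hbar h)"
proof -
  have "keys (hscale a h) \<subseteq> keys h" by (auto simp: in_keys_iff)
  then show ?thesis by (simp add: hbar_superset[of "keys h"] bar_mult hscale_sum)
qed

lemma hbar_0 [simp]: "hbar 0 = 0"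
  by (simp add: hbar_def)

lemma hbar_diff: "hbar (h - k) = hbar h - hbar k"
  using hbar_add[of "h - k" k] by simp

lemma hbar_sum: "hbar (sum f A) = (\<Sum>x\<in>A. hbar (f x))"
  by (induction A rule: infinite_finite_induct) (auto simp: hbar_add)

lemma hbar_Tn: "hbar (Tn w) = bn w"
proof -
  have "u = w" if "u \<in> keys (Tn w)" for u
    using that tc_0_iff[of "Tn w" u] by (auto simp: tc_Tn split: if_splits)
  then have "keys (Tn w) \<subseteq> {w}" by auto
  then show ?thesis by (simp add: hbar_superset[of "{w}"] tc_Tn)
qed

lemma hbar_Lt: "hbar (Lt g h) = Lti g (hbar h)"
proof -
  have Tn: "hbar (Lt g (Tn w)) = Lti g (bn w)" for w
  proof (cases "dsc g w")
    case True
    then have "bn w = Lti g (bn (of_gen g * w))" using bn_gen[of g "of_gen g * w"] by simp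
    then have "Lt g (bn w) = bn (of_gen g * w)" by simp
    then show ?thesis using True by (simp add: Lt_Tn hbar_add hbar_diff hbar_scale hbar_Tn Lti_def hscale_distribs)
  qed (simp add: Lt_Tn hbar_Tn bn_gen)
  have h: "h = (\<Sum>w\<in>keys h. hscale (tc h w) (Tn w))" by (rule Tn_expand) auto
  have "hbar (Lt g h) = (\<Sum>w\<in>keys h. hscale (laurent_bar (tc h w)) (Lti g (bn w)))"
    using arg_cong[OF h, of "\<lambda>h. hbar (Lt g h)"]
    by (simp only: hlin_sum[OF hlin_Lt] hlin_scale[OF hlin_Lt] hbar_sum hbar_scale Tn)
  also have "\<dots> = Lti g (hbar h)"
    by (simp add: hbar_superset[of "keys h"] hlin_sum[OF hlin_Lti] hlin_scale[OF hlin_Lti])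
  finally show ?thesis .
qed

definition Ct :: "gen \<Rightarrow> hecke \<Rightarrow> hecke" where
  "Ct g h = Lt g h + hscale (vpow (- 1)) h"

lemma hlin_Ct: "hlin (Ct g)"
  by (rule hlinI) (auto simp: Ct_def hlin_add[OF hlin_Lt] hlin_scale[OF hlin_Lt] hscale_distribs mult.commute)

lemma hbar_Ct: "hbar (Ct g h) = Ct g (hbar h)"
  by (simp add: Ct_def hbar_add hbar_scale hbar_Lt Lti_def hscale_distribs)

text \<open>Triangularity by length, weaker than by Bruhat order, is all that the uniqueness
  argument needs.\<close>

lemma tc_bn: "(tc (bn w) u \<noteq> 0 \<longrightarrow> u = w \<or> len u < len w) \<and> tc (bn w) w = 1"
proof (induction w arbitrary: u rule: W_left_induct)
  case one then show ?case by (simp add: tc_Tn)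
next
  case (gen g w)
  have len: "len (of_gen g * w) = Suc (len w)" using gen by (simp add: len_asc)
  have "tc (bn w) (of_gen g * w) = 0" using gen(2)[of "of_gen g * w"] len by auto
  moreover have "tc (bn w) u = 0" "tc (bn w) (of_gen g * u) = 0" if "u \<noteq> of_gen g * w" "\<not> len u < len (of_gen g * w)"
    using gen(2)[of u] gen(2)[of "of_gen g * u"] that len len_gen_cases[of g u] by (auto simp: gen_eq_iff)
  ultimately have "tc (bn (of_gen g * w)) u = 0"
    if "u \<noteq> of_gen g * w" "\<not> len u < len (of_gen g * w)"
    using that gen(1) by (simp add: bn_gen Lti_def tc_Lt)
  moreover have "tc (bn (of_gen g * w)) (of_gen g * w) = 1"
    using \<open>tc (bn w) (of_gen g * w) = 0\<close> gen by (simp add: bn_gen Lti_def tc_Lt)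
  ultimately show ?case by blast
qed

lemma finite_max_len:
  assumes "finite A" "A \<noteq> {}"
  shows "\<exists>u\<in>A. \<forall>w\<in>A. len w \<le> len u"
proof -
  have "Max (len ` A) \<in> len ` A" using assms by (intro Max_in) auto
  then obtain u where "u \<in> A" "len u = Max (len ` A)" by auto
  then show ?thesis using assms by (intro bexI[of _ u]) auto
qed

text \<open>At an element of maximal length in the support, triangularity makes the coefficient
  itself invariant under v -> v^-1, which is impossible with negative exponents only.\<close>

lemma bar_invariant_eq_0:
  assumes "hbar h = h" "\<And>w k. lookup (tc h w) k \<noteq> 0 \<Longrightarrow> k < 0"
  shows "h = 0"
proof (rule ccontr)
  assume "h \<noteq> 0"
  then have "keys h \<noteq> {}" by auto
  then obtain u where u: "u \<in> keys h" "\<And>w. w \<in> keys h \<Longrightarrow> len w \<le> len u"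
    using finite_max_len[of "keys h"] by auto
  have "tc h u = tc (hbar h) u" by (simp add: assms)
  also have "\<dots> = (\<Sum>w\<in>keys h. laurent_bar (tc h w) * tc (bn w) u)"
    by (simp add: hbar_superset[of "keys h"] tc_sum)
  also have "\<dots> = (\<Sum>w\<in>keys h. if w = u then laurent_bar (tc h u) else 0)"
  proof (rule sum.cong)
    fix w assume "w \<in> keys h"
    then have "\<not> len u < len w" using u(2)[of w] by simp
    then show "laurent_bar (tc h w) * tc (bn w) u = (if w = u then laurent_bar (tc h u) else 0)"
      using tc_bn[of w u] by auto
  qed simp
  also have "\<dots> = laurent_bar (tc h u)" using u by simp
  finally have bar: "tc h u = laurent_bar (tc h u)" .
  obtain k where k: "lookup (tc h u) k \<noteq> 0"
    using u(1) tc_0_iff[of h u] by (metis lookup_zero poly_mapping_eqI)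
  then have "lookup (tc h u) (- k) \<noteq> 0" using bar by (metis lookup_bar)
  then show False using assms(2)[of u k] assms(2)[of u "- k"] k by simp
qed

section \<open>The Kazhdan--Lusztig basis\<close>

text \<open>With \<open>tc C u\<close> = v^(l(u)-l(w)) P(v^2), the exponent conditions say that P is
  a polynomial in q with the prescribed degree bound. The last clause says P(0) = 1 and settles the
  case of length difference 1.\<close>

definition is_KL :: "W \<Rightarrow> hecke \<Rightarrow> bool" where
  "is_KL w C \<longleftrightarrow> hbar C = C \<and> tc C w = 1 \<and> (\<forall>u. tc C u \<noteq> 0 \<longrightarrow> u \<le> w) \<and>
     (\<forall>u k. u \<noteq> w \<longrightarrow> lookup (tc C u) k \<noteq> 0 \<longrightarrow>
        k < 0 \<and> int (len u) - int (len w) \<le> k \<and> even (k + int (len w) - int (len u))) \<and>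
     (\<forall>u\<le>w. lookup (tc C u) (int (len u) - int (len w)) = 1)"

lemma is_KL_support:
  assumes "is_KL w C" "lookup (tc C u) k \<noteq> 0"
  shows "u = w \<and> k = 0 \<or> u < w \<and> len u < len w \<and> k < 0 \<and> int (len u) - int (len w) \<le> k \<and>
    even (k + int (len w) - int (len u))"
proof (cases "u = w")
  case True
  then show ?thesis using assms by (auto simp: is_KL_def lookup_one when_def split: if_splits)
next
  case False
  have "tc C u \<noteq> 0" using assms(2) by auto
  then have "u < w" using assms(1) False by (auto simp: is_KL_def less_W_def)
  then show ?thesis using False assms by (auto simp: is_KL_def less_len)
qed

lemma is_KL_unique: "is_KL w C \<Longrightarrow> is_KL w C' \<Longrightarrow> C = C'"
proof -
  assume *: "is_KL w C" "is_KL w C'"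
  have "C - C' = 0"
  proof (rule bar_invariant_eq_0)
    show "hbar (C - C') = C - C'" using * by (simp add: hbar_diff is_KL_def)
    fix u k assume k: "lookup (tc (C - C') u) k \<noteq> 0"
    then have "u \<noteq> w" using * by (auto simp: is_KL_def)
    moreover have "lookup (tc C u) k \<noteq> 0 \<or> lookup (tc C' u) k \<noteq> 0" using k by (auto simp: lookup_minus)
    ultimately show "k < 0" using * by (auto simp: is_KL_def)
  qed
  then show ?thesis by simp
qed

lemma is_KL_1: "is_KL 1 (Tn 1)"
  by (auto simp: is_KL_def hbar_Tn tc_Tn dest: le_len)

lemma tc_Ct:
  "tc (Ct g h) u = tc h (of_gen g * u) + (if dsc g u then vpow 1 * tc h u else vpow (- 1) * tc h u)"
  by (simp add: Ct_def tc_Lt algebra_simps)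

lemma finite_lower [simp]: "finite {z. z < w \<and> P z}" for w :: W
  by (rule finite_subset[OF _ finite_len[of "len w"]]) (auto dest: less_len)

text \<open>The recursion of Kazhdan and Lusztig. Multiplication by C_g lifts the v^-1 coefficients
  at elements with descent \<open>g\<close> to constant terms; subtracting multiples of shorter
  basis elements removes exactly these and respects bar invariance.\<close>

lemma is_KL_gen:
  assumes gw: "\<not> dsc g w" and C: "is_KL w C" and K: "\<And>z. z < w \<Longrightarrow> is_KL z (K z)"
  defines "D \<equiv> Ct g C - (\<Sum>z\<in>{z. z < w \<and> dsc g z}. hscale (of_int (lookup (tc C z) (- 1))) (K z))"
  shows "is_KL (of_gen g * w) D"
proof -
  let ?Z = "{z. z < w \<and> dsc g z}"
  define m where "m z = lookup (tc C z) (- 1)" for z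
  define S where "S u k = (\<Sum>z\<in>?Z. m z * lookup (tc (K z) u) k)" for u k
  have lgw: "len (of_gen g * w) = Suc (len w)" using gw by (rule len_asc)
  have D: "lookup (tc D u) k = lookup (tc C (of_gen g * u)) k +
      (if dsc g u then lookup (tc C u) (k - 1) else lookup (tc C u) (k + 1)) - S u k" for u k
    by (simp add: D_def S_def m_def tc_sum lookup_minus lookup_add lookup_sum tc_Ct)
  have S_nz: "\<exists>z. z < w \<and> dsc g z \<and> len z < len w \<and> m z \<noteq> 0 \<and> lookup (tc (K z) u) k \<noteq> 0 \<and>
      even (int (len w) - int (len z) - 1)" if "S u k \<noteq> 0" for u k
  proof -
    obtain z where z: "z \<in> ?Z" "m z * lookup (tc (K z) u) k \<noteq> 0"
      using \<open>S u k \<noteq> 0\<close> unfolding S_def by (meson sum.not_neutral_contains_not_neutral)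
    then show ?thesis using is_KL_support[OF C, of z "- 1"] by (auto simp: m_def less_len algebra_simps)
  qed
  \<comment> \<open>Only the diagonal coefficient of \<open>K z\<close> has a constant term, so the
    correction at \<open>u\<close> is \<open>m u\<close>, the amount to be cancelled.\<close>
  have S0: "S u 0 = (if u < w \<and> dsc g u then m u else 0)" for u
  proof -
    have "S u 0 = (\<Sum>z\<in>?Z. if z = u then m u else 0)"
      unfolding S_def
    proof (rule sum.cong)
      fix z assume "z \<in> ?Z"
      then have z: "is_KL z (K z)" using K by simp
      show "m z * lookup (tc (K z) u) 0 = (if z = u then m u else 0)"
      proof (cases "z = u")
        case True
        then have "tc (K z) u = 1" using z by (simp add: is_KL_def)
        then show ?thesis using True by simp
      next
        case False then show ?thesis using is_KL_support[OF z, of u 0] by auto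
      qed
    qed simp
    then show ?thesis by simp
  qed
  have range: "k < 0 \<and> int (len u) - int (len (of_gen g * w)) \<le> k \<and>
      even (k + int (len (of_gen g * w)) - int (len u))"
    if u: "u \<noteq> of_gen g * w" and nz: "lookup (tc D u) k \<noteq> 0" for u k
  proof -
    have gu: "of_gen g * u \<noteq> w" using u by (auto simp: gen_eq_iff)
    have uw: "u \<noteq> w" if "dsc g u" using that gw by auto
    have "k \<noteq> 0"
    proof
      assume [simp]: "k = 0"
      have "lookup (tc C (of_gen g * u)) 0 = 0" using is_KL_support[OF C, of "of_gen g * u" 0] gu by auto
      moreover have "lookup (tc C u) 1 = 0" using is_KL_support[OF C, of u 1] by auto
      moreover have "lookup (tc C u) (- 1) = m u" by (simp add: m_def)
      moreover have "m u = 0" if "\<not> u < w" using is_KL_support[OF C, of u "- 1"] that by (auto simp: m_def)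
      ultimately show False using nz by (auto simp: D S0 split: if_splits)
    qed
    consider "lookup (tc C (of_gen g * u)) k \<noteq> 0" | "dsc g u" "lookup (tc C u) (k - 1) \<noteq> 0"
      | "\<not> dsc g u" "lookup (tc C u) (k + 1) \<noteq> 0" | "S u k \<noteq> 0"
      using nz by (fastforce simp: D split: if_splits)
    then show ?thesis
    proof cases
      case 1
      then show ?thesis using is_KL_support[OF C 1] gu lgw len_gen_cases[of g u] by auto
    next
      case 2
      then show ?thesis using is_KL_support[OF C 2(2)] uw lgw \<open>k \<noteq> 0\<close> by auto
    next
      case 3
      then show ?thesis using is_KL_support[OF C 3(2)] lgw \<open>k \<noteq> 0\<close> by auto
    next
      case 4
      then obtain z where z: "z < w" "len z < len w" "lookup (tc (K z) u) k \<noteq> 0"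
        "even (int (len w) - int (len z) - 1)" using S_nz by blast
      show ?thesis using is_KL_support[OF K[OF z(1)] z(3)] z(2,4) lgw \<open>k \<noteq> 0\<close> by auto
    qed
  qed
  have supp: "u \<le> of_gen g * w" if nz: "tc D u \<noteq> 0" for u
  proof -
    obtain k where k: "lookup (tc D u) k \<noteq> 0" using nz by (metis lookup_zero poly_mapping_eqI)
    have w_le: "w \<le> of_gen g * w" using less_gen[OF gw] by simp
    consider "lookup (tc C (of_gen g * u)) k \<noteq> 0" | k where "lookup (tc C u) k \<noteq> 0" | "S u k \<noteq> 0"
      using k by (fastforce simp: D split: if_splits)
    then show ?thesis
    proof cases
      case 1
      then have "of_gen g * u \<le> w" using is_KL_support[OF C 1] by auto
      then show ?thesis using gen_mult_le[of "of_gen g * u" w g] gw by simp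
    next
      case 2
      then show ?thesis using is_KL_support[OF C 2] w_le by auto
    next
      case 3
      then obtain z where z: "z < w" "lookup (tc (K z) u) k \<noteq> 0" using S_nz by blast
      then show ?thesis using is_KL_support[OF K[OF z(1)] z(2)] w_le by auto
    qed
  qed
  have top: "tc D (of_gen g * w) = 1"
  proof -
    have "lookup (tc C (of_gen g * w)) k = 0" for k
      using is_KL_support[OF C, of "of_gen g * w" k] lgw by auto
    moreover have "S (of_gen g * w) k = 0" for k
      using S_nz[of "of_gen g * w" k] is_KL_support[OF K, of _ "of_gen g * w" k] lgw by fastforce
    ultimately have "lookup (tc D (of_gen g * w)) k = lookup (tc C w) k" for k
      by (simp add: D)
    then show ?thesis using C by (intro poly_mapping_eqI) (auto simp: is_KL_def)
  qed
  \<comment> \<open>By the lifting property exactly one of the two terms of \<open>Ct g C\<close>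
    reaches the lowest power, with coefficient 1; the correction terms start at a higher power
    because \<open>z\<close> is shorter than \<open>w\<close>.\<close>
  have const: "lookup (tc D u) (int (len u) - int (len (of_gen g * w))) = 1" if u: "u \<le> of_gen g * w" for u
  proof (cases "u = of_gen g * w")
    case True then show ?thesis using top by simp
  next
    case False
    let ?k = "int (len u) - int (len w) - 1"
    have "len u < len (of_gen g * w)" using u False less_len[of u "of_gen g * w"] by (auto simp: less_W_def)
    then have k: "?k < 0" using lgw by simp
    have "S u ?k = 0"
      using S_nz[of u ?k] is_KL_support[OF K, of _ u ?k] k by fastforce
    moreover have "lookup (tc C (of_gen g * u)) ?k = 1" "lookup (tc C u) (?k - 1) = 0" if d: "dsc g u"
    proof -
      have "of_gen g * u \<le> w" using lifting[OF u d] .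
      moreover have "?k = int (len (of_gen g * u)) - int (len w)" using len_dsc[OF d] by simp
      ultimately show "lookup (tc C (of_gen g * u)) ?k = 1" using C unfolding is_KL_def by metis
      show "lookup (tc C u) (?k - 1) = 0" using is_KL_support[OF C, of u "?k - 1"] k by auto
    qed
    moreover have "lookup (tc C (of_gen g * u)) ?k = 0" "lookup (tc C u) (?k + 1) = 1" if d: "\<not> dsc g u"
    proof -
      have "u \<le> w" using lifting'[OF u d] .
      then show "lookup (tc C u) (?k + 1) = 1" using C by (simp add: is_KL_def)
      show "lookup (tc C (of_gen g * u)) ?k = 0"
        using is_KL_support[OF C, of "of_gen g * u" ?k] k len_asc[OF d] by auto
    qed
    ultimately have "lookup (tc D u) ?k = 1" by (auto simp: D)
    moreover have "int (len u) - int (len (of_gen g * w)) = ?k" using lgw by simp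
    ultimately show ?thesis by metis
  qed
  have "hbar D = D"
  proof -
    have "hbar (K z) = K z" if "z < w" for z using K that by (simp add: is_KL_def)
    then show ?thesis using C by (simp add: D_def hbar_diff hbar_Ct hbar_sum hbar_scale is_KL_def)
  qed
  then show ?thesis unfolding is_KL_def using range supp top const by blast
qed

lemma is_KL_exists: "\<exists>C. is_KL w C"
proof (induction "len w" arbitrary: w rule: less_induct)
  case less
  show ?case
  proof (cases "w = 1")
    case True then show ?thesis using is_KL_1 by blast
  next
    case False
    then obtain g where g: "dsc g w" by (rule exists_dsc)
    then obtain C where C: "is_KL (of_gen g * w) C" using less by blast
    have "\<exists>C. is_KL z C" if "z < of_gen g * w" for z
      using less[of z] less_len[OF that] g by simp
    then obtain K where K: "\<And>z. z < of_gen g * w \<Longrightarrow> is_KL z (K z)" by metis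
    have "\<exists>D. is_KL (of_gen g * (of_gen g * w)) D"
      using is_KL_gen[OF _ C K, of g] g by (auto simp: not_less)
    then show ?thesis by simp
  qed
qed

lemma q_power: "q ^ i = vpow (2 * int i)"
  by (induction i) (simp_all add: vpow_add algebra_simps)

lemma lookup_at_q: "lookup (at_q p) k = (if 0 \<le> k \<and> even k then coeff p (nat (k div 2)) else 0)"
proof -
  have deg: "degree (map_poly of_int p :: laurent poly) = degree p"
    by (rule degree_map_poly) auto
  have "at_q p = (\<Sum>i\<le>degree p. of_int (coeff p i) * vpow (2 * int i))"
    by (simp add: at_q_def poly_altdef deg coeff_map_poly q_power)
  also have "lookup \<dots> k = (\<Sum>i\<le>degree p. if 2 * int i = k then coeff p i else 0)"
    by (simp add: lookup_sum lookup_of_int_eq) (intro sum.cong, auto)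
  also have "\<dots> = (if 0 \<le> k \<and> even k then coeff p (nat (k div 2)) else 0)"
  proof (cases "0 \<le> k \<and> even k")
    case True
    then have "2 * int i = k \<longleftrightarrow> i = nat (k div 2)" for i by auto
    then show ?thesis using True by (simp add: coeff_eq_0)
  qed (auto intro!: sum.neutral)
  finally show ?thesis .
qed

lemma tc_kl_combination:
  "tc (kl_combination w p) u = (if u \<le> w then vpow (int (len u) - int (len w)) * at_q (p u) else 0)"
proof -
  have "finite {..w}" by (rule finite_subset[OF _ finite_len[of "len w"]]) (auto dest: le_len)
  then have "tc (kl_combination w p) u
      = vpow (- int (len w)) * (if u \<le> w then at_q (p u) * vpow (int (len u)) else 0)"
    by (simp add: kl_combination_def tc_sum T_eq_Tn tc_Tn if_distrib mult.commute cong: if_cong)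
  then show ?thesis by (simp add: mult.left_commute[of "vpow _"] mult.commute[of "at_q _"] vpow_add
        mult.assoc[symmetric])
qed

text \<open>\<open>KL_poly\<close> is a definite description. Existence comes from
  \<open>is_KL_exists\<close>; for uniqueness the degree condition is turned into negative exponents
  of v, so that \<open>bar_invariant_eq_0\<close> applies to the difference.\<close>

lemma is_KL_KL_basis: "is_KL w (KL_basis w)"
  and coeff_KL_poly: "u \<le> w \<Longrightarrow>
    coeff (KL_poly w u) i = lookup (tc (KL_basis w) u) (2 * int i + int (len u) - int (len w))"
proof -
  obtain C where C: "is_KL w C" using is_KL_exists by blast
  define f where "f u i = lookup (tc C u) (2 * int i + int (len u) - int (len w))" for u i
  \<comment> \<open>By \<open>f0\<close> the coefficients of index above \<open>len w\<close>
    vanish, so a list of length \<open>Suc (len w)\<close> loses nothing.\<close>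
  define P where "P u = (if u \<le> w then Poly (map (f u) [0..<Suc (len w)]) else 0)" for u
  have f0: "f u i = 0" if "len w < i" for u i
    using is_KL_support[OF C, of u "2 * int i + int (len u) - int (len w)"] that by (auto simp: f_def)
  have coeff_P: "coeff (P u) i = (if u \<le> w then f u i else 0)" for u i
    using f0[of i u] by (auto simp: P_def coeff_Poly_eq nth_default_def simp del: upt_Suc)
  have "kl_combination w P = C"
  proof (rule tc_eqI, rule poly_mapping_eqI)
    fix u k
    show "lookup (tc (kl_combination w P) u) k = lookup (tc C u) k"
    proof (cases "u \<le> w")
      case False
      then have "tc C u = 0" using C by (auto simp: is_KL_def)
      then show ?thesis using False by (simp add: tc_kl_combination)
    next
      case True
      let ?k = "k - (int (len u) - int (len w))"
      have "2 * int (nat (?k div 2)) + int (len u) - int (len w) = k" if "0 \<le> ?k" "even ?k"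
        using that by auto
      moreover have "lookup (tc C u) k = 0" if "\<not> (0 \<le> ?k \<and> even ?k)"
        using is_KL_support[OF C, of u k] that
        by (cases "lookup (tc C u) k = 0") (auto simp: algebra_simps)
      ultimately show ?thesis using True
        by (auto simp: tc_kl_combination lookup_at_q coeff_P f_def)
    qed
  qed
  note comb = this
  have Pdeg: "2 * degree (P u) + len u + 1 \<le> len w" if "u < w" for u
  proof (cases "P u = 0")
    case True then show ?thesis using less_len[OF that] by simp
  next
    case False
    then have "coeff (P u) (degree (P u)) \<noteq> 0" by simp
    then have "f u (degree (P u)) \<noteq> 0" by (simp add: coeff_P split: if_splits)
    then show ?thesis using is_KL_support[OF C, of u] that by (fastforce simp: f_def)
  qed
  have Pw: "P w = 1"
  proof (rule poly_eqI)
    fix i show "coeff (P w) i = coeff 1 i"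
      using C by (auto simp: coeff_P f_def is_KL_def lookup_one when_def)
  qed
  have "KL_poly w = P"
    unfolding KL_poly_def
  proof (rule the_equality)
    show "(\<forall>y. \<not> y \<le> w \<longrightarrow> P y = 0) \<and> P w = 1 \<and> (\<forall>y<w. 2 * degree (P y) + len y + 1 \<le> len w) \<and>
      hbar (kl_combination w P) = kl_combination w P"
      using C Pw Pdeg by (simp add: comb is_KL_def) (simp add: P_def)
    fix p
    assume p: "(\<forall>y. \<not> y \<le> w \<longrightarrow> p y = 0) \<and> p w = 1 \<and> (\<forall>y<w. 2 * degree (p y) + len y + 1 \<le> len w) \<and>
      hbar (kl_combination w p) = kl_combination w p"
    have "kl_combination w p - C = 0"
    proof (rule bar_invariant_eq_0)
      show "hbar (kl_combination w p - C) = kl_combination w p - C"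
        using p C by (simp add: hbar_diff is_KL_def)
      fix u k assume k: "lookup (tc (kl_combination w p - C) u) k \<noteq> 0"
      show "k < 0"
      proof (cases "lookup (tc C u) k \<noteq> 0")
        case True
        have "at_q 1 = 1" by (simp add: at_q_def)
        then have "tc (kl_combination w p) w = 1" using p by (simp add: tc_kl_combination)
        then have "u \<noteq> w" using k C by (auto simp: is_KL_def)
        then show ?thesis using is_KL_support[OF C True] by auto
      next
        case False
        have "at_q 1 = 1" by (simp add: at_q_def)
        then have "tc (kl_combination w p) w = 1" using p by (simp add: tc_kl_combination)
        then have "u \<noteq> w" using k C by (auto simp: is_KL_def)
        moreover have nz: "lookup (tc (kl_combination w p) u) k \<noteq> 0" using k False by (auto simp: lookup_minus)
        ultimately have u: "u < w" by (auto simp: tc_kl_combination less_W_def split: if_splits)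
        let ?k = "k - (int (len u) - int (len w))"
        have "0 \<le> ?k" "coeff (p u) (nat (?k div 2)) \<noteq> 0"
          using nz u by (auto simp: tc_kl_combination lookup_at_q split: if_splits)
        then have "?k div 2 \<le> int (degree (p u))" "even ?k"
          using nz u by (auto simp: tc_kl_combination lookup_at_q nat_le_iff dest: le_degree split: if_splits)
        moreover have "2 * degree (p u) + len u + 1 \<le> len w" using p u by blast
        ultimately show ?thesis by presburger
      qed
    qed
    then have eq: "kl_combination w p = kl_combination w P" by (simp add: comb)
    show "p = P"
    proof
      fix u
      show "p u = P u"
      proof (cases "u \<le> w")
        case True
        have "vpow (int (len u) - int (len w)) * at_q (p u) = vpow (int (len u) - int (len w)) * at_q (P u)"
          using arg_cong[OF eq, of "\<lambda>h. tc h u"] True by (simp add: tc_kl_combination)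
        then have eq: "at_q (p u) = at_q (P u)" by (metis minus_minus vpow_cancel(2))
        show ?thesis
        proof (rule poly_eqI)
          fix i
          show "coeff (p u) i = coeff (P u) i"
            using arg_cong[OF eq, of "\<lambda>p. lookup p (2 * int i)"] by (simp add: lookup_at_q)
        qed
      qed (use p in \<open>simp add: P_def\<close>)
    qed
  qed
  then have KL: "KL_basis w = C" by (simp add: KL_basis_def comb)
  then show "is_KL w (KL_basis w)" using C by simp
  show "u \<le> w \<Longrightarrow> coeff (KL_poly w u) i = lookup (tc (KL_basis w) u) (2 * int i + int (len u) - int (len w))"
    by (simp add: \<open>KL_poly w = P\<close> coeff_P KL f_def)
qed

lemmas KL_support = is_KL_support[OF is_KL_KL_basis]

text \<open>The normalising factor v^(l(u)-l(w)) moves q^((l(w)-l(u)-1)/2) to v^-1. For an even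
  length difference the parity clause in \<open>is_KL\<close> makes this coefficient vanish.\<close>

lemma mu_eq:
  assumes "u < w"
  shows "mu u w = lookup (tc (KL_basis w) u) (- 1)"
proof (cases "odd (len w - len u)")
  case True
  have "2 * int ((len w - len u - 1) div 2) + int (len u) - int (len w) = - 1"
  proof -
    obtain n where "len w - len u = 2 * n + 1" using True by (elim oddE)
    then have "len w = len u + 2 * n + 1" using less_len[OF assms] by simp
    then show ?thesis by simp
  qed
  then show ?thesis using True assms by (simp add: mu_def coeff_KL_poly)
next
  case False
  then have "lookup (tc (KL_basis w) u) (- 1) = 0"
    using KL_support[of w u "- 1"] less_len[OF assms] by auto
  then show ?thesis using False by (simp add: mu_def)
qed

lemma tc_KL_self [simp]: "tc (KL_basis w) w = 1"
  using is_KL_KL_basis[of w] by (simp add: is_KL_def)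

lemma mu_length_one:
  assumes "u < w" "len w - len u = 1"
  shows "mu u w = 1"
proof -
  have "int (len u) - int (len w) = - 1" using less_len[OF assms(1)] assms(2) by simp
  moreover have "lookup (tc (KL_basis w) u) (int (len u) - int (len w)) = 1"
    using is_KL_KL_basis[of w] assms(1) by (simp add: is_KL_def)
  ultimately show ?thesis by (simp add: mu_eq[OF assms(1)])
qed

lemma Ct_asc:
  assumes "\<not> dsc g w"
  shows "Ct g (KL_basis w) = KL_basis (of_gen g * w) +
    (\<Sum>z\<in>{z. z < w \<and> dsc g z}. hscale (of_int (mu z w)) (KL_basis z))"
proof -
  have "(\<Sum>z\<in>{z. z < w \<and> dsc g z}. hscale (of_int (mu z w)) (KL_basis z))
      = (\<Sum>z\<in>{z. z < w \<and> dsc g z}. hscale (of_int (lookup (tc (KL_basis w) z) (- 1))) (KL_basis z))"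
    by (rule sum.cong) (auto simp: mu_eq)
  then show ?thesis
    using is_KL_unique[OF is_KL_gen[OF assms is_KL_KL_basis is_KL_KL_basis] is_KL_KL_basis]
    by (simp add: algebra_simps)
qed

lemma Ct_Ct: "Ct g (Ct g h) = hscale (vpow 1 + vpow (- 1)) (Ct g h)"
  by (rule tc_eqI) (auto simp: tc_Ct not_dsc_iff algebra_simps)

text \<open>By \<open>Ct_asc\<close> the basis element is a combination of an image of
  \<open>Ct g\<close> and of shorter basis elements with descent \<open>g\<close>; all of these are
  eigenvectors.\<close>

lemma Ct_dsc: "dsc g w \<Longrightarrow> Ct g (KL_basis w) = hscale (vpow 1 + vpow (- 1)) (KL_basis w)"
proof (induction "len w" arbitrary: w rule: less_induct)
  case less
  let ?v = "of_gen g * w" and ?Z = "{z. z < of_gen g * w \<and> dsc g z}"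
  have v: "\<not> dsc g ?v" using less.prems by simp
  have C: "KL_basis w = Ct g (KL_basis ?v) - (\<Sum>z\<in>?Z. hscale (of_int (mu z ?v)) (KL_basis z))"
    using Ct_asc[OF v] by simp
  have IH: "Ct g (KL_basis z) = hscale (vpow 1 + vpow (- 1)) (KL_basis z)" if "z \<in> ?Z" for z
    using less.hyps[of z] that less_len[of z ?v] less.prems by auto
  have "(\<Sum>z\<in>?Z. hscale (of_int (mu z ?v)) (Ct g (KL_basis z)))
      = (\<Sum>z\<in>?Z. hscale (vpow 1 + vpow (- 1)) (hscale (of_int (mu z ?v)) (KL_basis z)))"
    by (rule sum.cong) (simp_all add: IH mult.commute)
  then show ?case
    unfolding C by (simp add: hlin_diff[OF hlin_Ct] hlin_sum[OF hlin_Ct] hlin_scale[OF hlin_Ct] Ct_Ct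
        hscale_distribs(3) hscale_sum[of "vpow 1 + vpow (- 1)"] del: hscale_laws(4))
qed

section \<open>Coordinates with respect to the Kazhdan--Lusztig basis\<close>

definition deg_le :: "laurent \<Rightarrow> int \<Rightarrow> bool" where
  "deg_le p n \<longleftrightarrow> (\<forall>k. lookup p k \<noteq> 0 \<longrightarrow> k \<le> n)"

lemma deg_leD: "deg_le p n \<Longrightarrow> n < k \<Longrightarrow> lookup p k = 0"
  by (force simp: deg_le_def)

lemma deg_le_mono: "deg_le p n \<Longrightarrow> n \<le> m \<Longrightarrow> deg_le p m"
  by (force simp: deg_le_def)

lemma deg_le_0 [simp]: "deg_le 0 n"
  by (simp add: deg_le_def)

lemma deg_le_1 [simp]: "deg_le 1 0"
  by (simp add: deg_le_def lookup_one when_def)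

lemma deg_le_add: "deg_le p n \<Longrightarrow> deg_le r n \<Longrightarrow> deg_le (p + r) n"
  unfolding deg_le_def lookup_add by (metis add.right_neutral)

lemma deg_le_sum: "(\<And>x. x \<in> A \<Longrightarrow> deg_le (f x) n) \<Longrightarrow> deg_le (sum f A) n"
  by (induction A rule: infinite_finite_induct) (auto intro: deg_le_add)

lemma deg_le_mult:
  assumes "deg_le p a" "deg_le r b" "a + b \<le> c"
  shows "deg_le (p * r) c"
  unfolding deg_le_def
proof (intro allI impI)
  fix k assume "lookup (p * r) k \<noteq> 0"
  then have "k \<in> keys (p * r)" by (simp add: in_keys_iff)
  then obtain i j where "i \<in> keys p" "j \<in> keys r" "k = i + j" using keys_mult[of p r] by auto
  then show "k \<le> c" using assms by (force simp: deg_le_def in_keys_iff)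
qed

lemma deg_le_xi: "deg_le p n \<Longrightarrow> deg_le (xi * p) (n + 1)"
  unfolding deg_le_def lookup_xi_mult
proof (intro allI impI)
  fix k assume *: "\<forall>k. lookup p k \<noteq> 0 \<longrightarrow> k \<le> n" "lookup p (k - 1) - lookup p (k + 1) \<noteq> 0"
  then have "lookup p (k - 1) \<noteq> 0 \<or> lookup p (k + 1) \<noteq> 0" by auto
  with * show "k \<le> n + 1" by fastforce
qed

lemma lookup_top_mult:
  assumes "deg_le p a" "deg_le r b"
  shows "lookup (p * r) (a + b) = lookup p a * lookup r b"
proof -
  let ?t = "of_int (lookup p a) * vpow a"
  have "deg_le (p - ?t) (a - 1)"
    using assms(1) by (force simp: deg_le_def lookup_minus lookup_vpow lookup_of_int_eq)
  then have "deg_le ((p - ?t) * r) (a + b - 1)" using assms(2) by (rule deg_le_mult) simp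
  then have "lookup ((p - ?t) * r) (a + b) = 0" by (rule deg_leD) simp
  moreover have "lookup (?t * r) (a + b) = lookup p a * lookup r b" by (simp add: mult.assoc)
  ultimately show ?thesis by (simp add: left_diff_distrib lookup_minus)
qed

lemma deg_le_KL: "u \<noteq> w \<Longrightarrow> deg_le (tc (KL_basis w) u) (- 1)"
  using KL_support[of w u] by (force simp: deg_le_def)

lemma tc_lin_ext_KL: "finite A \<Longrightarrow> keys c \<subseteq> A \<Longrightarrow>
  tc (lin_ext KL_basis c) u = (\<Sum>w\<in>A. lookup c w * tc (KL_basis w) u)"
  by (simp add: lin_ext_superset[of A] tc_sum)

lemma KL_span: "\<exists>c. h = lin_ext KL_basis c"
proof -
  have ex_sum: "\<exists>c. sum f A = lin_ext KL_basis c" if "\<And>x. x \<in> A \<Longrightarrow> \<exists>c. f x = lin_ext KL_basis c"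
    for f :: "W \<Rightarrow> hecke" and A
    using that
  proof (induction A rule: infinite_finite_induct)
    case (insert x A)
    then obtain c d where "f x = lin_ext KL_basis c" "sum f A = lin_ext KL_basis d" by force
    then show ?case using insert by (intro exI[of _ "c + d"]) (simp add: hlin_add[OF hlin_lin_ext])
  qed (auto intro!: exI[of _ 0] simp: hlin_0[OF hlin_lin_ext])
  have ex_scale: "\<exists>c. hscale a h = lin_ext KL_basis c" if "\<exists>c. h = lin_ext KL_basis c" for a h
    using that by (metis hlin_scale[OF hlin_lin_ext])
  have Tn: "\<exists>c. Tn w = lin_ext KL_basis c" for w
  proof (induction "len w" arbitrary: w rule: less_induct)
    case less
    have "KL_basis w = (\<Sum>u\<in>insert w {u. u < w}. hscale (tc (KL_basis w) u) (Tn u))"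
    proof (rule Tn_expand)
      show "finite (insert w {u. u < w})" using finite_lower[of w "\<lambda>_. True"] by simp
      show "keys (KL_basis w) \<subseteq> insert w {u. u < w}"
      proof
        fix u assume "u \<in> keys (KL_basis w)"
        then have "tc (KL_basis w) u \<noteq> 0" by (simp add: tc_0_iff)
        then show "u \<in> insert w {u. u < w}"
          using is_KL_KL_basis[of w] by (auto simp: is_KL_def less_W_def)
      qed
    qed
    also have "\<dots> = Tn w + (\<Sum>u\<in>{u. u < w}. hscale (tc (KL_basis w) u) (Tn u))"
      using finite_lower[of w "\<lambda>_. True"] by (subst sum.insert) auto
    finally have eq: "Tn w = lin_ext KL_basis (T w) + - (\<Sum>u\<in>{u. u < w}. hscale (tc (KL_basis w) u) (Tn u))"
      by (simp add: eq_diff_eq)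
    have "\<exists>c. (\<Sum>u\<in>{u. u < w}. hscale (tc (KL_basis w) u) (Tn u)) = lin_ext KL_basis c"
      by (rule ex_sum, rule ex_scale) (use less less_len in auto)
    then show ?case using eq by (metis hlin_diff[OF hlin_lin_ext] diff_conv_add_uminus)
  qed
  have "\<exists>c. (\<Sum>w\<in>keys h. hscale (tc h w) (Tn w)) = lin_ext KL_basis c"
    by (rule ex_sum, rule ex_scale, rule Tn)
  then show ?thesis using Tn_expand[of "keys h" h] by auto
qed

lemma KL_independent:
  assumes "lin_ext KL_basis c = 0"
  shows "c = 0"
proof (rule ccontr)
  assume "c \<noteq> 0"
  then have "keys c \<noteq> {}" by auto
  then obtain u where u: "u \<in> keys c" "\<And>w. w \<in> keys c \<Longrightarrow> len w \<le> len u"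
    using finite_max_len[of "keys c"] by auto
  have "0 = tc (lin_ext KL_basis c) u" by (simp add: assms)
  also have "\<dots> = (\<Sum>w\<in>keys c. if w = u then lookup c u else 0)"
    unfolding tc_lin_ext_KL[OF finite_keys subset_refl]
  proof (rule sum.cong)
    fix w assume w: "w \<in> keys c"
    have "tc (KL_basis w) u = 0" if "w \<noteq> u"
    proof (rule ccontr)
      assume "tc (KL_basis w) u \<noteq> 0"
      then have "u < w" using that is_KL_KL_basis[of w] by (auto simp: is_KL_def less_W_def)
      then show False using u(2)[OF w] less_len[of u w] by simp
    qed
    then show "lookup c w * tc (KL_basis w) u = (if w = u then lookup c u else 0)" by auto
  qed simp
  also have "\<dots> = lookup c u" using u by simp
  finally show False using u by (simp add: in_keys_iff)
qed

definition KL_coords :: "hecke \<Rightarrow> (W \<Rightarrow>\<^sub>0 laurent)" where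
  "KL_coords h = (THE c. h = lin_ext KL_basis c)"

lemma KL_coords_eqI: "h = lin_ext KL_basis c \<Longrightarrow> KL_coords h = c"
  unfolding KL_coords_def
proof (rule the_equality)
  fix d assume "h = lin_ext KL_basis c" "h = lin_ext KL_basis d"
  then have "lin_ext KL_basis (d - c) = 0" by (simp add: hlin_diff[OF hlin_lin_ext])
  then show "d = c" using KL_independent by force
qed

lemma KL_coords: "lin_ext KL_basis (KL_coords h) = h"
  using KL_span[of h] KL_coords_eqI by metis

abbreviation KL_coeff :: "hecke \<Rightarrow> W \<Rightarrow> laurent" where
  "KL_coeff h u \<equiv> lookup (KL_coords h) u"

lemma hlin_KL_coords: "hlin KL_coords"
  by (rule hlinI; rule KL_coords_eqI)
     (simp_all add: hlin_add[OF hlin_lin_ext] hlin_scale[OF hlin_lin_ext] KL_coords)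

lemma KL_coeff_linear [simp]:
  "KL_coeff 0 w = 0" "KL_coeff (h + k) w = KL_coeff h w + KL_coeff k w" "KL_coeff (h - k) w = KL_coeff h w - KL_coeff k w"
  "KL_coeff (hscale a h) w = a * KL_coeff h w"
  by (simp_all add: hlin_0[OF hlin_KL_coords] hlin_add[OF hlin_KL_coords] hlin_diff[OF hlin_KL_coords]
      hlin_scale[OF hlin_KL_coords] lookup_add lookup_minus)

lemma KL_coeff_sum: "KL_coeff (sum f A) w = (\<Sum>x\<in>A. KL_coeff (f x) w)"
  by (simp add: hlin_sum[OF hlin_KL_coords] lookup_sum)

lemma KL_coeff_KL: "KL_coeff (KL_basis w) u = (if u = w then 1 else 0)"
  using KL_coords_eqI[of "KL_basis w" "T w"] by (simp add: lookup_T)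

lemma KL_expand: "h = (\<Sum>w\<in>keys (KL_coords h). hscale (KL_coeff h w) (KL_basis w))"
  using KL_coords[of h] by (simp add: lin_ext_def)

lemma tc_KL_coeff: "tc h u = (\<Sum>w\<in>keys (KL_coords h). KL_coeff h w * tc (KL_basis w) u)"
  using tc_lin_ext_KL[OF finite_keys subset_refl, of "KL_coords h" u] by (simp add: KL_coords)

text \<open>The off-diagonal entries of the base change lie in v^-1 Z[v^-1], so they cannot reach
  the top exponent.\<close>

lemma lookup_tc_top:
  assumes "\<And>w. deg_le (KL_coeff h w) m"
  shows "lookup (tc h u) m = lookup (KL_coeff h u) m"
proof -
  have "lookup (tc h u) m = (\<Sum>w\<in>keys (KL_coords h). lookup (KL_coeff h w * tc (KL_basis w) u) m)"
    by (subst tc_KL_coeff) (rule lookup_sum)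
  also have "\<dots> = (\<Sum>w\<in>keys (KL_coords h). if w = u then lookup (KL_coeff h u) m else 0)"
  proof (rule sum.cong)
    fix w
    have "deg_le (KL_coeff h w * tc (KL_basis w) u) (m - 1)" if "w \<noteq> u"
      using that by (intro deg_le_mult[OF assms deg_le_KL]) auto
    then show "lookup (KL_coeff h w * tc (KL_basis w) u) m = (if w = u then lookup (KL_coeff h u) m else 0)"
      using deg_leD[of _ "m - 1" m] by auto
  qed simp
  also have "\<dots> = lookup (KL_coeff h u) m" by (simp add: in_keys_iff)
  finally show ?thesis .
qed

text \<open>The largest exponent in any Kazhdan-Lusztig coordinate survives in the standard basis by
  \<open>lookup_tc_top\<close>, so it is at most \<open>n\<close>.\<close>

lemma deg_le_KL_coeff:
  assumes "\<And>u. deg_le (tc h u) n"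
  shows "deg_le (KL_coeff h u) n"
proof (rule ccontr)
  assume "\<not> deg_le (KL_coeff h u) n"
  let ?K = "\<Union>w\<in>keys (KL_coords h). keys (KL_coeff h w)"
  obtain k where k: "lookup (KL_coeff h u) k \<noteq> 0" "n < k"
    using \<open>\<not> deg_le (KL_coeff h u) n\<close> by (force simp: deg_le_def)
  then have kK: "k \<in> ?K" by (force simp: in_keys_iff)
  define m where "m = Max ?K"
  have fin: "finite ?K" by simp
  have "m \<in> ?K" unfolding m_def using fin kK by (intro Max_in) auto
  then obtain w where w: "lookup (KL_coeff h w) m \<noteq> 0" by (auto simp: in_keys_iff)
  have "n < m" using Max_ge[OF fin kK] k by (simp add: m_def)
  have "deg_le (KL_coeff h v) m" for v
    unfolding deg_le_def m_def
  proof (intro allI impI)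
    fix j assume "lookup (KL_coeff h v) j \<noteq> 0"
    then have "j \<in> ?K" by (force simp: in_keys_iff)
    then show "j \<le> Max ?K" by (rule Max_ge[OF fin])
  qed
  then have "lookup (tc h w) m \<noteq> 0" using w lookup_tc_top by metis
  then show False using assms[of w] \<open>n < m\<close> by (force simp: deg_le_def)
qed

lemma deg_le_KL_coeff_Tn: "deg_le (KL_coeff (Tn w) u) 0"
  by (rule deg_le_KL_coeff) (simp add: tc_Tn)

lemma lookup_KL_coeff_Tn_0: "lookup (KL_coeff (Tn w) u) 0 = (if u = w then 1 else 0)"
  using lookup_tc_top[of "Tn w" 0 u] deg_le_KL_coeff_Tn by (simp add: tc_Tn split: if_splits)

text \<open>Modulo v^-2 the base change is 1 + v^-1 M with \<open>mu\<close> as entries of M, and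
  its inverse is 1 - v^-1 M.\<close>

lemma lookup_KL_coeff_Tn_minus_1:
  assumes "u < w"
  shows "lookup (KL_coeff (Tn w) u) (- 1) = - mu u w"
proof -
  let ?A = "keys (KL_coords (Tn w))"
  have "0 = lookup (tc (Tn w) u) (- 1)" using assms by (auto simp: tc_Tn)
  also have "\<dots> = (\<Sum>z\<in>?A. lookup (KL_coeff (Tn w) z * tc (KL_basis z) u) (- 1))"
    by (subst tc_KL_coeff) (rule lookup_sum)
  also have "\<dots> = (\<Sum>z\<in>?A. (if z = u then lookup (KL_coeff (Tn w) u) (- 1) else 0) + (if z = w then mu u w else 0))"
  proof (rule sum.cong)
    fix z
    show "lookup (KL_coeff (Tn w) z * tc (KL_basis z) u) (- 1) =
        (if z = u then lookup (KL_coeff (Tn w) u) (- 1) else 0) + (if z = w then mu u w else 0)"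
    proof (cases "z = u")
      case True
      then show ?thesis using assms by (auto simp: less_W_def)
    next
      case False
      then have "lookup (KL_coeff (Tn w) z * tc (KL_basis z) u) (0 + - 1)
          = lookup (KL_coeff (Tn w) z) 0 * lookup (tc (KL_basis z) u) (- 1)"
        by (intro lookup_top_mult deg_le_KL_coeff_Tn deg_le_KL) auto
      then show ?thesis using False assms by (auto simp: lookup_KL_coeff_Tn_0 mu_eq)
    qed
  qed simp
  also have "\<dots> = lookup (KL_coeff (Tn w) u) (- 1) + mu u w"
  proof -
    have "KL_coeff (Tn w) w \<noteq> 0" using lookup_KL_coeff_Tn_0[of w w] by auto
    then have "w \<in> ?A" by (simp add: in_keys_iff)
    then show ?thesis by (simp add: sum.distrib in_keys_iff)
  qed
  finally show ?thesis by simp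
qed

lemma struct_consts_eq: "struct_consts x y = KL_coords (hmult (KL_basis x) (KL_basis y))"
  by (simp add: struct_consts_def KL_coords_def)

section \<open>Elements containing the longest element of a parabolic subgroup of type $B_2$\<close>

definition wJ :: "gen \<Rightarrow> W" where
  "wJ a = of_gen a * (of_gen Gs * (of_gen a * of_gen Gs))"

text \<open>Additivity of lengths says that reduced words of \<open>x\<close> and \<open>y\<close>
  placed around the braid word form a reduced word of \<open>w\<close>.\<close>

definition not_fc :: "W \<Rightarrow> bool" where
  "not_fc w \<longleftrightarrow> (\<exists>a x y. a \<noteq> Gs \<and> w = x * (wJ a * y) \<and> len w = len x + 4 + len y)"

fun opp :: "gen \<Rightarrow> gen" where
  "opp Gr = Gt" | "opp Gt = Gr" | "opp Gs = Gs"

lemma len_gen_le: "len (of_gen g * w) \<le> Suc (len w)"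
  using len_gen_cases[of g w] by auto

text \<open>The letter is absorbed into the left factor; lengths stay additive because the total
  length does grow by one.\<close>

lemma not_fc_gen:
  assumes "\<not> dsc g w" "not_fc w"
  shows "not_fc (of_gen g * w)"
proof -
  obtain a x y where *: "a \<noteq> Gs" "w = x * (wJ a * y)" "len w = len x + 4 + len y"
    using assms(2) by (auto simp: not_fc_def)
  have "len (wJ a) \<le> 4"
    using len_le[of "[a, Gs, a, Gs]"] by (simp add: wJ_def of_word_Cons)
  then have "len ((of_gen g * x) * (wJ a * y)) \<le> len (of_gen g * x) + 4 + len y"
    using len_mult_le[of "of_gen g * x" "wJ a * y"] len_mult_le[of "wJ a" y] by simp
  moreover have "len (of_gen g * w) = Suc (len w)" using assms(1) by (rule len_asc)
  ultimately have "len (of_gen g * w) = len (of_gen g * x) + 4 + len y"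
    using len_gen_le[of g x] * by (simp add: mult.assoc)
  then show ?thesis using * unfolding not_fc_def by (metis mult.assoc)
qed

lemma not_fc_inverse: "not_fc w \<Longrightarrow> not_fc (inverse w)"
proof -
  assume "not_fc w"
  then obtain a x y where *: "a \<noteq> Gs" "w = x * (wJ a * y)" "len w = len x + 4 + len y"
    by (auto simp: not_fc_def)
  have "inverse (wJ a) = wJ a"
    using gen_braid[of a] * by (cases a) (auto simp: wJ_def W_inverse_mult mult.assoc)
  then have "inverse w = inverse y * (wJ a * inverse x)"
    using * by (simp add: W_inverse_mult mult.assoc)
  moreover have "len (inverse w) = len (inverse y) + 4 + len (inverse x)" using * by simp
  ultimately show ?thesis using * unfolding not_fc_def by blast
qed

text \<open>The two choices of \<open>a\<close> are exchanged by a symmetry of the fundamental alcove. In the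
  coordinates below, the special vertex fixed by \<open>a\<close> and \<open>Gs\<close> is the origin.\<close>

locale special_vertex =
  fixes a :: gen
  assumes a: "a \<noteq> Gs"
begin

abbreviation "A \<equiv> of_gen a"
abbreviation "S \<equiv> of_gen Gs"
abbreviation "B \<equiv> of_gen (opp a)"

text \<open>For \<open>Gt\<close> the pair (\<open>X\<close>, \<open>Y\<close>) is the image of the
  point under (x,y) -> (1-y,1-x), so both choices of \<open>a\<close> satisfy the same
  formulas.\<close>

definition X :: "W \<Rightarrow> real" where
  "X w = (if a = Gr then fst (act w base_pt) else 1 - snd (act w base_pt))"

definition Y :: "W \<Rightarrow> real" where
  "Y w = (if a = Gr then snd (act w base_pt) else 1 - fst (act w base_pt))"

lemma a_cases: "a = Gr \<or> a = Gt"
  using a by (cases a) auto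

lemma XY [simp]:
  "X (A * w) = X w" "Y (A * w) = - Y w" "X (S * w) = Y w" "Y (S * w) = X w"
  "X (B * w) = 2 - X w" "Y (B * w) = Y w"
  using a_cases by (cases "act w base_pt"; auto simp: X_def Y_def act_mult)+

lemma dsc_A: "dsc a w \<longleftrightarrow> Y w < 0"
  and dsc_S: "dsc Gs w \<longleftrightarrow> X w < Y w"
  and dsc_B: "dsc (opp a) w \<longleftrightarrow> 1 < X w"
  unfolding dsc_base using a_cases by (cases "act w base_pt"; auto simp: X_def Y_def)+

lemma XY_neq: "X w \<noteq> Y w" "Y w \<noteq> 0" "X w \<noteq> 1"
proof -
  obtain p1 p2 where P: "act w base_pt = (p1, p2)" by (cases "act w base_pt")
  show "X w \<noteq> Y w" "Y w \<noteq> 0" "X w \<noteq> 1"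
    using wall_base_neq_0[of Gr w] wall_base_neq_0[of Gs w] wall_base_neq_0[of Gt w] a_cases
    by (auto simp: X_def Y_def P)
qed

lemma dsc_cases: "dsc g w \<longleftrightarrow> (g = a \<and> Y w < 0) \<or> (g = Gs \<and> X w < Y w) \<or> (g = opp a \<and> 1 < X w)"
  using dsc_A dsc_S dsc_B a_cases by (cases g) auto

lemma len_up:
  "0 \<le> Y w \<Longrightarrow> len (A * w) = Suc (len w)"
  "Y w \<le> X w \<Longrightarrow> len (S * w) = Suc (len w)"
  "X w \<le> 1 \<Longrightarrow> len (B * w) = Suc (len w)"
  using len_asc[of a w] len_asc[of Gs w] len_asc[of "opp a" w] by (auto simp: dsc_A dsc_S dsc_B)

lemma Lt_Tn_XY:
  "Lt a (Tn w) = Tn (A * w) + (if Y w < 0 then hscale xi (Tn w) else 0)"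
  "Lt Gs (Tn w) = Tn (S * w) + (if X w < Y w then hscale xi (Tn w) else 0)"
  "Lt (opp a) (Tn w) = Tn (B * w) + (if 1 < X w then hscale xi (Tn w) else 0)"
  by (simp_all add: Lt_Tn dsc_A dsc_S dsc_B)

lemma braid_A: "S * (A * (S * (A * w))) = A * (S * (A * (S * w)))"
  using gen_braid'[of Gs a w] a a_cases by (auto simp: doubleton_eq_iff)

lemma comm_AB: "B * (A * w) = A * (B * w)"
  using a_cases gen_comm'[of w] by auto

lemma wJ_mult: "wJ a * w = A * (S * (A * (S * w)))" "wJ (opp a) * w = B * (S * (B * (S * w)))"
  by (simp_all add: wJ_def mult.assoc)

lemma not_fc_AS: "dsc a w \<Longrightarrow> dsc Gs w \<Longrightarrow> not_fc w"
proof -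
  assume *: "dsc a w" "dsc Gs w"
  define y where "y = S * (A * (S * (A * w)))"
  have "len w = len y + 4"
    using * len_up(1)[of "A * w"] len_up(2)[of "S * (A * w)"] len_up(1)[of "A * (S * (A * w))"]
      len_up(2)[of y] by (simp add: dsc_A dsc_S y_def)
  moreover have "w = 1 * (wJ a * y)" by (simp add: wJ_mult y_def)
  ultimately show "not_fc w" using a unfolding not_fc_def
    by (intro exI[of _ a] exI[of _ 1] exI[of _ y]) simp
qed

end

lemma special_vertexI: "a \<noteq> Gs \<Longrightarrow> special_vertex a"
  by unfold_locales

lemma not_fc_dsc: "g \<noteq> Gs \<Longrightarrow> dsc g w \<Longrightarrow> dsc Gs w \<Longrightarrow> not_fc w"
  using special_vertex.not_fc_AS[OF special_vertexI] by blast

lemma len_word_mult_le: "len (of_word us * w) \<le> length us + len w"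
  using len_mult_le[of "of_word us" w] len_le[of us] by simp

lemma rdsc_peel: "rdsc x g \<Longrightarrow> \<exists>x'. x = x' * of_gen g \<and> len x = Suc (len x')"
  using len_rdsc[of x g] by (intro exI[of _ "x * of_gen g"]) (simp add: mult.assoc)

text \<open>Choose the factor to the left of the longest element as short as possible; otherwise a braid
  relation would move it further to the left.\<close>

lemma not_fc_cases:
  assumes "not_fc w"
  obtains a x y where "a \<noteq> Gs" "w = x * (wJ a * y)" "len w = len x + 4 + len y"
    "x \<in> {1, of_gen (opp a), of_gen Gs * of_gen (opp a), of_gen a * (of_gen Gs * of_gen (opp a))}"
    "\<not> dsc a y" "\<not> dsc Gs y"
proof -
  define D where "D a x y \<longleftrightarrow> a \<noteq> Gs \<and> w = x * (wJ a * y) \<and> len w = len x + 4 + len y" for a x y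
  have "\<exists>n a x y. D a x y \<and> len x = n" using assms by (auto simp: not_fc_def D_def)
  from LeastI_ex[OF this] obtain a x y where D: "D a x y"
    and n: "len x = (LEAST n. \<exists>a x y. D a x y \<and> len x = n)" by blast
  have minimal: "len x \<le> len x'" if "D a' x' y'" for a' x' y'
    unfolding n by (rule Least_le) (use that in blast)
  have a: "a \<noteq> Gs" and w: "w = x * (wJ a * y)" and lw: "len w = len x + 4 + len y"
    using D by (auto simp: D_def)
  interpret special_vertex a using a by unfold_locales
  have b: "opp a \<noteq> Gs" using a_cases by auto
  \<comment> \<open>Only an upper bound on the lengths has to be checked; the reverse inequality
    holds for any factorisation.\<close>
  have DI: "D c x' z" if "w = x' * (wJ c * z)" "c \<noteq> Gs" "len x' + 4 + len z \<le> len w" for c x' z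
  proof -
    have "len w \<le> len x' + len (wJ c * z)" unfolding that(1) by (rule len_mult_le)
    also have "len (wJ c * z) \<le> 4 + len z"
      using len_word_mult_le[of "[c, Gs, c, Gs]" z] by (simp add: wJ_def of_word_Cons mult.assoc)
    finally show ?thesis using that by (simp add: D_def)
  qed
  have three: "len w \<le> len v + 3 + len z" if "w = v * (of_word [c, d, e] * z)" for v z c d e
    using that len_mult_le[of v "of_word [c, d, e] * z"] len_word_mult_le[of "[c, d, e]" z] by simp
  have y1: "\<not> dsc a y"
  proof
    assume d: "dsc a y"
    have "w = x * (of_word [Gs, a, Gs] * (A * y))"
      by (simp add: w wJ_mult of_word_Cons mult.assoc braid_A)
    then show False using three[of x Gs a Gs "A * y"] len_dsc[OF d] lw by simp
  qed
  have y2: "\<not> dsc Gs y"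
  proof
    assume d: "dsc Gs y"
    have "w = x * (of_word [a, Gs, a] * (S * y))"
      by (simp add: w wJ_mult of_word_Cons mult.assoc)
    then show False using three[of x a Gs a "S * y"] len_dsc[OF d] lw by simp
  qed
  have x1: "\<not> rdsc x a"
  proof
    assume "rdsc x a"
    then obtain x' where x': "x = x' * A" "len x = Suc (len x')" using rdsc_peel by blast
    have "w = x' * (of_word [Gs, a, Gs] * y)"
      by (simp add: w x' wJ_mult of_word_Cons mult.assoc)
    then show False using three[of x' Gs a Gs y] x' lw by simp
  qed
  have x2: "\<not> rdsc x Gs"
  proof
    assume "rdsc x Gs"
    then obtain x' where x': "x = x' * S" "len x = Suc (len x')" using rdsc_peel by blast
    have "w = x' * (of_word [a, Gs, a] * y)"
      by (simp add: w x' wJ_mult of_word_Cons mult.assoc braid_A[symmetric])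
    then show False using three[of x' a Gs a y] x' lw by simp
  qed
  have gens: "g = a \<or> g = Gs \<or> g = opp a" for g using a_cases by (cases g) auto
  have ASA: "len (A * (S * (A * y))) \<le> 3 + len y"
    using len_word_mult_le[of "[a, Gs, a]" y] by (simp add: of_word_Cons mult.assoc)
  have "x \<in> {1, B, S * B, A * (S * B)}"
  proof (cases "x = 1")
    case False
    then obtain g where "rdsc x g" by (rule exists_rdsc)
    then have "rdsc x (opp a)" using x1 x2 gens[of g] by auto
    then obtain u where u: "x = u * B" "len x = Suc (len u)" using rdsc_peel by blast
    have u1: "\<not> rdsc u a"
    proof
      assume "rdsc u a"
      then obtain v where v: "u = v * A" "len u = Suc (len v)" using rdsc_peel by blast
      have "x * A = v * B" using comm_AB[of 1] by (simp add: u v mult.assoc)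
      then have "len (x * A) \<le> Suc (len v)" using len_mult_le[of v B] by simp
      then show False using x1 u v by simp
    qed
    have u2: "\<not> rdsc u (opp a)" using u by simp
    show ?thesis
    proof (cases "u = 1")
      case True then show ?thesis using u by simp
    next
      case False
      then obtain g where "rdsc u g" by (rule exists_rdsc)
      then have "rdsc u Gs" using u1 u2 gens[of g] by auto
      then obtain v where v: "u = v * S" "len u = Suc (len v)" using rdsc_peel by blast
      have v1: "\<not> rdsc v Gs" using v by simp
      \<comment> \<open>Otherwise x = p B S B. Writing \<open>wJ a\<close> as S A S A turns w into p
        (B S B S) (A S A y), with the shorter left factor \<open>p\<close>.\<close>
      have v2: "\<not> rdsc v (opp a)"
      proof
        assume "rdsc v (opp a)"
        then obtain p where p: "v = p * B" "len v = Suc (len p)" using rdsc_peel by blast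
        have "D (opp a) p (A * (S * (A * y)))"
          by (rule DI) (use b ASA u v p lw in \<open>simp_all add: w wJ_mult mult.assoc braid_A[symmetric]\<close>)
        then show False using minimal u v p by fastforce
      qed
      show ?thesis
      proof (cases "v = 1")
        case True then show ?thesis using u v by simp
      next
        case False
        then obtain g where "rdsc v g" by (rule exists_rdsc)
        then have "rdsc v a" using v1 v2 gens[of g] by auto
        then obtain p where p: "v = p * A" "len v = Suc (len p)" using rdsc_peel by blast
        have p1: "\<not> rdsc p a" using p by simp
        \<comment> \<open>Otherwise x = k S A S B. Commuting B past the next A completes S A S A
          directly after \<open>k\<close>.\<close>
        have p2: "\<not> rdsc p Gs"
        proof
          assume "rdsc p Gs"
          then obtain k where k: "p = k * S" "len p = Suc (len k)" using rdsc_peel by blast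
          have "len (B * (S * (A * (S * y)))) \<le> 4 + len y"
            using len_word_mult_le[of "[opp a, Gs, a, Gs]" y] by (simp add: of_word_Cons mult.assoc)
          moreover have "w = k * (S * (A * (S * (A * (B * (S * (A * (S * y))))))))"
            by (simp add: w u v p k wJ_mult mult.assoc comm_AB)
          then have "w = k * (wJ a * (B * (S * (A * (S * y)))))"
            by (simp only: wJ_mult braid_A[symmetric])
          ultimately have "D a k (B * (S * (A * (S * y))))"
            using a u v p k lw by (intro DI) auto
          then show False using minimal u v p k by fastforce
        qed
        \<comment> \<open>Otherwise x = k B A S B. Commuting B and A gives w = (k A) (B S B S) (A S
          A y), and \<open>k * A\<close> is shorter than \<open>x\<close>.\<close>
        have p3: "\<not> rdsc p (opp a)"
        proof
          assume "rdsc p (opp a)"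
          then obtain k where k: "p = k * B" "len p = Suc (len k)" using rdsc_peel by blast
          have kA: "len (k * A) \<le> Suc (len k)" using len_mult_le[of k A] by simp
          have "D (opp a) (k * A) (A * (S * (A * y)))"
          proof (rule DI)
            show "w = k * A * (wJ (opp a) * (A * (S * (A * y))))"
              by (simp add: w u v p k wJ_mult mult.assoc comm_AB braid_A[symmetric])
          qed (use b ASA kA u v p k lw in auto)
          then show False using minimal u v p k kA by fastforce
        qed
        have "p = 1" using exists_rdsc[of p] p1 p2 p3 gens by metis
        then show ?thesis using u v p by (simp add: mult.assoc)
      qed
    qed
  qed simp
  then show thesis using that a w lw y1 y2 by blast
qed

section \<open>The left ideal\<close>

lemma q_int_neq_0: "(vpow 1 + vpow (- 1)) * p = 0 \<Longrightarrow> p = 0"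
proof -
  have "lookup (vpow 1 + vpow (- 1)) 1 \<noteq> lookup 0 1" by (simp add: lookup_add lookup_vpow)
  then have "vpow 1 + vpow (- 1) \<noteq> 0" by metis
  then show "(vpow 1 + vpow (- 1)) * p = 0 \<Longrightarrow> p = 0" by simp
qed

lemma KL_coeff_Ct_expand: "KL_coeff (Ct g h) u = (\<Sum>z\<in>keys (KL_coords h). KL_coeff h z * KL_coeff (Ct g (KL_basis z)) u)"
  using arg_cong[OF KL_expand[of h], of "\<lambda>h. KL_coeff (Ct g h) u"]
  by (simp add: hlin_sum[OF hlin_Ct] hlin_scale[OF hlin_Ct] KL_coeff_sum)

lemma KL_coeff_Ct_KL:
  "KL_coeff (Ct g (KL_basis z)) u = (if dsc g z then (if u = z then vpow 1 + vpow (- 1) else 0)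
     else (if u = of_gen g * z then 1 else 0) + (if u < z \<and> dsc g u then of_int (mu u z) else 0))"
proof (cases "dsc g z")
  case True
  then show ?thesis by (simp add: Ct_dsc KL_coeff_KL)
next
  case False
  have "KL_coeff (Ct g (KL_basis z)) u = (if u = of_gen g * z then 1 else 0) +
      (\<Sum>v\<in>{v. v < z \<and> dsc g v}. if v = u then of_int (mu u z) else 0)"
    by (simp add: Ct_asc[OF False] KL_coeff_sum KL_coeff_KL if_distrib[of "\<lambda>x. _ * x"] cong: if_cong)
  then show ?thesis using False by simp
qed

lemma KL_coeff_Ct_eq_0: "\<not> dsc g u \<Longrightarrow> KL_coeff (Ct g h) u = 0"
proof (subst KL_coeff_Ct_expand, rule sum.neutral, rule ballI)
  fix z assume "\<not> dsc g u"
  then show "KL_coeff h z * KL_coeff (Ct g (KL_basis z)) u = 0"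
    unfolding KL_coeff_Ct_KL using dsc_gen_mult[of g z] by (cases "dsc g z"; cases "u = z"; cases "u = of_gen g * z") auto
qed

text \<open>All coordinates of an image of \<open>Ct g\<close> sit at elements with descent
  \<open>g\<close>, and the eigenvalue v + v^-1 can be cancelled.\<close>

lemma KL_coeff_eigen: "Ct g h = hscale (vpow 1 + vpow (- 1)) h \<Longrightarrow> KL_coeff h u \<noteq> 0 \<Longrightarrow> dsc g u"
  using KL_coeff_Ct_eq_0[of g u h] q_int_neq_0[of "KL_coeff h u"] by auto

text \<open>A longest element among the Kazhdan-Lusztig coordinates keeps its coefficient in the
  standard basis.\<close>

lemma KL_coeff_len:
  assumes "\<And>u. tc h u \<noteq> 0 \<Longrightarrow> len u \<le> n" "KL_coeff h u \<noteq> 0"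
  shows "len u \<le> n"
proof (rule ccontr)
  assume n: "\<not> len u \<le> n"
  have "u \<in> keys (KL_coords h)" using assms(2) by (simp add: in_keys_iff)
  then obtain v where v: "v \<in> keys (KL_coords h)" "\<And>w. w \<in> keys (KL_coords h) \<Longrightarrow> len w \<le> len v"
    using finite_max_len[of "keys (KL_coords h)"] by fastforce
  have "tc h v = (\<Sum>w\<in>keys (KL_coords h). if w = v then KL_coeff h v else 0)"
    unfolding tc_KL_coeff[of h v]
  proof (rule sum.cong)
    fix w assume w: "w \<in> keys (KL_coords h)"
    have "tc (KL_basis w) v = 0" if "w \<noteq> v"
    proof (rule ccontr)
      assume "tc (KL_basis w) v \<noteq> 0"
      then have "v < w" using that is_KL_KL_basis[of w] by (auto simp: is_KL_def less_W_def)
      then show False using v(2)[OF w] less_len[of v w] by simp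
    qed
    then show "KL_coeff h w * tc (KL_basis w) v = (if w = v then KL_coeff h v else 0)" by auto
  qed simp
  then have "tc h v \<noteq> 0" using v by (simp add: in_keys_iff)
  then have "len v \<le> n" by (rule assms(1))
  then show False using n v(2)[OF \<open>u \<in> keys (KL_coords h)\<close>] by simp
qed

text \<open>The part of the ideal I up to length \<open>n\<close>. The bound records for which
  elements \<open>dsc_closed\<close> has to be known already.\<close>

definition not_fc_span :: "nat \<Rightarrow> hecke \<Rightarrow> bool" where
  "not_fc_span n h \<longleftrightarrow> (\<forall>u. KL_coeff h u \<noteq> 0 \<longrightarrow> not_fc u \<and> len u \<le> n)"

text \<open>This is what keeps \<open>Ct g\<close> from leading \<open>KL_basis w\<close> out of the
  span of the elements that are not fully commutative.\<close>

definition dsc_closed :: "W \<Rightarrow> bool" where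
  "dsc_closed w \<longleftrightarrow> (\<forall>u g. u < w \<longrightarrow> \<not> not_fc u \<longrightarrow> mu u w \<noteq> 0 \<longrightarrow> dsc g u \<longrightarrow> dsc g w)"

text \<open>In \<open>Ct_asc\<close> the lower terms have descent \<open>g\<close>. A fully
  commutative one with nonzero \<open>mu\<close> would force \<open>g\<close> to be a descent of
  \<open>z\<close> as well, by \<open>dsc_closed\<close>, and then \<open>Ct g\<close> would act on
  \<open>KL_basis z\<close> as a scalar.\<close>

lemma not_fc_span_Lt:
  assumes "\<And>w. not_fc w \<Longrightarrow> len w \<le> n \<Longrightarrow> dsc_closed w" "not_fc_span n h"
  shows "not_fc_span (Suc n) (Lt g h)"
  unfolding not_fc_span_def
proof (intro allI impI)
  fix u assume nz: "KL_coeff (Lt g h) u \<noteq> 0"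
  have "Lt g h = Ct g h - hscale (vpow (- 1)) h" by (simp add: Ct_def)
  then have "KL_coeff (Ct g h) u \<noteq> 0 \<or> KL_coeff h u \<noteq> 0" using nz by auto
  then show "not_fc u \<and> len u \<le> Suc n"
  proof
    assume "KL_coeff (Ct g h) u \<noteq> 0"
    then have "(\<Sum>z\<in>keys (KL_coords h). KL_coeff h z * KL_coeff (Ct g (KL_basis z)) u) \<noteq> 0"
      by (subst (asm) KL_coeff_Ct_expand)
    then obtain z where z: "z \<in> keys (KL_coords h)" "KL_coeff h z * KL_coeff (Ct g (KL_basis z)) u \<noteq> 0"
      by (meson sum.not_neutral_contains_not_neutral)
    then have nz: "not_fc z" "len z \<le> n" using assms(2) by (auto simp: not_fc_span_def)
    have cl: "dsc_closed z" using assms(1) nz by blast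
    show ?thesis
    proof (cases "dsc g z")
      case True
      then show ?thesis using z nz by (auto simp: KL_coeff_Ct_KL split: if_splits)
    next
      case False
      then consider "u = of_gen g * z" | "u < z" "dsc g u" "mu u z \<noteq> 0"
        using z by (fastforce simp: KL_coeff_Ct_KL split: if_splits)
      then show ?thesis
      proof cases
        case 1
        then show ?thesis using not_fc_gen[OF False] nz len_asc[OF False] by simp
      next
        case 2
        then show ?thesis using cl False nz less_len[of u z] by (auto simp: dsc_closed_def)
      qed
    qed
  next
    assume "KL_coeff h u \<noteq> 0"
    then show ?thesis using assms(2) by (auto simp: not_fc_span_def)
  qed
qed

lemma Ct_Tn: "Ct g (Tn w) = Tn (of_gen g * w) + hscale (if dsc g w then vpow 1 else vpow (- 1)) (Tn w)"
  by (simp add: Ct_def Lt_Tn hscale_distribs)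

lemma vpow_add': "vpow k * (vpow j * p) = vpow (k + j) * p"
  by (simp add: vpow_add mult.assoc[symmetric])

section \<open>The product of the parabolic Kazhdan-Lusztig element with a standard basis
  element\<close>

context special_vertex
begin

lemma Ct_Tn_XY:
  "Ct a (Tn w) = Tn (A * w) + hscale (if Y w < 0 then vpow 1 else vpow (- 1)) (Tn w)"
  "Ct Gs (Tn w) = Tn (S * w) + hscale (if X w < Y w then vpow 1 else vpow (- 1)) (Tn w)"
  by (simp_all only: Ct_Tn dsc_A dsc_S)

text \<open>$C_{w_J} T_y$ without the top term, in the normalised basis\<close>

definition lower_part :: "W \<Rightarrow> hecke" where
  "lower_part y =
     hscale (vpow (- 1)) (Tn (A * (S * (A * y))) + Tn (S * (A * (S * y)))) +
     hscale (vpow (- 2)) (Tn (A * (S * y)) + Tn (S * (A * y))) +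
     hscale (vpow (- 3)) (Tn (A * y) + Tn (S * y)) + hscale (vpow (- 4)) (Tn y)"

context
  fixes y :: W
  assumes y: "\<not> dsc a y" "\<not> dsc Gs y"
begin

lemma XYy: "0 < Y y" "Y y < X y" "0 < X y"
  using y XY_neq[of y] by (auto simp: dsc_A dsc_S)

text \<open>The argument of \<open>Ct g\<close> is the product of the basis element of the longest
  element of the parabolic subgroup with \<open>Tn y\<close>, and that basis element is an
  eigenvector for both generators.\<close>

lemma Ct_CJ:
  "g = a \<or> g = Gs \<Longrightarrow> Ct g (Tn (A * (S * (A * (S * y)))) + lower_part y) =
     hscale (vpow 1 + vpow (- 1)) (Tn (A * (S * (A * (S * y)))) + lower_part y)"
proof -
  have 1: "Ct a (Tn (A * (S * (A * (S * y)))) + lower_part y) =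
     hscale (vpow 1 + vpow (- 1)) (Tn (A * (S * (A * (S * y)))) + lower_part y)"
    using XYy by (intro tc_eqI)
      (simp add: lower_part_def hlin_add[OF hlin_Ct] hlin_scale[OF hlin_Ct] Ct_Tn_XY
        braid_A distrib_left distrib_right add_ac vpow_add')
  have 2: "Ct Gs (Tn (A * (S * (A * (S * y)))) + lower_part y) =
     hscale (vpow 1 + vpow (- 1)) (Tn (A * (S * (A * (S * y)))) + lower_part y)"
  proof -
    have [simp]: "S * (A * (S * (A * (S * y)))) = A * (S * (A * y))"
      using braid_A[of "S * y"] by simp
    show ?thesis using XYy by (intro tc_eqI)
      (simp add: lower_part_def hlin_add[OF hlin_Ct] hlin_scale[OF hlin_Ct] Ct_Tn_XY
        braid_A distrib_left distrib_right add_ac vpow_add')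
  qed
  show "g = a \<or> g = Gs \<Longrightarrow> ?thesis" using 1 2 by auto
qed

lemma len_wJ_y: "len (A * (S * (A * (S * y)))) = len y + 4" "len (A * (S * (A * y))) = len y + 3"
  "len (S * (A * (S * y))) = len y + 3" "len (A * (S * y)) = len y + 2" "len (S * (A * y)) = len y + 2"
  "len (A * y) = len y + 1" "len (S * y) = len y + 1"
  using XYy by (simp_all add: len_up)

text \<open>By the eigenvector property every Kazhdan-Lusztig component has both \<open>a\<close>
  and \<open>Gs\<close> as left descents, hence begins with w_J.\<close>

lemma not_fc_span_CJ: "not_fc_span (len y + 4) (Tn (A * (S * (A * (S * y)))) + lower_part y)"
  unfolding not_fc_span_def
proof (intro allI impI conjI)
  fix u assume nz: "KL_coeff (Tn (A * (S * (A * (S * y)))) + lower_part y) u \<noteq> 0"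
  show "not_fc u" using not_fc_AS KL_coeff_eigen[OF Ct_CJ nz] by blast
  show "len u \<le> len y + 4"
  proof (rule KL_coeff_len[OF _ nz])
    fix v assume "tc (Tn (A * (S * (A * (S * y)))) + lower_part y) v \<noteq> 0"
    then have "v \<in> {A * (S * (A * (S * y))), A * (S * (A * y)), S * (A * (S * y)), A * (S * y),
        S * (A * y), A * y, S * y, y}"
      by (auto simp: lower_part_def tc_Tn split: if_splits)
    then show "len v \<le> len y + 4" using len_wJ_y by auto
  qed
qed

end

end

lemma lookup_KL_coeff_Tn_pos: "0 < n \<Longrightarrow> lookup (KL_coeff (Tn w) u) n = 0"
  using deg_leD[OF deg_le_KL_coeff_Tn] by blast

lemma lookup_KL_coeff_Tn_not_fc: "\<not> not_fc u \<Longrightarrow> not_fc w \<Longrightarrow> lookup (KL_coeff (Tn w) u) 0 = 0"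
  by (auto simp: lookup_KL_coeff_Tn_0)

section \<open>The coefficient of v^-1 in the translates of the lower terms\<close>

context special_vertex
begin

lemma not_fc_XY:
  "Y w < 0 \<Longrightarrow> X w < Y w \<Longrightarrow> not_fc w"
  "1 < X w \<Longrightarrow> X w < Y w \<Longrightarrow> not_fc w"
  "0 \<le> Y w \<Longrightarrow> not_fc w \<Longrightarrow> not_fc (A * w)"
  "Y w \<le> X w \<Longrightarrow> not_fc w \<Longrightarrow> not_fc (S * w)"
  "X w \<le> 1 \<Longrightarrow> not_fc w \<Longrightarrow> not_fc (B * w)"
  using not_fc_AS[of w] not_fc_dsc[of "opp a" w] not_fc_gen[of a w] not_fc_gen[of Gs w] not_fc_gen[of "opp a" w] a_cases
  by (auto simp: dsc_A dsc_S dsc_B simp del: not_less)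

lemmas Lt_expand = lower_part_def hlin_add[OF hlin_Lt] hlin_scale[OF hlin_Lt] Lt_Tn_XY

context
  fixes y u :: W
  assumes y: "\<not> dsc a y" "\<not> dsc Gs y" and u: "\<not> not_fc u"
begin

text \<open>A component $T_z$ picks up one power of $v$ for each letter that is a left descent. Whenever
  this compensates the power of $v$ in \<open>lower_part\<close> but one, the component contains $w_J$ or
  its mirror image, so it does not contribute.\<close>

lemma lower_part_1:
  "lookup (KL_coeff (lower_part y) u) (- 1) =
    lookup (KL_coeff (Tn (A * (S * (A * y)))) u) 0 + lookup (KL_coeff (Tn (S * (A * (S * y)))) u) 0"
  by (simp add: lower_part_def lookup_add lookup_KL_coeff_Tn_pos)

lemma lower_part_B:
  "lookup (KL_coeff (Lt (opp a) (lower_part y)) u) (- 1) =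
    lookup (KL_coeff (Tn (B * (A * (S * (A * y))))) u) 0 + lookup (KL_coeff (Tn (B * (S * (A * (S * y))))) u) 0"
proof -
  show ?thesis using XYy[OF y]
    by (cases "1 < X y"; cases "1 < Y y"; (simp add: Lt_expand)?; (simp add: lookup_add lookup_minus lookup_xi_mult mult.assoc)?;
        (simp add: lookup_KL_coeff_Tn_pos)?; (simp add: lookup_KL_coeff_Tn_not_fc[OF u] not_fc_XY)?)
qed

lemma lower_part_SB:
  "lookup (KL_coeff (Lt Gs (Lt (opp a) (lower_part y))) u) (- 1) =
    lookup (KL_coeff (Tn (S * (B * (A * (S * (A * y)))))) u) 0 +
    lookup (KL_coeff (Tn (S * (B * (S * (A * (S * y)))))) u) 0"
proof -
  show ?thesis using XYy[OF y]
    by (cases "1 < X y"; cases "1 < Y y"; cases "2 + Y y < X y"; cases "2 < X y + Y y";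
        (simp add: Lt_expand)?; (simp add: lookup_add lookup_minus lookup_xi_mult mult.assoc)?;
        (simp add: lookup_KL_coeff_Tn_pos)?; (simp add: lookup_KL_coeff_Tn_not_fc[OF u] not_fc_XY)?)
qed

lemma lower_part_ASB:
  "lookup (KL_coeff (Lt a (Lt Gs (Lt (opp a) (lower_part y)))) u) (- 1) =
    lookup (KL_coeff (Tn (A * (S * (B * (A * (S * (A * y))))))) u) 0 +
    lookup (KL_coeff (Tn (A * (S * (B * (S * (A * (S * y))))))) u) 0"
proof -
  \<comment> \<open>Descents of the components are inequalities in the coordinates of
    \<open>y\<close>. The cases ask for its side of the lines X = 1, Y = 1, X - Y = 2, X + Y = 2 and
    Y = 2.\<close>
  show ?thesis using XYy[OF y]
    by (cases "1 < X y"; cases "1 < Y y"; cases "2 + Y y < X y"; cases "2 < X y + Y y"; cases "2 < Y y";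
        (simp add: Lt_expand)?; (simp add: lookup_add lookup_minus lookup_xi_mult mult.assoc)?;
        (simp add: lookup_KL_coeff_Tn_pos)?; (simp add: lookup_KL_coeff_Tn_not_fc[OF u] not_fc_XY)?)
qed

end

end

text \<open>At a fully commutative \<open>u\<close> the coordinate of the whole sum is zero, so the
  contribution - \<open>mu u w\<close> of \<open>Tn w\<close> is balanced by
  \<open>h\<close>.\<close>

lemma mu_from_not_fc_span:
  assumes "not_fc_span n (Tn w + h)" "\<not> not_fc u" "u < w"
  shows "mu u w = lookup (KL_coeff h u) (- 1)"
proof -
  have "KL_coeff (Tn w + h) u = 0" using assms by (auto simp: not_fc_span_def)
  then have "lookup (KL_coeff (Tn w) u) (- 1) + lookup (KL_coeff h u) (- 1) = 0"
    by (metis KL_coeff_linear(2) lookup_add lookup_zero)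
  then show ?thesis using lookup_KL_coeff_Tn_minus_1[OF assms(3)] by simp
qed

context special_vertex
begin

lemma mu_wJ_step:
  fixes y :: W
  assumes y: "\<not> dsc a y" "\<not> dsc Gs y" and u: "\<not> not_fc u" "u < w" "mu u w \<noteq> 0"
    and w: "w = x * (wJ a * y)" "len w = len x + 4 + len y" and x: "x \<in> {1, B, S * B, A * (S * B)}"
    and IH: "\<And>v. not_fc v \<Longrightarrow> len v < len w \<Longrightarrow> dsc_closed v"
  shows "len w = Suc (len u) \<and> (\<forall>g. dsc g u \<longrightarrow> dsc g w)"
proof -
  note XYy = XYy[OF y]
  let ?P = "A * (S * (A * (S * y)))"
  have span0: "not_fc_span (len y + 4) (Tn ?P + lower_part y)" by (rule not_fc_span_CJ[OF y])
  \<comment> \<open>The condition on \<open>len w\<close> is needed since \<open>dsc_closed\<close>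
    is available only below the length of \<open>w\<close>.\<close>
  have span1: "not_fc_span (len y + 5) (Tn (B * ?P) + Lt (opp a) (lower_part y))" if "len y + 4 < len w"
    using not_fc_span_Lt[OF IH span0, of "opp a"] that XYy
    by (simp add: hlin_add[OF hlin_Lt] Lt_Tn_XY eval_nat_numeral)
  have span2: "not_fc_span (len y + 6) (Tn (S * (B * ?P)) + Lt Gs (Lt (opp a) (lower_part y)))"
    if "len y + 5 < len w"
    using not_fc_span_Lt[OF IH span1, of Gs] that XYy
    by (simp add: hlin_add[OF hlin_Lt] Lt_Tn_XY eval_nat_numeral)
  have span3: "not_fc_span (len y + 7) (Tn (A * (S * (B * ?P))) + Lt a (Lt Gs (Lt (opp a) (lower_part y))))"
    if "len y + 6 < len w"
    using not_fc_span_Lt[OF IH span2, of a] that XYy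
    by (simp add: hlin_add[OF hlin_Lt] Lt_Tn_XY eval_nat_numeral)
  consider "w = ?P" | "w = B * ?P" "len y + 4 < len w" | "w = S * (B * ?P)" "len y + 5 < len w"
    | "w = A * (S * (B * ?P))" "len y + 6 < len w"
  proof -
    have "len w = len (x * ?P)" using w(1) by (simp add: wJ_mult)
    then show thesis using that w x XYy by (auto simp: wJ_mult mult.assoc len_up)
  qed
  then show ?thesis
  proof cases
    case 1
    have "mu u w = lookup (KL_coeff (Tn (A * (S * (A * y)))) u) 0 + lookup (KL_coeff (Tn (S * (A * (S * y)))) u) 0"
      using mu_from_not_fc_span[OF span0 u(1)] u(2) lower_part_1[OF y u(1)] 1 by simp
    then have *: "u = A * (S * (A * y)) \<or> u = S * (A * (S * y))" using u(3) by (auto simp: lookup_KL_coeff_Tn_0 split: if_splits)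
    then have "len w = Suc (len u)" using 1 XYy by (elim disjE) (simp_all add: len_up)
    moreover have "dsc g u \<longrightarrow> dsc g w" for g
      unfolding dsc_cases using * 1 XYy by (elim disjE) auto
    ultimately show ?thesis by blast
  next
    case 2
    have "mu u w = lookup (KL_coeff (Tn (B * (A * (S * (A * y))))) u) 0 + lookup (KL_coeff (Tn (B * (S * (A * (S * y))))) u) 0"
      using mu_from_not_fc_span[OF span1 u(1)] u(2) lower_part_B[OF y u(1)] 2 by simp
    then have *: "u = B * (A * (S * (A * y))) \<or> u = B * (S * (A * (S * y)))"
      using u(3) by (auto simp: lookup_KL_coeff_Tn_0 split: if_splits)
    then have "len w = Suc (len u)" using 2 XYy by (elim disjE) (simp_all add: len_up)
    moreover have "dsc g u \<longrightarrow> dsc g w" for g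
      unfolding dsc_cases using * 2 XYy by (elim disjE) auto
    ultimately show ?thesis by blast
  next
    case 3
    have "mu u w = lookup (KL_coeff (Tn (S * (B * (A * (S * (A * y)))))) u) 0 +
        lookup (KL_coeff (Tn (S * (B * (S * (A * (S * y)))))) u) 0"
      using mu_from_not_fc_span[OF span2 u(1)] u(2) lower_part_SB[OF y u(1)] 3 by simp
    then have *: "u = S * (B * (A * (S * (A * y)))) \<or> u = S * (B * (S * (A * (S * y))))"
      using u(3) by (auto simp: lookup_KL_coeff_Tn_0 split: if_splits)
    \<comment> \<open>Here \<open>opp a\<close> is a descent of \<open>u\<close> but not of
      \<open>w\<close> exactly when 1 < Y y; full commutativity of \<open>u\<close> rules this
      out.\<close>
    have n: "\<not> 1 < Y y" if "u = S * (B * (S * (A * (S * y))))"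
      using not_fc_XY(2)[of u] u(1) that XYy by auto
    have "dsc g u \<longrightarrow> dsc g w" for g
      using *
    proof
      assume u: "u = S * (B * (A * (S * (A * y))))"
      show ?thesis unfolding dsc_cases using u 3 XYy by auto
    next
      assume u: "u = S * (B * (S * (A * (S * y))))"
      show ?thesis unfolding dsc_cases using u 3 n[OF u] XYy by auto
    qed
    moreover have "len w = Suc (len u)" using * 3 XYy by (elim disjE) (simp_all add: len_up)
    ultimately show ?thesis by blast
  next
    case 4
    have "mu u w = lookup (KL_coeff (Tn (A * (S * (B * (A * (S * (A * y))))))) u) 0 +
        lookup (KL_coeff (Tn (A * (S * (B * (S * (A * (S * y))))))) u) 0"
      using mu_from_not_fc_span[OF span3 u(1)] u(2) lower_part_ASB[OF y u(1)] 4 by simp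
    then have *: "u = A * (S * (B * (A * (S * (A * y))))) \<or> u = A * (S * (B * (S * (A * (S * y)))))"
      using u(3) by (auto simp: lookup_KL_coeff_Tn_0 split: if_splits)
    have n1: "\<not> 1 < Y y" if "u = A * (S * (B * (S * (A * (S * y)))))"
    proof
      assume "1 < Y y"
      then have "not_fc (S * (B * (S * (A * (S * y)))))" using XYy by (intro not_fc_XY(2)) auto
      then have "not_fc u" unfolding that using XYy by (intro not_fc_XY(3)) auto
      then show False using u(1) by simp
    qed
    \<comment> \<open>For this \<open>u\<close> the only possible descent that \<open>w\<close>
      lacks is \<open>Gs\<close>, and it occurs exactly if 2 + Y y < X y.\<close>
    have n2: "\<not> 2 + Y y < X y" if "u = A * (S * (B * (A * (S * (A * y)))))"
      using not_fc_XY(1)[of u] u(1) that XYy by auto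
    have "dsc g u \<longrightarrow> dsc g w" for g
      using *
    proof
      assume u: "u = A * (S * (B * (A * (S * (A * y)))))"
      show ?thesis unfolding dsc_cases using u 4 n2[OF u] XYy by auto
    next
      assume u: "u = A * (S * (B * (S * (A * (S * y)))))"
      show ?thesis unfolding dsc_cases using u 4 n1[OF u] XYy by auto
    qed
    moreover have "len w = Suc (len u)" using * 4 XYy by (elim disjE) (simp_all add: len_up)
    ultimately show ?thesis by blast
  qed
qed

end

lemma mu_not_fc:
  assumes "not_fc w" "\<not> not_fc u" "u < w" "mu u w \<noteq> 0"
  shows "len w = Suc (len u) \<and> (\<forall>g. dsc g u \<longrightarrow> dsc g w)"
  using assms
proof (induction "len w" arbitrary: w u rule: less_induct)
  case less
  obtain a x y where *: "a \<noteq> Gs" "w = x * (wJ a * y)" "len w = len x + 4 + len y"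
    "x \<in> {1, of_gen (opp a), of_gen Gs * of_gen (opp a), of_gen a * (of_gen Gs * of_gen (opp a))}"
    "\<not> dsc a y" "\<not> dsc Gs y"
    by (rule not_fc_cases[OF less.prems(1)])
  interpret special_vertex a using * by unfold_locales
  have "dsc_closed v" if "not_fc v" "len v < len w" for v
    unfolding dsc_closed_def using less.hyps that by blast
  then show ?case using mu_wJ_step[OF *(5,6) less.prems(2-4) *(2,3,4)] by blast
qed

section \<open>Degrees of structure constants\<close>

fun refl_lin :: "gen \<Rightarrow> real \<times> real \<Rightarrow> real \<times> real" where
  "refl_lin Gr (x, y) = (x, - y)"
| "refl_lin Gs (x, y) = (y, x)"
| "refl_lin Gt (x, y) = (- x, y)"

fun wall_lin :: "gen \<Rightarrow> real \<times> real \<Rightarrow> real" where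
  "wall_lin Gr (x, y) = y"
| "wall_lin Gs (x, y) = x - y"
| "wall_lin Gt (x, y) = - x"

definition ray :: "real \<times> real \<Rightarrow> real \<Rightarrow> real \<times> real \<Rightarrow> real \<times> real" where
  "ray p k d = (fst p + k * fst d, snd p + k * snd d)"

definition pdiff :: "real \<times> real \<Rightarrow> real \<times> real \<Rightarrow> real \<times> real" where
  "pdiff p r = (fst p - fst r, snd p - snd r)"

definition act_lin :: "W \<Rightarrow> real \<times> real \<Rightarrow> real \<times> real" where
  "act_lin w d = pdiff (act w d) (act w (0, 0))"

lemma wall_ray: "wall g (ray p k d) = wall g p + k * wall_lin g d"
  by (cases g; cases p; cases d) (auto simp: ray_def algebra_simps)

lemma wall_pdiff: "wall_lin g (pdiff p r) = wall g p - wall g r"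
  by (cases g; cases p; cases r) (auto simp: pdiff_def)

lemma refl_ray: "refl_pt g (ray p k d) = ray (refl_pt g p) k (refl_lin g d)"
  by (cases g; cases p; cases d) (auto simp: ray_def algebra_simps)

lemma refl_pdiff: "pdiff (refl_pt g p) (refl_pt g r) = refl_lin g (pdiff p r)"
  by (cases g; cases p; cases r) (auto simp: pdiff_def)

lemma refl_fixed: "wall g p = 0 \<Longrightarrow> refl_pt g p = p"
  by (cases g; cases p) auto

text \<open>Linear parts are signed permutations and the constants are even. Integer witnesses are
  kept so that positions inside a strip can be settled by integrality.\<close>

lemma act_affine:
  "\<exists>e1 e2 c1 c2 :: int. \<bar>e1\<bar> = 1 \<and> \<bar>e2\<bar> = 1 \<and> even c1 \<and> even c2 \<and>
    ((\<forall>(x :: real) (y :: real). act w (x, y) = (of_int e1 * x + of_int c1, of_int e2 * y + of_int c2)) \<or>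
     (\<forall>(x :: real) (y :: real). act w (x, y) = (of_int e1 * y + of_int c1, of_int e2 * x + of_int c2)))"
proof (induction w rule: W_left_induct)
  case one
  show ?case by (rule exI[of _ 1], rule exI[of _ 1], rule exI[of _ 0], rule exI[of _ 0]) simp
next
  case (gen g w)
  then obtain e1 e2 c1 c2 :: int where *: "\<bar>e1\<bar> = 1" "\<bar>e2\<bar> = 1" "even c1" "even c2"
    "(\<forall>(x :: real) (y :: real). act w (x, y) = (of_int e1 * x + of_int c1, of_int e2 * y + of_int c2)) \<or> (\<forall>(x :: real) (y :: real). act w (x, y) = (of_int e1 * y + of_int c1, of_int e2 * x + of_int c2))"
    by (elim exE conjE) (rule that, assumption+)
  show ?case
  proof (cases g)
    case Gr
    show ?thesis by (rule exI[of _ e1], rule exI[of _ "- e2"], rule exI[of _ c1], rule exI[of _ "- c2"]) (use * in \<open>auto simp: act_mult Gr\<close>)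
  next
    case Gs
    show ?thesis by (rule exI[of _ e2], rule exI[of _ e1], rule exI[of _ c2], rule exI[of _ c1]) (use * in \<open>auto simp: act_mult Gs\<close>)
  next
    case Gt
    show ?thesis by (rule exI[of _ "- e1"], rule exI[of _ e2], rule exI[of _ "2 - c1"], rule exI[of _ c2]) (use * in \<open>auto simp: act_mult Gt\<close>)
  qed
qed

lemma act_affineE:
  obtains e1 e2 c1 c2 :: int where "\<bar>e1\<bar> = 1" "\<bar>e2\<bar> = 1" "even c1" "even c2"
    "(\<forall>(x :: real) (y :: real). act w (x, y) = (of_int e1 * x + of_int c1, of_int e2 * y + of_int c2)) \<or>
     (\<forall>(x :: real) (y :: real). act w (x, y) = (of_int e1 * y + of_int c1, of_int e2 * x + of_int c2))"
  using act_affine[of w] by (elim exE conjE) (rule that, assumption+)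

lemma act_lin_pdiff: "act_lin w (pdiff p r) = pdiff (act w p) (act w r)"
proof -
  obtain e1 e2 c1 c2 :: int where
    "(\<forall>(x :: real) (y :: real). act w (x, y) = (of_int e1 * x + of_int c1, of_int e2 * y + of_int c2)) \<or> (\<forall>(x :: real) (y :: real). act w (x, y) = (of_int e1 * y + of_int c1, of_int e2 * x + of_int c2))"
    by (rule act_affineE[of w])
  then show ?thesis by (cases p; cases r) (auto simp: act_lin_def pdiff_def algebra_simps)
qed

lemma act_lin_1 [simp]: "act_lin 1 d = d"
  by (simp add: act_lin_def pdiff_def)

lemma act_lin_gen: "act_lin (w * of_gen g) d = act_lin w (refl_lin g d)"
proof -
  obtain e1 e2 c1 c2 :: int where
    "(\<forall>(x :: real) (y :: real). act w (x, y) = (of_int e1 * x + of_int c1, of_int e2 * y + of_int c2)) \<or> (\<forall>(x :: real) (y :: real). act w (x, y) = (of_int e1 * y + of_int c1, of_int e2 * x + of_int c2))"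
    by (rule act_affineE[of w])
  then show ?thesis by (cases g; cases d) (auto simp: act_lin_def pdiff_def act_mult algebra_simps)
qed

text \<open>The number of directions of reflecting lines with respect to which \<open>d\<close> points from the side
  of \<open>u\<close> to the other side.\<close>

definition bad :: "real \<times> real \<Rightarrow> real \<times> real \<Rightarrow> nat" where
  "bad u d = of_bool (fst u * fst d < 0) + of_bool (snd u * snd d < 0) +
     of_bool ((fst u + snd u) * (fst d + snd d) < 0) + of_bool ((fst u - snd u) * (fst d - snd d) < 0)"

lemma bad_le: "bad u d \<le> 4"
  by (auto simp: bad_def of_bool_def)

lemma bad_le': "int (bad u d) \<le> 4"
  using bad_le[of u d] by linarith

lemma bad_le_3: "fst d = 0 \<or> snd d = 0 \<or> fst d + snd d = 0 \<or> fst d = snd d \<Longrightarrow> bad u d \<le> 3"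
  by (auto simp: bad_def of_bool_def)

lemma bad_refl: "bad (refl_lin g u) (refl_lin g d) = bad u d"
proof -
  have 1: "(- x - y) * (- x' - y') = (x + y) * (x' + y')" "(- x + y) * (- x' + y') = (x - y) * (x' - y')"
    "(y - x) * (y' - x') = (x - y) * (x' - y')" "(y + x) * (y' + x') = (x + y) * (x' + y')"
    for x y x' y' :: real by (simp_all add: algebra_simps)
  show ?thesis
    by (cases g; cases u; cases d) (simp_all add: bad_def 1)
qed

lemma bad_move: assumes "0 \<le> t" shows "bad (ray u t d) d \<le> bad u d"
proof -
  have *: "of_bool ((x + t * y) * y < 0) \<le> (of_bool (x * y < 0) :: nat)" for x y :: real
  proof -
    have "(x + t * y) * y = x * y + t * (y * y)" by (simp add: algebra_simps)
    moreover have "0 \<le> t * (y * y)" using assms by simp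
    ultimately show ?thesis by (auto simp: of_bool_def)
  qed
  have eq: "(fst u + t * fst d + (snd u + t * snd d)) = (fst u + snd u) + t * (fst d + snd d)"
    "(fst u + t * fst d - (snd u + t * snd d)) = (fst u - snd u) + t * (fst d - snd d)"
    by (simp_all add: algebra_simps)
  show ?thesis unfolding bad_def ray_def fst_conv snd_conv eq
    by (intro add_mono *)
qed

text \<open>A rearrangement principle for signs, meant for the two directions of lines that a
  reflection interchanges.\<close>

lemma sign_changes:
  fixes a b c d :: real
  assumes "b < a" "c < d"
  shows "of_bool (a * d < 0) + of_bool (b * c < 0) \<le> (of_bool (a * c < 0) + of_bool (b * d < 0) :: nat)"
  using assms by (auto simp: mult_less_0_iff of_bool_def)

text \<open>The direction of the wall of \<open>g\<close> stops being bad. The perpendicular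
  direction is unaffected, and the other two are interchanged, which does not increase their count
  by \<open>sign_changes\<close>.\<close>

lemma bad_fold:
  assumes "0 < wall_lin g u" "wall_lin g d < 0"
  shows "bad u (refl_lin g d) + 1 \<le> bad u d"
proof -
  obtain x y where u: "u = (x, y)" by (cases u)
  obtain x' y' where d: "d = (x', y')" by (cases d)
  show ?thesis
  proof (cases g)
    case Gr
    then have "0 < y" "y' < 0" using assms by (auto simp: u d)
    then have "y * y' < 0" "\<not> y * - y' < 0" by (auto simp: mult_pos_neg not_less intro: less_imp_le)
    moreover have "of_bool ((x + y) * (x' - y') < 0) + of_bool ((x - y) * (x' + y') < 0)
        \<le> (of_bool ((x + y) * (x' + y') < 0) + of_bool ((x - y) * (x' - y') < 0) :: nat)"
      using \<open>0 < y\<close> \<open>y' < 0\<close> by (intro sign_changes) auto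
    ultimately show ?thesis using Gr by (simp add: u d bad_def)
  next
    case Gs
    then have lt: "y < x" "x' < y'" using assms by (auto simp: u d)
    then have "(x - y) * (x' - y') < 0" "\<not> (x - y) * (y' - x') < 0"
      by (auto simp: mult_pos_neg not_less intro!: mult_nonneg_nonneg)
    moreover have "of_bool (x * y' < 0) + of_bool (y * x' < 0)
        \<le> (of_bool (x * x' < 0) + of_bool (y * y' < 0) :: nat)"
      using lt by (intro sign_changes)
    ultimately show ?thesis using Gs by (simp add: u d bad_def add.commute)
  next
    case Gt
    then have "x < 0" "0 < x'" using assms by (auto simp: u d)
    then have "x * x' < 0" "\<not> x * - x' < 0" by (auto simp: mult_neg_pos not_less intro: less_imp_le)
    moreover have "of_bool ((y - x) * (y' + x') < 0) + of_bool ((y + x) * (y' - x') < 0)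
        \<le> (of_bool ((y - x) * (y' - x') < 0) + of_bool ((y + x) * (y' + x') < 0) :: nat)"
      using \<open>x < 0\<close> \<open>0 < x'\<close> by (intro sign_changes) auto
    moreover have "(y - x) * (y' + x') = (x - y) * (- x' - y')" "(y + x) * (y' - x') = (x + y) * (- x' + y')"
      "(y - x) * (y' - x') = (x - y) * (x' - y')" "(y + x) * (y' + x') = (x + y) * (x' + y')"
      by (simp_all add: algebra_simps)
    ultimately show ?thesis using Gt by (simp add: u d bad_def)
  qed
qed

text \<open>The linear form of the wall crossed at a letter of a reduced expression of \<open>x\<close>, read from
  the right, decreases along \<open>d\<close>.\<close>

definition crossing :: "W \<Rightarrow> real \<times> real \<Rightarrow> bool" where
  "crossing x d \<longleftrightarrow> (\<forall>x1 g x2. x = x1 * (of_gen g * x2) \<longrightarrow> len x = len x1 + 1 + len x2 \<longrightarrow>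
     wall_lin g (act_lin x2 d) < 0)"

lemma hmult_Tn_Lt:
  assumes "rdsc x g"
  shows "hmult (Tn x) k = hmult (Tn (x * of_gen g)) (Lt g k)"
  using hmult_gen_Tn[of "x * of_gen g" g k] assms by (simp add: mult.assoc)

text \<open>The terms of the expansion of $T_x T_y$ correspond to folded galleries. A point moves along a
  segment of direction \<open>d\<close>; folding away from the base point \<open>act y base_pt\<close> reflects \<open>d\<close> and reduces
  the number of bad directions.\<close>

lemma deg_le_fold:
  assumes "\<And>g. 0 \<le> wall g p" "0 \<le> k" "\<And>g. 0 \<le> wall g (act x (ray p k d))" "crossing x d"
  shows "deg_le (tc (hmult (Tn x) (Tn y)) z) (int (bad (pdiff p (act y base_pt)) d))"
  using assms
proof (induction "len x" arbitrary: x p k d y z rule: less_induct)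
  case less
  let ?b = "ray p k d"
  show ?case
  proof (cases "x = 1")
    case True
    have "deg_le (tc (Tn y) z) 0" by (simp add: tc_Tn)
    then show ?thesis using True by (auto elim!: deg_le_mono)
  next
    case False
    have neg: "wall_lin g d < 0" if "rdsc x g" for g
    proof -
      have "x = (x * of_gen g) * (of_gen g * 1)" "len x = len (x * of_gen g) + 1 + len 1"
        using len_rdsc[OF that] by (simp_all add: mult.assoc)
      then have "wall_lin g (act_lin 1 d) < 0"
        using less.prems(4) unfolding crossing_def by blast
      then show ?thesis by simp
    qed
    have inv: "act (inverse x) (act x P) = P" for P
      by (simp add: act_mult[symmetric] W_left_inverse)
    have b: "wall g ?b \<le> 0" if "rdsc x g" for g
    proof -
      have "\<not> dsc g (of_gen g * inverse x)" using that by (simp add: rdsc_iff)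
      then have "0 \<le> wall g (act (of_gen g * inverse x) (act x ?b))"
        by (intro wall_act less.prems(3)) simp_all
      then show ?thesis by (simp add: act_mult inv)
    qed
    have b': "0 \<le> wall g ?b" if "\<not> rdsc x g" for g
    proof -
      have "\<not> dsc g (inverse x)" using that by (simp add: rdsc_iff)
      then have "0 \<le> wall g (act (inverse x) (act x ?b))"
        by (intro wall_act less.prems(3)) simp_all
      then show ?thesis by (simp add: inv)
    qed
    \<comment> \<open>The parameter at which the ray meets the wall of \<open>g\<close>. The letter
      split off from \<open>x\<close> is the right descent whose wall is met earliest.\<close>
    define \<theta> where "\<theta> g = wall g p / (- wall_lin g d)" for g
    have "finite (UNIV :: gen set)"
    proof -
      have "(UNIV :: gen set) = {Gr, Gs, Gt}" by (auto intro: gen.exhaust)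
      then show ?thesis by (metis finite.emptyI finite_insert)
    qed
    then have fin: "finite {g. rdsc x g}" by (rule rev_finite_subset) simp
    obtain g0 where "rdsc x g0" using False by (rule exists_rdsc)
    then have "Min (\<theta> ` {g. rdsc x g}) \<in> \<theta> ` {g. rdsc x g}"
      using fin by (intro Min_in) auto
    then obtain g where "rdsc x g" "\<theta> g = Min (\<theta> ` {g. rdsc x g})" by auto
    then have g: "rdsc x g" "\<And>h. rdsc x h \<Longrightarrow> \<theta> g \<le> \<theta> h" using fin by auto
    have wp: "\<theta> h * wall_lin h d = - wall h p" if "rdsc x h" for h
      using neg[OF that] by (simp add: \<theta>_def)
    have \<theta>0: "0 \<le> \<theta> g"
      unfolding \<theta>_def using neg[OF g(1)] less.prems(1)[of g] by (intro divide_nonneg_pos) auto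
    have \<theta>k: "\<theta> g \<le> k"
    proof -
      have "k * wall_lin g d \<le> \<theta> g * wall_lin g d"
        using b[OF g(1)] wp[OF g(1)] by (simp add: wall_ray)
      then show ?thesis using neg[OF g(1)] by (simp add: mult_le_cancel_right)
    qed
    define p1 where "p1 = ray p (\<theta> g) d"
    \<comment> \<open>For right descents this is the minimal choice of \<open>\<theta> g\<close>;
      for the other generators both ends of the segment are on the nonnegative side, hence so is
      \<open>p1\<close>.\<close>
    have p1: "0 \<le> wall h p1" for h
    proof (cases "rdsc x h")
      case True
      then have "\<theta> h * wall_lin h d \<le> \<theta> g * wall_lin h d"
        using neg[OF True] g(2)[OF True] by (simp add: mult_right_mono_neg)
      then show ?thesis using wp[OF True] by (simp add: p1_def wall_ray)
    next
      case False
      show ?thesis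
      proof (cases "0 \<le> wall_lin h d")
        case True
        then show ?thesis using less.prems(1)[of h] \<theta>0 by (simp add: p1_def wall_ray)
      next
        case neg: False
        then have "k * wall_lin h d \<le> \<theta> g * wall_lin h d" using \<theta>k by (simp add: mult_right_mono_neg)
        then show ?thesis using b'[OF False] by (simp add: p1_def wall_ray)
      qed
    qed
    have p1g: "wall g p1 = 0" using wp[OF g(1)] by (simp add: p1_def wall_ray)
    let ?x1 = "x * of_gen g" and ?d1 = "refl_lin g d"
    have lx: "len x = Suc (len ?x1)" using len_rdsc[OF g(1)] .
    have "ray p1 (k - \<theta> g) d = ?b" by (simp add: p1_def ray_def algebra_simps)
    then have "ray p1 (k - \<theta> g) ?d1 = refl_pt g ?b"
      by (metis p1g refl_fixed refl_ray)
    then have w1: "0 \<le> wall h (act ?x1 (ray p1 (k - \<theta> g) ?d1))" for h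
      using less.prems(3)[of h] by (simp add: act_mult)
    \<comment> \<open>A length-additive factorisation of \<open>?x1\<close> becomes one of
      \<open>x\<close> by appending \<open>g\<close>, and appending \<open>g\<close> reflects the
      direction.\<close>
    have cr: "crossing ?x1 ?d1"
      unfolding crossing_def
    proof (intro allI impI)
      fix x1 h x2 assume *: "?x1 = x1 * (of_gen h * x2)" "len ?x1 = len x1 + 1 + len x2"
      have x: "x = x1 * (of_gen h * (x2 * of_gen g))"
        using * by (simp add: gen_eq_iff_right mult.assoc)
      have "len x \<le> len x1 + (1 + len (x2 * of_gen g))"
        using len_mult_le[of x1 "of_gen h * (x2 * of_gen g)"] len_gen_le[of h "x2 * of_gen g"]
        unfolding x[symmetric] by simp
      moreover have "len (x2 * of_gen g) \<le> Suc (len x2)" using len_mult_le[of x2 "of_gen g"] by simp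
      ultimately have "len x = len x1 + 1 + len (x2 * of_gen g)" using * lx by simp
      then have "wall_lin h (act_lin (x2 * of_gen g) d) < 0"
        using less.prems(4) x unfolding crossing_def by blast
      then show "wall_lin h (act_lin x2 ?d1) < 0" by (simp add: act_lin_gen)
    qed
    have IH: "deg_le (tc (hmult (Tn ?x1) (Tn v)) z) (int (bad (pdiff p1 (act v base_pt)) ?d1))" for v
      by (rule less.hyps[of ?x1 p1 "k - \<theta> g"]) (use lx p1 \<theta>k w1 cr in auto)
    let ?u = "pdiff p1 (act y base_pt)"
    have "?u = ray (pdiff p (act y base_pt)) (\<theta> g) d"
      by (simp add: p1_def ray_def pdiff_def)
    then have le: "bad ?u d \<le> bad (pdiff p (act y base_pt)) d"
      using bad_move[OF \<theta>0] by simp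
    \<comment> \<open>Crossing without a fold: the direction and the base point are reflected
      together, so the number of bad directions is unchanged.\<close>
    have "pdiff p1 (act (of_gen g * y) base_pt) = refl_lin g ?u"
      using refl_pdiff[of g p1] by (simp add: act_mult refl_fixed[OF p1g])
    then have first: "deg_le (tc (hmult (Tn ?x1) (Tn (of_gen g * y))) z) (int (bad (pdiff p (act y base_pt)) d))"
      using IH[of "of_gen g * y"] le by (auto simp: bad_refl intro: deg_le_mono)
    \<comment> \<open>A fold: the direction is reflected and the base point is not. The loss of a
      bad direction pays for the factor \<open>xi\<close>.\<close>
    have second: "deg_le (xi * tc (hmult (Tn ?x1) (Tn y)) z) (int (bad (pdiff p (act y base_pt)) d))"
      if "dsc g y"
    proof -
      have "0 < wall_lin g ?u" using that dsc_base[of g y] by (simp add: wall_pdiff p1g)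
      then have "bad ?u ?d1 + 1 \<le> bad ?u d" using neg[OF g(1)] by (rule bad_fold)
      then show ?thesis using deg_le_xi[OF IH[of y]] le by (auto elim!: deg_le_mono)
    qed
    have "tc (hmult (Tn x) (Tn y)) z = tc (hmult (Tn ?x1) (Tn (of_gen g * y))) z +
        (if dsc g y then xi * tc (hmult (Tn ?x1) (Tn y)) z else 0)"
      by (simp add: hmult_Tn_Lt[OF g(1)] Lt_Tn hlin_add[OF hlin_hmult_right]
          hlin_scale[OF hlin_hmult_right] hlin_0[OF hlin_hmult_right])
    then show ?thesis using first second by (auto intro: deg_le_add)
  qed
qed

text \<open>The wall crossed at the letter \<open>g\<close> has the image of \<open>p\<close> on its
  nonnegative side and the image of \<open>c\<close> on its negative side, at distance at least
  \<open>e\<close> in the wall coordinate.\<close>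

lemma crossing_le:
  assumes p: "\<And>g. 0 \<le> wall g p" and c: "0 \<le> e" "\<And>g. e \<le> wall g c"
    and x: "x = x1 * (of_gen g * x2)" "len x = len x1 + 1 + len x2"
  shows "wall_lin g (act_lin x2 (pdiff (act (inverse x) c) p)) \<le> - e" "\<not> dsc g x2"
    "act (of_gen g * inverse x1) c = act x2 (act (inverse x) c)" "\<not> dsc g (inverse x1)"
proof -
  have "len x \<le> len x1 + len (of_gen g * x2)" unfolding x(1) by (rule len_mult_le)
  then show 1: "\<not> dsc g x2" using x(2) by simp
  have "len x \<le> len (x1 * of_gen g) + len x2"
    using len_mult_le[of "x1 * of_gen g" x2] by (simp add: x(1) mult.assoc)
  then have "\<not> rdsc x1 g" using x(2) by simp
  then show 2: "\<not> dsc g (inverse x1)" by (simp add: rdsc_iff)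
  show eq: "act (of_gen g * inverse x1) c = act x2 (act (inverse x) c)"
    by (simp add: x(1) W_inverse_mult act_mult[symmetric] mult.assoc W_right_inverse)
  have "e \<le> wall g (act (inverse x1) c)" by (rule wall_act[OF c(2,1) 2])
  then have "wall g (act x2 (act (inverse x) c)) \<le> - e" unfolding eq[symmetric] by (simp add: act_mult)
  moreover have "0 \<le> wall g (act x2 p)" by (rule wall_act[OF p _ 1]) simp
  ultimately show "wall_lin g (act_lin x2 (pdiff (act (inverse x) c) p)) \<le> - e"
    by (simp add: act_lin_pdiff wall_pdiff)
qed

text \<open>The segment runs from \<open>p\<close> to the image of \<open>c\<close> under
  \<open>inverse x\<close>. As \<open>c\<close> is an interior point, all crossings are
  strict.\<close>

lemma deg_le_interior:
  assumes p: "\<And>g. 0 \<le> wall g p" and c: "\<And>g. 0 < wall g c"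
  shows "deg_le (tc (hmult (Tn x) (Tn y)) z)
    (int (bad (pdiff p (act y base_pt)) (pdiff (act (inverse x) c) p)))"
proof (rule deg_le_fold[where k = 1])
  define e where "e = min (wall Gr c) (min (wall Gs c) (wall Gt c))"
  have e0: "0 < e" using c by (simp add: e_def)
  have e: "e \<le> wall g c" for g by (cases g) (auto simp: e_def)
  have "ray p 1 (pdiff (act (inverse x) c) p) = act (inverse x) c" by (simp add: ray_def pdiff_def)
  then show "0 \<le> wall g (act x (ray p 1 (pdiff (act (inverse x) c) p)))" for g
    using c[of g] by (simp add: act_mult[symmetric] W_right_inverse)
  show "crossing x (pdiff (act (inverse x) c) p)"
    unfolding crossing_def using crossing_le(1)[OF p less_imp_le[OF e0] e] e0 by fastforce
qed (use p in auto)

lemma deg_le_4: "deg_le (tc (hmult (Tn x) (Tn y)) z) 4"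
proof -
  have "0 \<le> wall g base_pt" for g using wall_base_pt[of g] by simp
  from deg_le_interior[OF this wall_base_pt, of x y z] show ?thesis
    by (rule deg_le_mono) (rule bad_le')
qed

text \<open>If reflecting lines of all four directions separate the alcove from the fundamental alcove,
  then so do all lines through some special point.\<close>

lemma not_fc_of_no_strip:
  assumes "act w base_pt = (X, Y)" "Y \<le> 0 \<or> 1 \<le> Y" "X \<le> 0 \<or> 1 \<le> X"
    "X - Y \<le> 0 \<or> 2 \<le> X - Y" "X + Y \<le> 0 \<or> 2 \<le> X + Y"
  shows "not_fc w"
  using assms
proof (induction "len w" arbitrary: w X Y rule: less_induct)
  case less
  have d: "dsc Gr w \<longleftrightarrow> Y < 0" "dsc Gs w \<longleftrightarrow> X < Y" "dsc Gt w \<longleftrightarrow> 1 < X"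
    using less.prems(1) by (auto simp: dsc_base)
  have ne: "Y \<noteq> 0" "X \<noteq> Y" "X \<noteq> 1"
    using wall_base_neq_0[of Gr w] wall_base_neq_0[of Gs w] wall_base_neq_0[of Gt w] less.prems(1) by auto
  \<comment> \<open>Reflecting in a descent shortens \<open>w\<close>. What has to be checked in
    each case is that the reflected point still avoids all four strips.\<close>
  have step: "not_fc w" if "dsc g w" "refl_pt g (X, Y) = (X', Y')" "Y' \<le> 0 \<or> 1 \<le> Y'" "X' \<le> 0 \<or> 1 \<le> X'"
    "X' - Y' \<le> 0 \<or> 2 \<le> X' - Y'" "X' + Y' \<le> 0 \<or> 2 \<le> X' + Y'" for g X' Y'
  proof -
    have "not_fc (of_gen g * w)"
      by (rule less.hyps[of "of_gen g * w" X' Y']) (use that less.prems(1) in \<open>auto simp: act_mult\<close>)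
    then show ?thesis using not_fc_gen[of g "of_gen g * w"] that(1) by simp
  qed
  consider "X < Y" "Y < 0 \<or> 1 < X" | "X < Y" "0 < Y" "X < 1" | "Y < X" "Y < 0" "X < 1"
    | "Y < X" "Y < 0" "1 < X" "2 \<le> X + Y" | "Y < X" "Y < 0" "1 < X" "X + Y \<le> 0"
    | "Y < X" "0 < Y" "1 < X" | "Y < X" "0 < Y" "X < 1"
  proof -
    have "X < Y \<or> Y < X" "Y < 0 \<or> 0 < Y" "X < 1 \<or> 1 < X" using ne by auto
    then show thesis using less.prems(5) that by blast
  qed
  then show ?case
  proof cases
    case 1 then show ?thesis using not_fc_dsc[of Gr w] not_fc_dsc[of Gt w] d by auto
  next
    case 2
    then have "dsc Gs w" using d by simp
    moreover have "1 \<le> Y" "X \<le> 0" using 2 less.prems by linarith+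
    moreover have "X - Y \<le> - 2" using 2 \<open>1 \<le> Y\<close> \<open>X \<le> 0\<close> less.prems by linarith
    ultimately show ?thesis using less.prems by (intro step[of Gs Y X]) auto
  next
    case 3
    then have "dsc Gr w" using d by simp
    moreover have "X \<le> 0" "2 \<le> X - Y" using 3 less.prems by linarith+
    ultimately show ?thesis using 3 by (intro step[of Gr X "- Y"]) auto
  next
    case 4
    then have "dsc Gt w" using d by simp
    moreover have "2 \<le> X - Y" using 4 less.prems by linarith
    ultimately show ?thesis using 4 by (intro step[of Gt "2 - X" Y]) auto
  next
    case 5
    then have "dsc Gr w" using d by simp
    moreover have "2 \<le> X - Y" using 5 less.prems by linarith
    ultimately show ?thesis using 5 by (intro step[of Gr X "- Y"]) auto
  next
    case 6
    then have "dsc Gt w" using d by simp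
    moreover have "2 \<le> X - Y" "1 \<le> Y" using 6 less.prems by linarith+
    ultimately show ?thesis using 6 by (intro step[of Gt "2 - X" Y]) auto
  next
    case 7 then show ?thesis using less.prems by linarith
  qed
qed

text \<open>A segment parallel to one of the four directions of lines never has this direction among
  its bad ones.\<close>

lemma deg_le_3_strip:
  assumes p: "\<And>g. 0 \<le> wall g p" and c: "\<And>g. 0 < wall g c" and d: "d = pdiff (act (inverse x) c) p"
    and "fst d = 0 \<or> snd d = 0 \<or> fst d + snd d = 0 \<or> fst d = snd d"
  shows "deg_le (tc (hmult (Tn x) (Tn y)) z) 3"
proof -
  have "deg_le (tc (hmult (Tn x) (Tn y)) z) (int (bad (pdiff p (act y base_pt)) d))"
    unfolding d by (rule deg_le_interior[OF p c])
  moreover have "bad (pdiff p (act y base_pt)) d \<le> 3" by (rule bad_le_3) (rule assms(4))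
  ultimately show ?thesis by (auto elim!: deg_le_mono)
qed

text \<open>The remaining case: the segment joins two vertices on a line $x - y = 1$, which is not a
  reflecting line.\<close>

lemma deg_le_3_vertex:
  assumes w: "\<And>a b. act (inverse x) (a, b) = (f1 a b, f2 a b)"
    and D: "\<And>a b. f1 a b - f2 a b = 2 - (a - b)" and ne: "f1 1 0 \<noteq> 1"
  shows "deg_le (tc (hmult (Tn x) (Tn y)) z) 3"
proof -
  let ?v = "(1, 0) :: real \<times> real"
  let ?d = "pdiff (act (inverse x) ?v) ?v"
  have v: "0 \<le> wall g ?v" for g by (cases g) auto
  define k where "k = f1 1 0 - 1"
  have k: "?d = (k, k)" "k \<noteq> 0"
    using D[of 1 0] ne by (auto simp: w pdiff_def k_def)
  have cr: "crossing x ?d"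
    unfolding crossing_def
  proof (intro allI impI)
    fix x1 g x2 assume *: "x = x1 * (of_gen g * x2)" "len x = len x1 + 1 + len x2"
    note cl = crossing_le[of ?v 0, OF v order_refl v *]
    \<comment> \<open>From a vertex \<open>crossing_le\<close> gives only a weak inequality.
      Equality would mean crossing a reflecting line parallel to x - y = 1 that separates the two
      alcoves; but x - y is 1/2 and 3/2 at their base points, with no even integer in
      between.\<close>
    have "wall_lin g (act_lin x2 ?d) \<noteq> 0"
    proof
      assume 0: "wall_lin g (act_lin x2 ?d) = 0"
      obtain e1 e2 c1 c2 :: int where e: "\<bar>e1\<bar> = 1" "\<bar>e2\<bar> = 1" "even c1" "even c2"
        "(\<forall>(x :: real) (y :: real). act x2 (x, y) = (of_int e1 * x + of_int c1, of_int e2 * y + of_int c2)) \<or>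
         (\<forall>(x :: real) (y :: real). act x2 (x, y) = (of_int e1 * y + of_int c1, of_int e2 * x + of_int c2))"
        by (rule act_affineE[of x2])
      have lin: "act_lin x2 ?d = (of_int e1 * k, of_int e2 * k)"
        unfolding k(1) using e(5) by (auto simp: act_lin_def pdiff_def)
      have "g = Gs" "e1 = e2" using 0 e(1,2) k(2) unfolding lin by (cases g; auto)+
      have "\<not> dsc g x2" by (rule cl(2))
      then have 1: "0 < wall Gs (act x2 base_pt)"
        using dsc_base[of Gs x2] wall_base_neq_0[of Gs x2] \<open>g = Gs\<close> by auto
      have "wall g (act (of_gen g * inverse x1) base_pt) < 0"
        using dsc_base[of g "of_gen g * inverse x1"] dsc_gen_mult[of g "inverse x1"] cl(4) by blast
      moreover have "act (of_gen g * inverse x1) base_pt = act x2 (act (inverse x) base_pt)"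
        by (simp add: *(1) W_inverse_mult act_mult[symmetric] mult.assoc W_right_inverse)
      ultimately have 2: "wall Gs (act x2 (act (inverse x) base_pt)) < 0" using \<open>g = Gs\<close> by simp
      define b1 b2 where "b1 = f1 (3/4) (1/4)" and "b2 = f2 (3/4) (1/4)"
      have b: "act (inverse x) base_pt = (b1, b2)" "b1 - b2 = 3/2"
        using D[of "3/4" "1/4"] by (auto simp: w base_pt_def b1_def b2_def)
      obtain n1 n2 where n: "c1 = 2 * n1" "c2 = 2 * n2" using e(3,4) by (auto elim!: evenE)
      have "e1 = 1 \<or> e1 = - 1" using e(1) by auto
      then consider "1/2 + 2 * of_int (n1 - n2) > (0 :: real)" "3/2 + 2 * of_int (n1 - n2) < (0 :: real)"
        | "- 1/2 + 2 * of_int (n1 - n2) > (0 :: real)" "- 3/2 + 2 * of_int (n1 - n2) < (0 :: real)"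
        using 1[unfolded base_pt_def] 2[unfolded b(1)] e(5) \<open>e1 = e2\<close> b(2) unfolding n by auto
      then show False
      proof cases
        case 1 then show False by linarith
      next
        case 2
        then have "of_int 0 < (of_int (n1 - n2) :: real)" "of_int (n1 - n2) < (of_int 1 :: real)" by simp_all
        then show False unfolding of_int_less_iff by linarith
      qed
    qed
    then show "wall_lin g (act_lin x2 ?d) < 0" using cl(1) by simp
  qed
  have "deg_le (tc (hmult (Tn x) (Tn y)) z) (int (bad (pdiff ?v (act y base_pt)) ?d))"
  proof (rule deg_le_fold[where k = 1, OF v _ _ cr])
    have "ray ?v 1 ?d = act (inverse x) ?v" by (simp add: ray_def pdiff_def)
    then show "0 \<le> wall g (act x (ray ?v 1 ?d))" for g
      using v by (simp add: act_mult[symmetric] W_right_inverse)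
  qed simp
  moreover have "bad (pdiff ?v (act y base_pt)) ?d \<le> 3" by (rule bad_le_3) (simp add: k(1))
  ultimately show ?thesis by (auto elim!: deg_le_mono)
qed

text \<open>The start point is chosen at the same height in the strip as the end point. The
  fundamental alcove has such points for 0 < y < 1, 0 < x < 1 and 0 < x + y < 2, but in 0 < x - y <
  2 it reaches only up to x - y = 1.\<close>

lemma deg_le_3:
  assumes "\<not> not_fc x"
  shows "deg_le (tc (hmult (Tn x) (Tn y)) z) 3"
proof -
  have "\<not> not_fc (inverse x)" using assms not_fc_inverse[of "inverse x"] by auto
  obtain X Y where XY: "act (inverse x) base_pt = (X, Y)" by (cases "act (inverse x) base_pt")
  consider "0 < Y" "Y < 1" | "0 < X" "X < 1" | "0 < X + Y" "X + Y < 2"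
    | "0 < X - Y" "X - Y < 2" "\<not> (0 < X + Y \<and> X + Y < 2)"
    using not_fc_of_no_strip[OF XY] \<open>\<not> not_fc (inverse x)\<close> by (meson not_le)
  then show ?thesis
  proof cases
    case 1
    have "0 \<le> wall g ((Y + 1) / 2, Y)" for g using 1 by (cases g) auto
    then show ?thesis by (rule deg_le_3_strip[OF _ wall_base_pt HOL.refl]) (simp add: XY pdiff_def)
  next
    case 2
    have "0 \<le> wall g (X, X / 2)" for g using 2 by (cases g) auto
    then show ?thesis by (rule deg_le_3_strip[OF _ wall_base_pt HOL.refl]) (simp add: XY pdiff_def)
  next
    case 3
    have "0 \<le> wall g ((X + Y) / 2, (X + Y) / 2)" for g using 3 by (cases g) auto
    then show ?thesis
      by (rule deg_le_3_strip[OF _ wall_base_pt HOL.refl]) (simp add: XY pdiff_def field_simps)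
  next
    case 4
    obtain e1 e2 c1 c2 :: int where e: "\<bar>e1\<bar> = 1" "\<bar>e2\<bar> = 1" "even c1" "even c2"
      "(\<forall>(a :: real) (b :: real). act (inverse x) (a, b) = (of_int e1 * a + of_int c1, of_int e2 * b + of_int c2)) \<or>
       (\<forall>(a :: real) (b :: real). act (inverse x) (a, b) = (of_int e1 * b + of_int c1, of_int e2 * a + of_int c2))"
      by (rule act_affineE[of "inverse x"])
    obtain n1 n2 where n: "c1 = 2 * n1" "c2 = 2 * n2" using e(3,4) by (auto elim!: evenE)
    have e': "e1 = 1 \<or> e1 = - 1" "e2 = 1 \<or> e2 = - 1" using e(1,2) by auto
    have int: "n1 - n2 = m" if "of_int m - 1 < (of_int (n1 - n2) :: real)" "of_int (n1 - n2) < (of_int m + 1 :: real)" for m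
      using that by linarith
    \<comment> \<open>In this strip X - Y can only be 1/2, 1 or 3/2. The values 1/2 and 1 are
      attained at \<open>base_pt\<close> and at the vertex (1,0). The value 3/2 is not attained in
      the closed fundamental alcove; it splits into \<open>minus\<close> and \<open>swap\<close> by
      the linear part.\<close>
    consider (sum) "X - Y = 1" | (plus) "X - Y = 1/2"
      | (minus) "e1 = - 1" "e2 = - 1" "n1 - n2 = 1"
          "\<forall>(a :: real) (b :: real). act (inverse x) (a, b) = (of_int e1 * a + of_int c1, of_int e2 * b + of_int c2)"
      | (swap) "e1 = 1" "e2 = 1" "n1 - n2 = 1"
          "\<forall>(a :: real) (b :: real). act (inverse x) (a, b) = (of_int e1 * b + of_int c1, of_int e2 * a + of_int c2)"
      using e(5)
    proof
      assume *: "\<forall>(a :: real) (b :: real). act (inverse x) (a, b) = (of_int e1 * a + of_int c1, of_int e2 * b + of_int c2)"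
      then have D: "X - Y = of_int e1 * (3/4) - of_int e2 * (1/4) + 2 * of_int (n1 - n2)"
        using XY by (auto simp: base_pt_def n)
      show thesis
      proof (cases "e1 = e2")
        case True
        show thesis
        proof (cases "e1 = 1")
          case e1: True
          then have "n1 - n2 = 0" using D True 4 by (intro int) auto
          then show thesis using that(2) D True e1 by simp
        next
          case False
          then have "e1 = - 1" using e' by simp
          then have "n1 - n2 = 1" using D True 4 by (intro int) auto
          then show thesis using that(3)[OF _ _ _ *] \<open>e1 = - 1\<close> True by simp
        qed
      next
        case False
        then consider "e1 = 1" "e2 = - 1" | "e1 = - 1" "e2 = 1" using e' by auto
        then show thesis
        proof cases
          case 1
          then have "n1 - n2 = 0" using D 4 by (intro int) auto
          then show thesis using that(1) D 1 by simp
        next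
          case 2
          then have "n1 - n2 = 1" using D 4 by (intro int) auto
          then show thesis using that(1) D 2 by simp
        qed
      qed
    next
      assume *: "\<forall>(a :: real) (b :: real). act (inverse x) (a, b) = (of_int e1 * b + of_int c1, of_int e2 * a + of_int c2)"
      then have D: "X - Y = of_int e1 * (1/4) - of_int e2 * (3/4) + 2 * of_int (n1 - n2)"
        using XY by (auto simp: base_pt_def n)
      show thesis
      proof (cases "e1 = e2")
        case True
        show thesis
        proof (cases "e1 = 1")
          case e1: True
          then have "n1 - n2 = 1" using D True 4 by (intro int) auto
          then show thesis using that(4)[OF _ _ _ *] e1 True by simp
        next
          case False
          then have "e1 = - 1" using e' by simp
          then have "n1 - n2 = 0" using D True 4 by (intro int) auto
          then show thesis using that(2) D True \<open>e1 = - 1\<close> by simp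
        qed
      next
        case False
        then consider "e1 = 1" "e2 = - 1" | "e1 = - 1" "e2 = 1" using e' by auto
        then show thesis
        proof cases
          case 1
          then have "n1 - n2 = 0" using D 4 by (intro int) auto
          then show thesis using that(1) D 1 by simp
        next
          case 2
          then have "n1 - n2 = 1" using D 4 by (intro int) auto
          then show thesis using that(1) D 2 by simp
        qed
      qed
    qed
    then show ?thesis
    proof cases
      case sum
      have "0 \<le> wall g (1, 0)" for g by (cases g) auto
      then show ?thesis
        by (rule deg_le_3_strip[OF _ wall_base_pt HOL.refl]) (use sum in \<open>simp add: XY pdiff_def\<close>)
    next
      case plus
      have "0 \<le> wall g base_pt" for g using wall_base_pt[of g] by simp
      then show ?thesis
        by (rule deg_le_3_strip[OF _ wall_base_pt HOL.refl])
           (use plus in \<open>simp add: XY pdiff_def\<close>, simp add: base_pt_def)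
    next
      case minus
      then have n1: "n1 = n2 + 1" by simp
      \<comment> \<open>Otherwise the segment between the vertices would degenerate to a point. The
        base point would be (5/4,-1/4), in the strip 0 < x + y < 2 treated before.\<close>
      have "n2 \<noteq> 0"
      proof
        assume "n2 = 0"
        then have "X = - (3/4) + 2" "Y = - (1/4)" using minus(1,2,4) n1 XY by (auto simp: base_pt_def n)
        then show False using 4(3) by simp
      qed
      then show ?thesis
        by (intro deg_le_3_vertex[where ?f1.0 = "\<lambda>a b. - a + 2 * of_int n2 + 2" and ?f2.0 = "\<lambda>a b. - b + 2 * of_int n2"])
           (use minus(1,2,4) n1 in \<open>auto simp: n\<close>)
    next
      case swap
      then have n1: "n1 = n2 + 1" by simp
      \<comment> \<open>Parity shows that the image of the vertex (1,0) is a different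
        vertex.\<close>
      have "2 * real_of_int n2 + 2 \<noteq> 1"
      proof
        assume "2 * real_of_int n2 + 2 = 1"
        then have "real_of_int (2 * n2 + 2) = real_of_int 1" by simp
        then have "2 * n2 + 2 = 1" by (simp only: of_int_eq_iff)
        then show False by presburger
      qed
      then show ?thesis
        by (intro deg_le_3_vertex[where ?f1.0 = "\<lambda>a b. b + 2 * of_int n2 + 2" and ?f2.0 = "\<lambda>a b. a + 2 * of_int n2"])
           (use swap(1,2,4) n1 in \<open>auto simp: n\<close>)
    qed
  qed
qed

text \<open>Right multiplication by a generator is self-adjoint for the bilinear form in which the
  elements \<open>Tn w\<close> are orthonormal.\<close>

lemma tc_hmult_swap:
  "tc (hmult (Tn x) (Tn y)) z = tc (hmult (Tn z) (Tn (inverse y))) x"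
proof (induction y arbitrary: z rule: W_right_induct)
  case one
  show ?case by (auto simp: tc_Tn)
next
  case (gen g y)
  have "hmult (Tn x) (Tn (y * of_gen g)) = Rt g (hmult (Tn x) (Tn y))"
    using gen(1) by (simp add: hmult_Rt[symmetric] Rt_Tn)
  moreover have "hmult (Tn z) (Tn (inverse (y * of_gen g))) = hmult (Rt g (Tn z)) (Tn (inverse y))"
  proof -
    have "\<not> dsc g (inverse y)" using gen(1) by (simp add: rdsc_iff)
    then have "Tn (inverse (y * of_gen g)) = Lt g (Tn (inverse y))" by (simp add: W_inverse_mult Lt_Tn)
    then show ?thesis
      using hmult_assoc[of "Tn z" "Tn (of_gen g)" "Tn (inverse y)"] by (simp add: hmult_gen_left hmult_gen_right)
  qed
  ultimately show ?case
    by (simp add: tc_Rt Rt_Tn hlin_add[OF hlin_hmult_left] hlin_scale[OF hlin_hmult_left]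
        hlin_0[OF hlin_hmult_left] gen.IH)
qed

lemma deg_le_3_target: "\<not> not_fc z \<Longrightarrow> deg_le (tc (hmult (Tn x) (Tn y)) z) 3"
  unfolding tc_hmult_swap[of x y z] by (rule deg_le_3)

section \<open>From the standard basis to the structure constants and the a-function\<close>

lemma KL_expand_Tn: "KL_basis x = (\<Sum>u\<in>keys (KL_basis x). hscale (tc (KL_basis x) u) (Tn u))"
  by (rule Tn_expand) auto

lemma tc_hmult_KL:
  "tc (hmult (KL_basis x) (KL_basis y)) z = (\<Sum>u\<in>keys (KL_basis x). \<Sum>v\<in>keys (KL_basis y).
     tc (KL_basis x) u * tc (KL_basis y) v * tc (hmult (Tn u) (Tn v)) z)"
proof -
  have "hmult (KL_basis x) (KL_basis y)
      = (\<Sum>u\<in>keys (KL_basis x). hscale (tc (KL_basis x) u) (hmult (Tn u) (KL_basis y)))"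
    using arg_cong[OF KL_expand_Tn[of x], of "\<lambda>h. hmult h (KL_basis y)"]
    by (simp only: hlin_sum[OF hlin_hmult_left] hlin_scale[OF hlin_hmult_left])
  moreover have "hmult (Tn u) (KL_basis y)
      = (\<Sum>v\<in>keys (KL_basis y). hscale (tc (KL_basis y) v) (hmult (Tn u) (Tn v)))" for u
    using arg_cong[OF KL_expand_Tn[of y], of "hmult (Tn u)"]
    by (simp only: hlin_sum[OF hlin_hmult_right] hlin_scale[OF hlin_hmult_right])
  ultimately show ?thesis by (simp add: tc_sum sum_distrib_left mult.assoc)
qed

lemma deg_le_KL_0: "deg_le (tc (KL_basis x) u) 0"
  using deg_le_KL[of u x] by (cases "u = x") (auto elim: deg_le_mono)

text \<open>The coefficients of $v^4$ agree with those for the standard basis, because $v^4$ is the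
  highest possible power and the elements of the two bases differ by terms in $v^{-1}$.\<close>

lemma h_const_4:
  "deg_le (h_const x y z) 4" "lookup (h_const x y z) 4 = lookup (tc (hmult (Tn x) (Tn y)) z) 4"
proof -
  let ?h = "hmult (KL_basis x) (KL_basis y)"
  let ?t = "\<lambda>z u v. tc (KL_basis x) u * tc (KL_basis y) v * tc (hmult (Tn u) (Tn v)) z"
  have deg: "deg_le (tc ?h z) 4" for z
    unfolding tc_hmult_KL
    by (intro deg_le_sum deg_le_mult[OF deg_le_mult[OF deg_le_KL_0 deg_le_KL_0 order_refl] deg_le_4]) simp
  then have KL_coeff: "deg_le (KL_coeff ?h z) 4" for z by (rule deg_le_KL_coeff)
  then show "deg_le (h_const x y z) 4" by (simp add: h_const_def struct_consts_eq)
  have "lookup (h_const x y z) 4 = lookup (tc ?h z) 4"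
    using lookup_tc_top[OF KL_coeff, of z] by (simp add: h_const_def struct_consts_eq)
  also have "\<dots> = (\<Sum>u\<in>keys (KL_basis x). \<Sum>v\<in>keys (KL_basis y). lookup (?t z u v) 4)"
    by (simp add: tc_hmult_KL lookup_sum)
  also have "\<dots> = (\<Sum>u\<in>keys (KL_basis x). \<Sum>v\<in>keys (KL_basis y).
      if v = y then if u = x then lookup (tc (hmult (Tn x) (Tn y)) z) 4 else 0 else 0)"
  proof (intro sum.cong HOL.refl)
    fix u v
    have "deg_le (?t z u v) 3" if "u \<noteq> x"
      by (intro deg_le_mult[OF deg_le_mult[OF deg_le_KL[OF that] deg_le_KL_0 order_refl] deg_le_4]) simp
    moreover have "deg_le (?t z u v) 3" if "v \<noteq> y"
      by (intro deg_le_mult[OF deg_le_mult[OF deg_le_KL_0 deg_le_KL[OF that] order_refl] deg_le_4]) simp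
    ultimately show "lookup (?t z u v) 4
        = (if v = y then if u = x then lookup (tc (hmult (Tn x) (Tn y)) z) 4 else 0 else 0)"
      using deg_leD[of "?t z u v" 3 4] by auto
  qed
  also have "\<dots> = lookup (tc (hmult (Tn x) (Tn y)) z) 4"
    using tc_0_iff[of "KL_basis x" x] tc_0_iff[of "KL_basis y" y] by simp
  finally show "lookup (h_const x y z) 4 = lookup (tc (hmult (Tn x) (Tn y)) z) 4" .
qed

lemma a_fun_fc:
  assumes "\<not> not_fc z"
  shows "a_fun z \<le> 3"
proof -
  have "k \<le> 3" if "k \<in> keys (h_const x y z)" for x y k
  proof -
    have nz: "lookup (h_const x y z) k \<noteq> 0" using that by (simp add: in_keys_iff)
    have "lookup (h_const x y z) 4 = 0"
      unfolding h_const_4(2) by (rule deg_leD[OF deg_le_3_target[OF assms]]) simp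
    then have "k \<noteq> 4" using nz by auto
    moreover have "k \<le> 4" using h_const_4(1) nz by (auto simp: deg_le_def)
    ultimately show ?thesis by simp
  qed
  then have "enat 3 \<in> {enat n | n. \<forall>x y. \<forall>k\<in>keys (h_const x y z). k \<le> int n}" by auto
  then have "a_fun z \<le> enat 3" unfolding a_fun_def by (rule Inf_lower)
  then show ?thesis by (simp add: numeral_eq_enat)
qed

text \<open>Every use of the term with \<open>xi\<close> loses length, so at the largest possible
  length only the plain product contributes.\<close>

lemma tc_hmult_top:
  assumes "len x + len v \<le> len z"
  shows "tc (hmult (Tn x) (Tn v)) z = (if z = x * v then 1 else 0)"
  using assms
proof (induction x arbitrary: v rule: W_right_induct)
  case one
  show ?case by (simp add: tc_Tn)
next
  case (gen g x)
  have len: "len x + Suc (len v) \<le> len z" using gen(1,3) by (simp add: len_rasc)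
  have "tc (hmult (Tn x) (Tn (of_gen g * v))) z = (if z = x * (of_gen g * v) then 1 else 0)"
    using len len_gen_le[of g v] by (intro gen.IH) simp
  moreover have "tc (hmult (Tn x) (Tn v)) z = 0"
  proof -
    have "z \<noteq> x * v" using len len_mult_le[of x v] by auto
    then show ?thesis using gen.IH[of v] len by simp
  qed
  ultimately show ?case
    by (simp add: hmult_gen_Tn[OF gen(1)] Lt_Tn hlin_add[OF hlin_hmult_right]
        hlin_scale[OF hlin_hmult_right] hlin_0[OF hlin_hmult_right] mult.assoc)
qed

text \<open>\<open>Z\<close> is meant to be a coset of a parabolic subgroup, and \<open>h\<close> the result of multiplying
  $\tilde T_P$ by \<open>n\<close> generators that are left descents of \<open>P\<close>.\<close>

definition leading :: "W set \<Rightarrow> W \<Rightarrow> int \<Rightarrow> hecke \<Rightarrow> bool" where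
  "leading Z P n h \<longleftrightarrow> lookup (tc h P) n = 1 \<and> deg_le (tc h P) n \<and>
     (\<forall>u. u \<noteq> P \<longrightarrow> deg_le (tc h u) (n - 1)) \<and> (\<forall>u. tc h u \<noteq> 0 \<longrightarrow> u \<in> Z)"

text \<open>At the descent the diagonal entry \<open>xi\<close> raises the degree at
  \<open>P\<close> by one with leading coefficient 1, while the neighbour
  \<open>of_gen g * P\<close> only contributes lower degree.\<close>

lemma leading_Lt:
  assumes "leading Z P n h" "dsc g P" "\<And>u. u \<in> Z \<Longrightarrow> of_gen g * u \<in> Z"
  shows "leading Z P (n + 1) (Lt g h)"
proof -
  have deg: "deg_le (tc h u) n" for u
    using assms(1) deg_le_mono[of "tc h u" "n - 1" n] by (cases "u = P") (auto simp: leading_def)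
  have gP: "deg_le (tc h (of_gen g * P)) (n - 1)" using assms(1) by (simp add: leading_def)
  show ?thesis
    unfolding leading_def
  proof (intro conjI allI impI)
    show "lookup (tc (Lt g h) P) (n + 1) = 1"
      using assms(1,2) deg_leD[OF gP, of "n + 1"] deg_leD[OF deg, of "2 + n" P]
      by (simp add: tc_Lt lookup_add lookup_xi_mult leading_def)
    show "deg_le (tc (Lt g h) P) (n + 1)"
      using assms(2) deg_le_add[OF deg_le_mono[OF gP] deg_le_xi[OF deg]] by (simp add: tc_Lt)
    show "deg_le (tc (Lt g h) u) (n + 1 - 1)" if "u \<noteq> P" for u
    proof -
      have "deg_le (tc h u) (n - 1)" using assms(1) that by (simp add: leading_def)
      then have "deg_le (xi * tc h u) n" using deg_le_xi by fastforce
      then show ?thesis using deg[of "of_gen g * u"] by (auto simp: tc_Lt intro!: deg_le_add)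
    qed
    show "u \<in> Z" if "tc (Lt g h) u \<noteq> 0" for u
    proof -
      have "tc h (of_gen g * u) \<noteq> 0 \<or> tc h u \<noteq> 0" using that by (auto simp: tc_Lt split: if_splits)
      then show ?thesis using assms(1) assms(3)[of "of_gen g * u"] by (auto simp: leading_def)
    qed
  qed
qed

context special_vertex
begin

text \<open>All four letters of w_J are left descents of w_J y, so each multiplication raises the
  degree there by one. Multiplying by \<open>Tn x\<close> keeps this leading term, because no other
  element of the coset part reaches x w_J y.\<close>

lemma lookup_top_wJ:
  assumes y: "\<not> dsc a y" "\<not> dsc Gs y" and len: "len (x * (wJ a * y)) = len x + 4 + len y"
  shows "lookup (tc (hmult (Tn (x * wJ a)) (Tn (wJ a * y))) (x * (wJ a * y))) 4 = 1"
proof -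
  let ?P = "A * (S * (A * (S * y)))"
  define Z where "Z = {?P, A * (S * (A * y)), S * (A * (S * y)), A * (S * y), S * (A * y), A * y, S * y, y}"
  note XYy = XYy[OF y]
  have SP: "S * ?P = A * (S * (A * y))" using braid_A[of "S * y"] by simp
  have closed: "A * u \<in> Z" "S * u \<in> Z" if "u \<in> Z" for u
    using that SP by (auto simp: Z_def braid_A)
  have dP: "dsc a ?P" "dsc Gs ?P" using XYy unfolding dsc_A dsc_S by simp_all
  have "leading Z ?P 0 (Tn ?P)" by (auto simp: leading_def tc_Tn Z_def split: if_splits)
  then have "leading Z ?P (0 + 1 + 1 + 1 + 1) (Lt a (Lt Gs (Lt a (Lt Gs (Tn ?P)))))"
    by (intro leading_Lt dP closed)
  then have lead: "leading Z ?P 4 (Lt a (Lt Gs (Lt a (Lt Gs (Tn ?P)))))" by simp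
  let ?k = "Lt a (Lt Gs (Lt a (Lt Gs (Tn ?P))))"
  have lw: "len (wJ a) \<le> 4"
    using len_le[of "[a, Gs, a, Gs]"] by (simp add: wJ_def of_word_Cons)
  have lP: "len ?P = len y + 4" using len_wJ_y[OF y] by simp
  have "len (x * wJ a) = len x + 4"
    using len len_mult_le[of "x * wJ a" y] len_mult_le[of x "wJ a"] lw by (simp add: mult.assoc)
  then have l: "len (x * A * S * A * S) = len x + 4" by (simp add: wJ_def mult.assoc)
  have m: "len (w * of_gen g) \<le> Suc (len w)" for w g using len_mult_le[of w "of_gen g"] by simp
  have r: "\<not> rdsc x a" "\<not> rdsc (x * A) Gs" "\<not> rdsc (x * A * S) a" "\<not> rdsc (x * A * S * A) Gs"
    using l m[of x a] m[of "x * A" Gs] m[of "x * A * S" a] m[of "x * A * S * A" Gs] by linarith+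
  have "hmult (Tn (x * wJ a)) (Tn (wJ a * y)) = hmult (Tn (x * A * S * A * S)) (Tn ?P)"
    by (simp add: wJ_def mult.assoc)
  also have "\<dots> = hmult (Tn x) ?k"
    by (simp only: hmult_gen_Tn[OF r(4)] hmult_gen_Tn[OF r(3)] hmult_gen_Tn[OF r(2)] hmult_gen_Tn[OF r(1)])
  finally have eq: "hmult (Tn (x * wJ a)) (Tn (wJ a * y)) = hmult (Tn x) ?k" .
  have "?k = (\<Sum>v\<in>keys ?k. hscale (tc ?k v) (Tn v))" by (rule Tn_expand) auto
  from arg_cong[OF this, of "\<lambda>k. tc (hmult (Tn x) k) (x * ?P)"]
  have "tc (hmult (Tn x) ?k) (x * ?P) = (\<Sum>v\<in>keys ?k. tc ?k v * tc (hmult (Tn x) (Tn v)) (x * ?P))"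
    by (simp only: hlin_sum[OF hlin_hmult_right] hlin_scale[OF hlin_hmult_right] tc_sum tc_linear)
  also have "\<dots> = (\<Sum>v\<in>keys ?k. if v = ?P then tc ?k ?P else 0)"
  proof (rule sum.cong)
    fix v assume "v \<in> keys ?k"
    then have "v \<in> Z" using lead by (auto simp: leading_def tc_0_iff)
    then have "len v \<le> len ?P" using len_wJ_y[OF y] by (auto simp: Z_def)
    then have "len x + len v \<le> len (x * ?P)" using len lP by (simp add: wJ_mult)
    from tc_hmult_top[OF this] show "tc ?k v * tc (hmult (Tn x) (Tn v)) (x * ?P) = (if v = ?P then tc ?k ?P else 0)"
      by auto
  qed simp
  also have "\<dots> = tc ?k ?P"
    using lead tc_0_iff[of ?k ?P] by (auto simp: leading_def)
  finally have "tc (hmult (Tn x) ?k) (x * ?P) = tc ?k ?P" .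
  then show ?thesis using lead unfolding eq unfolding wJ_mult by (simp add: leading_def)
qed

end

lemma a_fun_not_fc:
  assumes "not_fc z"
  shows "4 \<le> a_fun z"
proof -
  obtain a x y where *: "a \<noteq> Gs" "z = x * (wJ a * y)" "len z = len x + 4 + len y"
    "\<not> dsc a y" "\<not> dsc Gs y"
    by (rule not_fc_cases[OF assms])
  interpret special_vertex a using * by unfold_locales
  have "lookup (h_const (x * wJ a) (wJ a * y) z) 4 = 1"
    unfolding h_const_4(2) using lookup_top_wJ[OF *(4,5), of x] * by simp
  then have "4 \<in> keys (h_const (x * wJ a) (wJ a * y) z)" by (simp add: in_keys_iff)
  then have "enat 4 \<le> m" if "m \<in> {enat n | n. \<forall>x y. \<forall>k\<in>keys (h_const x y z). k \<le> int n}" for m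
    using that by force
  then have "enat 4 \<le> a_fun z" unfolding a_fun_def by (rule Inf_greatest)
  then show ?thesis by (simp add: numeral_eq_enat)
qed

theorem theorem7p1:
  fixes u w :: W
  assumes "u < w"
    and "a_fun u \<in> {1, 2}"
    and "a_fun w = 4"
  shows "mu u w = (if len w - len u = 1 then 1 else 0)"
proof (cases "len w - len u = 1")
  case True
  then show ?thesis using mu_length_one[OF assms(1)] by simp
next
  case False
  have "\<not> not_fc u"
  proof
    assume "not_fc u"
    from a_fun_not_fc[OF this] assms(2) show False by (auto simp: one_enat_def numeral_eq_enat)
  qed
  moreover have "not_fc w"
  proof (rule ccontr)
    assume "\<not> not_fc w"
    from a_fun_fc[OF this] assms(3) show False by (simp add: numeral_eq_enat)
  qed
  ultimately have "mu u w = 0" using mu_not_fc[of w u] assms(1) False by fastforce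
  then show ?thesis using False by simp
qed

end
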